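(* Let $E/\mathbb{F}_q$ be an elliptic curve (of spinorial type) with a spin structure $(B,\sigma)$, where $B=\mathrm{End}(E)$. Then the Frobenius endomorphism $\tau_E:E\to E$ induces a similitude of $(B,\sigma)$.
   Context: $\mathrm{End}(E)$ denotes the $\mathbb{Q}$-algebra of endomorphisms of $E$ defined over $\mathbb{F}_q$ (endomorphism ring tensored with $\mathbb{Q}$). An involution of the first kind on an algebra is an additive anti-multiplicative map of square the identity which is the identity on the center. $E$ is of spinorial type if $\mathrm{End}(E)$ admits a non-trivial involution of the first kind (equivalently, $\mathrm{End}(E)$ is a quaternion algebra over $\mathbb{Q}$). A spin structure $(B,\sigma)$ on such an $E$ is a choice of an involution $\sigma$ of the first kind and orthogonal type on $B=\mathrm{End}(E)$; orthogonal means that over a splitting field of $B$, $\sigma$ becomes the adjoint involution of a non-degenerate symmetric bilinear form. A similitude of $(B,\sigma)$ is an element $g\in B$ such that $\sigma(g)g\in\mathbb{Q}^*$. *)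

theory Defs
  imports
    "HOL-Library.Cardinality"
    "HOL-Library.Poly_Mapping"
    "HOL-Algebra.QuotRing"
    "HOL-Algebra.Algebraic_Closure_Type"
    "Jordan_Normal_Form.Matrix"
begin

section \<open>Elliptic curves\<close>

text \<open>
  \<open>Weierstrass a1 a2 a3 a4 a6\<close> is the projective plane cubic
  \<open>Y^2 Z + a1 X Y Z + a3 Y Z^2 = X^3 + a2 X^2 Z + a4 X Z^2 + a6 Z^3\<close>
  with base point \<open>(0 : 1 : 0)\<close>, the only point of it with \<open>Z = 0\<close>.
\<close>

datatype 'a weierstrass = Weierstrass 'a 'a 'a 'a 'a

fun discriminant :: "'a::comm_ring_1 weierstrass \<Rightarrow> 'a" where
  "discriminant (Weierstrass a1 a2 a3 a4 a6) =
    (let b2 = a1^2 + 4 * a2;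
         b4 = 2 * a4 + a1 * a3;
         b6 = a3^2 + 4 * a6;
         b8 = a1^2 * a6 + 4 * a2 * a6 - a1 * a3 * a4 + a2 * a3^2 - a4^2
     in - (b2^2 * b8) - 8 * b4^3 - 27 * b6^2 + 9 * b2 * b4 * b6)"

definition elliptic_curve :: "'a::field weierstrass \<Rightarrow> bool" where
  "elliptic_curve E \<longleftrightarrow> discriminant E \<noteq> 0"

datatype 'k point = Infinity | Affine 'k 'k

fun homog_coords :: "'k::comm_ring_1 point \<Rightarrow> 'k \<times> 'k \<times> 'k" where
  "homog_coords Infinity = (0, 1, 0)"
| "homog_coords (Affine x y) = (x, y, 1)"

fun on_curve :: "'k::comm_ring_1 weierstrass \<Rightarrow> 'k point \<Rightarrow> bool" where
  "on_curve W Infinity \<longleftrightarrow> True"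
| "on_curve (Weierstrass a1 a2 a3 a4 a6) (Affine x y) \<longleftrightarrow>
     y^2 + a1 * x * y + a3 * y = x^3 + a2 * x^2 + a4 * x + a6"

text \<open>The chord-and-tangent group law, valid in every characteristic.\<close>

fun point_add :: "'k::field weierstrass \<Rightarrow> 'k point \<Rightarrow> 'k point \<Rightarrow> 'k point" where
  "point_add W Infinity Q = Q"
| "point_add W P Infinity = P"
| "point_add (Weierstrass a1 a2 a3 a4 a6) (Affine x1 y1) (Affine x2 y2) =
    (if x1 = x2 \<and> y1 + y2 + a1 * x2 + a3 = 0 then Infinity
     else
       let l = (if x1 = x2
                then (3 * x1^2 + 2 * a2 * x1 + a4 - a1 * y1) / (2 * y1 + a1 * x1 + a3)
                else (y2 - y1) / (x2 - x1));
           x3 = l^2 + a1 * l - a2 - x1 - x2;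
           y3 = - (l + a1) * x3 - (y1 - l * x1) - a3
       in Affine x3 y3)"

definition geometric_curve :: "'a::field weierstrass \<Rightarrow> 'a alg_closure weierstrass" where
  "geometric_curve E = map_weierstrass to_ac E"

definition geometric_points :: "'a::field weierstrass \<Rightarrow> 'a alg_closure point set" where
  "geometric_points E = {P. on_curve (geometric_curve E) P}"

section \<open>Endomorphisms defined over the base field\<close>

text \<open>The ternary form of degree \<open>d\<close> with coefficient \<open>c i j\<close> at \<open>x^i y^j z^(d - i - j)\<close>.\<close>

fun ternary_form :: "nat \<Rightarrow> (nat \<Rightarrow> nat \<Rightarrow> 'k::comm_ring_1) \<Rightarrow> 'k \<times> 'k \<times> 'k \<Rightarrow> 'k" where
  "ternary_form d c (x, y, z) = (\<Sum>i\<le>d. \<Sum>j\<le>d - i. c i j * x^i * y^j * z^(d - i - j))"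

text \<open>
  A map on geometric points is a morphism over the base field if around every point it is
  given, in homogeneous coordinates, by three forms of equal degree with coefficients in the
  base field.  As the curve is irreducible, it is no restriction to ask that the forms describe
  the map wherever they do not vanish simultaneously.
\<close>

definition morphism_over_base ::
  "'a::field weierstrass \<Rightarrow> ('a alg_closure point \<Rightarrow> 'a alg_closure point) \<Rightarrow> bool" where
  "morphism_over_base E f \<longleftrightarrow>
    f \<in> geometric_points E \<rightarrow> geometric_points E \<and>
    (\<forall>P\<in>geometric_points E. \<exists>d c1 c2 c3.
      let F = (\<lambda>c Q. ternary_form d (\<lambda>i j. to_ac (c i j)) (homog_coords Q));
          \<Phi> = (\<lambda>Q. (F c1 Q, F c2 Q, F c3 Q))
      in \<Phi> P \<noteq> (0, 0, 0) \<and>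
         (\<forall>Q\<in>geometric_points E. \<Phi> Q \<noteq> (0, 0, 0) \<longrightarrow>
            (\<exists>l. l \<noteq> 0 \<and>
              (case homog_coords (f Q) of (x, y, z) \<Rightarrow> \<Phi> Q = (l * x, l * y, l * z)))))"

text \<open>
  The endomorphisms are the isogenies in the usual sense together with the zero map: a morphism
  that fixes the base point is automatically a group homomorphism.
\<close>

definition End_ring ::
  "'a::field weierstrass \<Rightarrow> ('a alg_closure point \<Rightarrow> 'a alg_closure point) ring" where
  "End_ring E =
    \<lparr>carrier = {f \<in> extensional (geometric_points E). morphism_over_base E f \<and> f Infinity = Infinity},
     monoid.mult = compose (geometric_points E),
     one = (\<lambda>P\<in>geometric_points E. P),
     zero = (\<lambda>P\<in>geometric_points E. Infinity),
     add = (\<lambda>f g. \<lambda>P\<in>geometric_points E. point_add (geometric_curve E) (f P) (g P))\<rparr>"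

fun frobenius_point :: "'a::{field,finite} alg_closure point \<Rightarrow> 'a alg_closure point" where
  "frobenius_point Infinity = Infinity"
| "frobenius_point (Affine x y) = Affine (x ^ CARD('a)) (y ^ CARD('a))"

definition frobenius ::
  "'a::{field,finite} weierstrass \<Rightarrow> 'a alg_closure point \<Rightarrow> 'a alg_closure point" where
  "frobenius E = (\<lambda>P\<in>geometric_points E. frobenius_point P)"

section \<open>Extension of scalars\<close>

text \<open>
  Let \<open>C\<close> be a commutative ring (here a type), \<open>R\<close> a \<open>C\<close>-algebra with structure map
  \<open>i : C \<rightarrow> R\<close> and \<open>S\<close> a commutative \<open>C\<close>-algebra (also a type) with structure map
  \<open>j : C \<rightarrow> S\<close>.  The tensor product of \<open>R\<close> and \<open>S\<close> over \<open>C\<close> is built as usual: the free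
  abelian group on the pairs \<open>(r, s)\<close>, with \<open>(r, s) (r', s') = (r r', s s')\<close>, modulo the
  relations of biadditivity and \<open>C\<close>-balancedness.
\<close>

definition tensor_free_ring :: "('r, 'm) ring_scheme \<Rightarrow> ('r \<times> 's::comm_ring_1 \<Rightarrow>\<^sub>0 int) ring" where
  "tensor_free_ring R =
    \<lparr>carrier = {u. Poly_Mapping.keys u \<subseteq> carrier R \<times> UNIV},
     monoid.mult = (\<lambda>u v. frag_extend (\<lambda>(r, s).
       frag_extend (\<lambda>(r', s'). frag_of (r \<otimes>\<^bsub>R\<^esub> r', s * s')) v) u),
     one = frag_of (\<one>\<^bsub>R\<^esub>, 1),
     zero = 0,
     add = (+)\<rparr>"

definition tensor_relations ::
  "('r, 'm) ring_scheme \<Rightarrow> ('c \<Rightarrow> 'r) \<Rightarrow> ('c \<Rightarrow> 's::comm_ring_1) \<Rightarrow> ('r \<times> 's \<Rightarrow>\<^sub>0 int) set" where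
  "tensor_relations R i j =
     {frag_of (r \<oplus>\<^bsub>R\<^esub> r', s) - frag_of (r, s) - frag_of (r', s) | r r' s.
        r \<in> carrier R \<and> r' \<in> carrier R}
   \<union> {frag_of (r, s + s') - frag_of (r, s) - frag_of (r, s') | r s s'. r \<in> carrier R}
   \<union> {frag_of (i c \<otimes>\<^bsub>R\<^esub> r, s) - frag_of (r, j c * s) | c r s. r \<in> carrier R}"

definition tensor_ideal ::
  "('r, 'm) ring_scheme \<Rightarrow> ('c \<Rightarrow> 'r) \<Rightarrow> ('c \<Rightarrow> 's::comm_ring_1) \<Rightarrow> ('r \<times> 's \<Rightarrow>\<^sub>0 int) set" where
  "tensor_ideal R i j = genideal (tensor_free_ring R) (tensor_relations R i j)"

definition scalar_extension ::
  "('r, 'm) ring_scheme \<Rightarrow> ('c \<Rightarrow> 'r) \<Rightarrow> ('c \<Rightarrow> 's::comm_ring_1) \<Rightarrow> ('r \<times> 's \<Rightarrow>\<^sub>0 int) set ring" where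
  "scalar_extension R i j = tensor_free_ring R Quot tensor_ideal R i j"

definition pure_tensor ::
  "('r, 'm) ring_scheme \<Rightarrow> ('c \<Rightarrow> 'r) \<Rightarrow> ('c \<Rightarrow> 's::comm_ring_1) \<Rightarrow> 'r \<Rightarrow> 's \<Rightarrow> ('r \<times> 's \<Rightarrow>\<^sub>0 int) set"
  where
  "pure_tensor R i j r s = tensor_ideal R i j +>\<^bsub>tensor_free_ring R\<^esub> frag_of (r, s)"

text \<open>The map on the tensor product induced by a \<open>C\<close>-linear map \<open>h : R \<rightarrow> R\<close>.\<close>

definition tensor_map ::
  "('r, 'm) ring_scheme \<Rightarrow> ('c \<Rightarrow> 'r) \<Rightarrow> ('c \<Rightarrow> 's::comm_ring_1) \<Rightarrow> ('r \<Rightarrow> 'r)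
    \<Rightarrow> ('r \<times> 's \<Rightarrow>\<^sub>0 int) set \<Rightarrow> ('r \<times> 's \<Rightarrow>\<^sub>0 int) set" where
  "tensor_map R i j h t =
    (\<Union>u\<in>t. tensor_ideal R i j +>\<^bsub>tensor_free_ring R\<^esub> frag_extend (\<lambda>(r, s). frag_of (h r, s)) u)"

section \<open>Involutions and similitudes of algebras over the rationals\<close>

definition center :: "('r, 'm) ring_scheme \<Rightarrow> 'r set" where
  "center B = {z \<in> carrier B. \<forall>x\<in>carrier B. z \<otimes>\<^bsub>B\<^esub> x = x \<otimes>\<^bsub>B\<^esub> z}"

definition involution_first_kind :: "('r, 'm) ring_scheme \<Rightarrow> ('r \<Rightarrow> 'r) \<Rightarrow> bool" where
  "involution_first_kind B \<sigma> \<longleftrightarrow>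
    \<sigma> \<in> carrier B \<rightarrow> carrier B \<and>
    (\<forall>x\<in>carrier B. \<forall>y\<in>carrier B. \<sigma> (x \<oplus>\<^bsub>B\<^esub> y) = \<sigma> x \<oplus>\<^bsub>B\<^esub> \<sigma> y) \<and>
    (\<forall>x\<in>carrier B. \<forall>y\<in>carrier B. \<sigma> (x \<otimes>\<^bsub>B\<^esub> y) = \<sigma> y \<otimes>\<^bsub>B\<^esub> \<sigma> x) \<and>
    (\<forall>x\<in>carrier B. \<sigma> (\<sigma> x) = x) \<and>
    (\<forall>z\<in>center B. \<sigma> z = z)"

definition nondegenerate_symmetric_bilinear_form ::
  "nat \<Rightarrow> ('k::field vec \<Rightarrow> 'k vec \<Rightarrow> 'k) \<Rightarrow> bool" where
  "nondegenerate_symmetric_bilinear_form n b \<longleftrightarrow>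
    (\<forall>x\<in>carrier_vec n. \<forall>y\<in>carrier_vec n. \<forall>z\<in>carrier_vec n. b (x + y) z = b x z + b y z) \<and>
    (\<forall>a. \<forall>x\<in>carrier_vec n. \<forall>y\<in>carrier_vec n. b (a \<cdot>\<^sub>v x) y = a * b x y) \<and>
    (\<forall>x\<in>carrier_vec n. \<forall>y\<in>carrier_vec n. b x y = b y x) \<and>
    (\<forall>x\<in>carrier_vec n. (\<forall>y\<in>carrier_vec n. b x y = 0) \<longrightarrow> x = 0\<^sub>v n)"

text \<open>
  \<open>B\<close> is an algebra over the rationals with structure map \<open>i\<close>.  An isomorphism of
  \<open>K\<close>-algebras from the scalar extension of \<open>B\<close> to \<open>K\<close> onto the \<open>n \<times> n\<close> matrices over \<open>K\<close>
  exists for some \<open>n > 0\<close> exactly if \<open>K\<close> is a splitting field of \<open>B\<close>.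
\<close>

definition splitting ::
  "('r, 'm) ring_scheme \<Rightarrow> (rat \<Rightarrow> 'r) \<Rightarrow> nat \<Rightarrow>
    (('r \<times> 'k::field_char_0 \<Rightarrow>\<^sub>0 int) set \<Rightarrow> 'k mat) \<Rightarrow> bool" where
  "splitting B i n \<phi> \<longleftrightarrow>
    0 < n \<and>
    \<phi> \<in> ring_iso (scalar_extension B i (of_rat :: rat \<Rightarrow> 'k)) (ring_mat TYPE('k) n ()) \<and>
    (\<forall>k. \<phi> (pure_tensor B i of_rat \<one>\<^bsub>B\<^esub> k) = k \<cdot>\<^sub>m 1\<^sub>m n)"

definition orthogonal_involution ::
  "'k::field_char_0 itself \<Rightarrow> ('r, 'm) ring_scheme \<Rightarrow> (rat \<Rightarrow> 'r) \<Rightarrow> ('r \<Rightarrow> 'r) \<Rightarrow> bool" where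
  "orthogonal_involution (_ :: 'k itself) B i \<sigma> \<longleftrightarrow>
    involution_first_kind B \<sigma> \<and>
    (\<exists>n (\<phi> :: ('r \<times> 'k \<Rightarrow>\<^sub>0 int) set \<Rightarrow> 'k mat) b.
      splitting B i n \<phi> \<and>
      nondegenerate_symmetric_bilinear_form n b \<and>
      (\<forall>t\<in>carrier (scalar_extension B i (of_rat :: rat \<Rightarrow> 'k)).
        \<forall>x\<in>carrier_vec n. \<forall>y\<in>carrier_vec n.
          b (\<phi> t *\<^sub>v x) y = b x (\<phi> (tensor_map B i of_rat \<sigma> t) *\<^sub>v y)))"

definition similitude :: "('r, 'm) ring_scheme \<Rightarrow> (rat \<Rightarrow> 'r) \<Rightarrow> ('r \<Rightarrow> 'r) \<Rightarrow> 'r \<Rightarrow> bool" where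
  "similitude B i \<sigma> g \<longleftrightarrow> g \<in> carrier B \<and> \<sigma> g \<otimes>\<^bsub>B\<^esub> g \<in> i ` (UNIV - {0})"

section \<open>Spin structures on elliptic curves\<close>

type_synonym 'a End_algebra_elem =
  "(('a alg_closure point \<Rightarrow> 'a alg_closure point) \<times> rat \<Rightarrow>\<^sub>0 int) set"

definition End_of_int ::
  "'a::field weierstrass \<Rightarrow> int \<Rightarrow> 'a alg_closure point \<Rightarrow> 'a alg_closure point" where
  "End_of_int E m = [m] \<cdot>\<^bsub>End_ring E\<^esub> \<one>\<^bsub>End_ring E\<^esub>"

definition End_algebra :: "'a::field weierstrass \<Rightarrow> 'a End_algebra_elem ring" where
  "End_algebra E = scalar_extension (End_ring E) (End_of_int E) (of_int :: int \<Rightarrow> rat)"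

definition End_algebra_of_rat :: "'a::field weierstrass \<Rightarrow> rat \<Rightarrow> 'a End_algebra_elem" where
  "End_algebra_of_rat E r = pure_tensor (End_ring E) (End_of_int E) of_int \<one>\<^bsub>End_ring E\<^esub> r"

definition End_to_End_algebra ::
  "'a::field weierstrass \<Rightarrow> ('a alg_closure point \<Rightarrow> 'a alg_closure point) \<Rightarrow> 'a End_algebra_elem"
  where
  "End_to_End_algebra E f = pure_tensor (End_ring E) (End_of_int E) of_int f 1"

definition spinorial_type :: "'a::field weierstrass \<Rightarrow> bool" where
  "spinorial_type E \<longleftrightarrow>
    (\<exists>\<sigma>. involution_first_kind (End_algebra E) \<sigma> \<and> (\<exists>x\<in>carrier (End_algebra E). \<sigma> x \<noteq> x))"

text \<open>
  Whether an involution is orthogonal does not depend on the splitting field; the type \<open>'k\<close> is the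
  one used to witness it.
\<close>

definition spin_structure ::
  "'k::field_char_0 itself \<Rightarrow> 'a::field weierstrass \<Rightarrow>
    ('a End_algebra_elem \<Rightarrow> 'a End_algebra_elem) \<Rightarrow> bool" where
  "spin_structure k E \<sigma> \<longleftrightarrow> orthogonal_involution k (End_algebra E) (End_algebra_of_rat E) \<sigma>"

end

theory Submission
  imports Defs "HOL-Algebra.Free_Abelian_Groups" "HOL-Algebra.Sylow"
    "HOL-Computational_Algebra.Formal_Laurent_Series"
begin

text \<open>
  Write \<open>B\<close> for the endomorphism algebra of \<open>E\<close> tensored with the rationals and \<open>\<tau>\<close> for the Frobenius.
  A morphism defined over the base field has coefficients fixed by the \<open>q\<close>-th power map, so \<open>\<tau>\<close> commutes
  with every endomorphism and is central in \<open>B\<close>.  A spin structure comes with a splitting of \<open>B\<close>, which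
  forces the center of \<open>B\<close> to consist of the rationals (\<open>center_eq_rationals\<close>).  Hence \<open>\<tau> = r\<close> for a
  rational \<open>r\<close>, the involution fixes \<open>\<tau>\<close>, and \<open>\<sigma>(\<tau>) \<tau> = r^2\<close>.  What remains is \<open>r \<noteq> 0\<close>.

  For this it suffices that \<open>\<tau>\<close> divides a power of the characteristic \<open>p\<close>: there is an endomorphism
  \<open>V\<close>, the Verschiebung, with \<open>\<tau> V = [p]^n\<close> where \<open>q = p^n\<close> (\<open>Verschiebung_exists\<close>), and \<open>p^n\<close> is
  invertible in \<open>B\<close>.  As \<open>\<tau>\<close> is bijective on geometric points, \<open>V\<close> exists as a map, and the question is
  whether it is a morphism, that is, whether \<open>[p]^n\<close> is given by \<open>q\<close>-th powers of forms.

  The generic point of \<open>E\<close> is expanded at the base point into Laurent series over the finite field,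
  where the derivative of power series is available.  If \<open>(x, y)\<close> is a point over the Laurent series
  with \<open>dx = \<omega> (2 y + a1 x + a3)\<close>, then \<open>\<omega>\<close> is additive under the chord and tangent law
  (\<open>point_add_differential\<close>), so the coordinates of the \<open>p\<close>-th multiple of the generic point have
  derivative \<open>0\<close>.  A regular function with derivative \<open>0\<close> is a \<open>p\<close>-th power of a regular function
  (\<open>regular_p_th_root\<close>): its pole order is divisible by \<open>p\<close>, and subtracting the \<open>p\<close>-th power of a
  monomial lowers the pole order, except that there is no monomial with a pole of order \<open>1\<close>; but a
  function with derivative \<open>0\<close> and a pole of order \<open>p\<close> would give a polynomial parametrization of a
  nonsingular cubic.  Clearing denominators in local forms for \<open>[p]\<close> turns this into local forms whose
  \<open>p\<close>-th powers describe \<open>[p]\<close>, and composing \<open>n\<close> twists of them yields \<open>V\<close>.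

  That sums and composites of endomorphisms are endomorphisms is read off from the hypotheses:
  the tensor product is a quotient of a free ring by the ideal that its relations generate, and it would
  have a single element if the relations did not all lie in that ring (\<open>relations_in_proper_ideal\<close>).
\<close>

section \<open>Tensor products that are not the zero ring\<close>

lemma tensor_free_ring_simps [simp]:
  "carrier (tensor_free_ring R) = {u. Poly_Mapping.keys u \<subseteq> carrier R \<times> UNIV}"
  "u \<otimes>\<^bsub>tensor_free_ring R\<^esub> v =
    frag_extend (\<lambda>(r, s). frag_extend (\<lambda>(r', s'). frag_of (r \<otimes>\<^bsub>R\<^esub> r', s * s')) v) u"
  "\<one>\<^bsub>tensor_free_ring R\<^esub> = frag_of (\<one>\<^bsub>R\<^esub>, 1)"
  "\<zero>\<^bsub>tensor_free_ring R\<^esub> = 0"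
  "u \<oplus>\<^bsub>tensor_free_ring R\<^esub> v = u + v"
  by (simp_all add: tensor_free_ring_def)

lemma tensor_relationsI:
  "r \<in> carrier R \<Longrightarrow> r' \<in> carrier R \<Longrightarrow>
    frag_of (r \<oplus>\<^bsub>R\<^esub> r', s) - frag_of (r, s) - frag_of (r', s) \<in> tensor_relations R i j"
  "r \<in> carrier R \<Longrightarrow>
    frag_of (r, s + s') - frag_of (r, s) - frag_of (r, s') \<in> tensor_relations R i j"
proof -
  show "frag_of (r \<oplus>\<^bsub>R\<^esub> r', s) - frag_of (r, s) - frag_of (r', s) \<in> tensor_relations R i j"
    if "r \<in> carrier R" "r' \<in> carrier R"
    unfolding tensor_relations_def by (rule UnI1, rule UnI1, rule CollectI, rule exI[of _ r], rule exI[of _ r'], rule exI[of _ s]) (simp add: that)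
  show "frag_of (r, s + s') - frag_of (r, s) - frag_of (r, s') \<in> tensor_relations R i j"
    if "r \<in> carrier R"
    unfolding tensor_relations_def by (rule UnI1, rule UnI2, rule CollectI, rule exI[of _ r], rule exI[of _ s], rule exI[of _ s']) (simp add: that)
qed

lemma tensor_relationsE:
  assumes "u \<in> tensor_relations R i j"
  obtains (left) r r' s where "r \<in> carrier R" "r' \<in> carrier R"
      "u = frag_of (r \<oplus>\<^bsub>R\<^esub> r', s) - frag_of (r, s) - frag_of (r', s)"
    | (right) r s s' where "r \<in> carrier R"
      "u = frag_of (r, s + s') - frag_of (r, s) - frag_of (r, s')"
    | (balanced) c r s where "r \<in> carrier R"
      "u = frag_of (i c \<otimes>\<^bsub>R\<^esub> r, s) - frag_of (r, j c * s)"
  using assms unfolding tensor_relations_def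
  by (elim UnE CollectE exE conjE) (erule (2) left, erule (1) right, erule (1) balanced)

text \<open>
  The free ring on the pairs is a ring, and contains the relations, only if the given structure is closed
  under its operations.  Otherwise no ideal contains the relations, the intersection of all such ideals
  is the whole type, and the quotient has a single element.  So a second element of the quotient is
  enough to conclude that the quotient is a ring in which the relations hold, and even that the given
  structure is closed under its operations.
\<close>

locale nontrivial_scalar_extension =
  fixes R :: "('r, 'm) ring_scheme" and i :: "'c \<Rightarrow> 'r" and j :: "'c \<Rightarrow> 's::comm_ring_1"
  assumes nontrivial: "\<not> carrier (scalar_extension R i j) \<subseteq> {t}"
begin

abbreviation "F \<equiv> (tensor_free_ring R :: ('r \<times> 's \<Rightarrow>\<^sub>0 int) ring)"
abbreviation "I \<equiv> tensor_ideal R i j"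
abbreviation "S \<equiv> scalar_extension R i j"
abbreviation "T \<equiv> pure_tensor R i j"

lemma relations_in_proper_ideal: "\<exists>J. ideal J F \<and> tensor_relations R i j \<subseteq> J"
proof (rule ccontr)
  assume "\<not> ?thesis"
  then have "{J. ideal J F \<and> tensor_relations R i j \<subseteq> J} = {}" by blast
  then have I: "I = UNIV"
    unfolding tensor_ideal_def genideal_def by (simp only: Inter_empty)
  have coset: "I +>\<^bsub>F\<^esub> u = UNIV" for u
  proof -
    have "v \<in> I +>\<^bsub>F\<^esub> u" for v
      unfolding a_r_coset_def' I by (auto intro!: exI[of _ "v - u"])
    then show ?thesis by blast
  qed
  have "carrier S \<subseteq> {UNIV}"
    by (auto simp: scalar_extension_def FactRing_def A_RCOSETS_def' coset)
  with nontrivial show False by blast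
qed

lemma ring_F: "ring F"
  using relations_in_proper_ideal ideal.axioms(2) by blast

lemma relations_carrier: "tensor_relations R i j \<subseteq> carrier F"
proof -
  obtain J where J: "ideal J F" "tensor_relations R i j \<subseteq> J" using relations_in_proper_ideal by blast
  show ?thesis using ideal.Icarr[OF J(1)] J(2) by (auto simp del: tensor_free_ring_simps)
qed

lemma ideal_I: "ideal I F"
  unfolding tensor_ideal_def by (rule ring.genideal_ideal[OF ring_F relations_carrier])

lemma relations_I: "tensor_relations R i j \<subseteq> I"
  unfolding tensor_ideal_def by (rule ring.genideal_self[OF ring_F relations_carrier])

lemma I_least: "ideal J F \<Longrightarrow> tensor_relations R i j \<subseteq> J \<Longrightarrow> I \<subseteq> J"
  unfolding tensor_ideal_def by (rule ring.genideal_minimal[OF ring_F])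

lemma ring_S: "ring S"
  unfolding scalar_extension_def by (rule ideal.quotient_is_ring[OF ideal_I])

lemma frag_of_in_F: "r \<in> carrier R \<Longrightarrow> frag_of (r, s) \<in> carrier F"
  by (simp add: keys_frag_of)

lemma add_F: "u \<in> carrier F \<Longrightarrow> v \<in> carrier F \<Longrightarrow> u + v \<in> carrier F"
  using ring.ring_simprules(1)[OF ring_F, of u v] by (simp only: tensor_free_ring_simps(5))

lemma minus_F: assumes "u \<in> carrier F" "v \<in> carrier F"
  shows "u \<ominus>\<^bsub>F\<^esub> v = u - v"
proof -
  interpret F: ring F by (rule ring_F)
  have "- v \<in> carrier F" using assms by simp
  moreover have "v + - v = 0" by simp
  ultimately have "\<ominus>\<^bsub>F\<^esub> v = - v"
    using assms by (intro F.minus_equality) (simp_all add: add.commute)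
  then show ?thesis by (simp add: a_minus_def)
qed

lemma coset_eq_iff:
  assumes "u \<in> carrier F" "v \<in> carrier F"
  shows "I +>\<^bsub>F\<^esub> u = I +>\<^bsub>F\<^esub> v \<longleftrightarrow> u - v \<in> I"
  using ring.quotient_eq_iff_same_a_r_cos[OF ring_F ideal_I assms] minus_F[OF assms] by simp

lemma carrier_S: "carrier S = (\<lambda>u. I +>\<^bsub>F\<^esub> u) ` carrier F"
  by (auto simp: scalar_extension_def FactRing_def A_RCOSETS_def')

lemma coset_mult:
  assumes "u \<in> carrier F" "v \<in> carrier F"
  shows "(I +>\<^bsub>F\<^esub> u) \<otimes>\<^bsub>S\<^esub> (I +>\<^bsub>F\<^esub> v) = I +>\<^bsub>F\<^esub> (u \<otimes>\<^bsub>F\<^esub> v)"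
  using ideal.rcoset_mult_add[OF ideal_I assms]
  by (simp add: scalar_extension_def FactRing_def)

lemma coset_add:
  assumes "u \<in> carrier F" "v \<in> carrier F"
  shows "(I +>\<^bsub>F\<^esub> u) \<oplus>\<^bsub>S\<^esub> (I +>\<^bsub>F\<^esub> v) = I +>\<^bsub>F\<^esub> (u + v)"
  using abelian_subgroup.a_rcos_sum[OF abelian_subgroupI3[OF ideal.axioms(1)[OF ideal_I] 
     ring.is_abelian_group[OF ring_F]] assms]
  by (simp add: scalar_extension_def FactRing_def)

lemma one_S: "\<one>\<^bsub>S\<^esub> = T \<one>\<^bsub>R\<^esub> 1"
  by (simp add: scalar_extension_def FactRing_def pure_tensor_def)

lemma one_closed: "\<one>\<^bsub>R\<^esub> \<in> carrier R"
  using monoid.one_closed[OF ring.is_monoid[OF ring_F]] by (simp add: keys_frag_of)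

lemma mult_closed:
  assumes "r \<in> carrier R" "r' \<in> carrier R" shows "r \<otimes>\<^bsub>R\<^esub> r' \<in> carrier R"
  using monoid.m_closed[OF ring.is_monoid[OF ring_F] frag_of_in_F[OF assms(1), of 1] frag_of_in_F[OF assms(2), of 1]]
  by (simp add: keys_frag_of)

lemma add_closed:
  assumes "r \<in> carrier R" "r' \<in> carrier R" shows "r \<oplus>\<^bsub>R\<^esub> r' \<in> carrier R"
proof -
  let ?u = "frag_of (r \<oplus>\<^bsub>R\<^esub> r', 1 :: 's) - frag_of (r, 1) - frag_of (r', 1)"
  have "?u \<in> tensor_relations R i j" by (intro tensor_relationsI assms)
  then have "?u \<in> carrier F" using relations_carrier by blast
  then have "?u + frag_of (r, 1) + frag_of (r', 1) \<in> carrier F"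
    by (intro add_F frag_of_in_F assms)
  then show ?thesis by (simp add: keys_frag_of)
qed

lemma T_closed: "r \<in> carrier R \<Longrightarrow> T r s \<in> carrier S"
  using frag_of_in_F by (auto simp: carrier_S pure_tensor_def)

lemma T_mult:
  assumes "r \<in> carrier R" "r' \<in> carrier R"
  shows "T r s \<otimes>\<^bsub>S\<^esub> T r' s' = T (r \<otimes>\<^bsub>R\<^esub> r') (s * s')"
  unfolding pure_tensor_def using coset_mult[OF frag_of_in_F frag_of_in_F] assms by simp

lemma T_add_left:
  assumes "r \<in> carrier R" "r' \<in> carrier R"
  shows "T (r \<oplus>\<^bsub>R\<^esub> r') s = T r s \<oplus>\<^bsub>S\<^esub> T r' s"
proof -
  let ?u = "frag_of (r \<oplus>\<^bsub>R\<^esub> r', s)" and ?v = "frag_of (r, s)" and ?w = "frag_of (r', s)"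
  have in_F: "?u \<in> carrier F" "?v \<in> carrier F" "?w \<in> carrier F"
    by (intro frag_of_in_F add_closed assms)+
  have "?u - ?v - ?w \<in> I"
    by (intro subsetD[OF relations_I] tensor_relationsI assms)
  then have "?u - (?v + ?w) \<in> I" by (simp only: diff_diff_eq)
  then show ?thesis
    unfolding pure_tensor_def coset_add[OF in_F(2,3)] coset_eq_iff[OF in_F(1) add_F[OF in_F(2,3)]] .
qed

lemma T_add_right:
  assumes "r \<in> carrier R"
  shows "T r (s + s') = T r s \<oplus>\<^bsub>S\<^esub> T r s'"
proof -
  let ?u = "frag_of (r, s + s')" and ?v = "frag_of (r, s)" and ?w = "frag_of (r, s')"
  have in_F: "?u \<in> carrier F" "?v \<in> carrier F" "?w \<in> carrier F"
    by (intro frag_of_in_F assms)+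
  have "?u - ?v - ?w \<in> I"
    by (intro subsetD[OF relations_I] tensor_relationsI assms)
  then have "?u - (?v + ?w) \<in> I" by (simp only: diff_diff_eq)
  then show ?thesis
    unfolding pure_tensor_def coset_add[OF in_F(2,3)] coset_eq_iff[OF in_F(1) add_F[OF in_F(2,3)]] .
qed

lemma self_add_imp_zero:
  assumes "x \<in> carrier S" "x = x \<oplus>\<^bsub>S\<^esub> x" shows "x = \<zero>\<^bsub>S\<^esub>"
proof -
  interpret S: ring S by (rule ring_S)
  show ?thesis using assms S.add.r_cancel_one[of x x] by simp
qed

lemma T_zero_right: "r \<in> carrier R \<Longrightarrow> T r 0 = \<zero>\<^bsub>S\<^esub>"
  by (rule self_add_imp_zero[OF T_closed]) (simp_all flip: T_add_right)

lemma one_not_zero_S: "\<one>\<^bsub>S\<^esub> \<noteq> \<zero>\<^bsub>S\<^esub>"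
proof
  assume eq: "\<one>\<^bsub>S\<^esub> = \<zero>\<^bsub>S\<^esub>"
  interpret S: ring S by (rule ring_S)
  have "x = \<zero>\<^bsub>S\<^esub>" if "x \<in> carrier S" for x
    using S.l_one[OF that] S.l_null[OF that] by (simp add: eq)
  with nontrivial[of "\<zero>\<^bsub>S\<^esub>"] show False by blast
qed

text \<open>
  On the free ring both products with \<open>(z, s)\<close> are sums over the same generators, so centrality holds
  before passing to the quotient.
\<close>

lemma central_T:
  assumes "z \<in> carrier R" "\<And>r. r \<in> carrier R \<Longrightarrow> z \<otimes>\<^bsub>R\<^esub> r = r \<otimes>\<^bsub>R\<^esub> z"
  shows "T z s \<in> center S"
proof -
  have "frag_of (z, s) \<otimes>\<^bsub>F\<^esub> u = u \<otimes>\<^bsub>F\<^esub> frag_of (z, s)" if "u \<in> carrier F" for u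
    using that assms(2) unfolding tensor_free_ring_simps mem_Collect_eq
    by (auto intro!: frag_extend_eq simp: mult.commute)
  then show ?thesis
    unfolding center_def using T_closed[OF assms(1)]
    by (auto simp: carrier_S pure_tensor_def coset_mult frag_of_in_F[OF assms(1)] 
       simp del: tensor_free_ring_simps)
qed

end

section \<open>The center of a split algebra over the rationals\<close>

text \<open>
  A projection of \<open>'k\<close> onto its prime field, linear over the rationals.  It makes it possible to return
  from the scalar extension of an algebra to the algebra.
\<close>

lemma rat_linear_projection:
  obtains \<pi> :: "'k::field_char_0 \<Rightarrow> rat" where
    "\<And>a b. \<pi> (a + b) = \<pi> a + \<pi> b" "\<And>c a. \<pi> (of_rat c * a) = c * \<pi> a" "\<pi> 1 = 1"
proof -
  interpret K: vector_space "\<lambda>(c::rat) (k::'k). of_rat c * k"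
    by standard (simp_all add: algebra_simps of_rat_add of_rat_mult)
  interpret Q: vector_space "\<lambda>(c::rat) (d::rat). c * d"
    by standard (simp_all add: algebra_simps)
  interpret KQ: vector_space_pair "\<lambda>(c::rat) (k::'k). of_rat c * k" "\<lambda>(c::rat) (d::rat). c * d"
    by standard
  have "K.independent {1}"
    by (simp add: K.dependent_single)
  from KQ.linear_independent_extend[OF this, of "\<lambda>_. 1"]
  obtain g where g: "Vector_Spaces.linear (\<lambda>(c::rat) (k::'k). of_rat c * k) (\<lambda>(c::rat) (d::rat). c * d) g" "g 1 = 1"
    by auto
  interpret g: Vector_Spaces.linear "\<lambda>(c::rat) (k::'k). of_rat c * k" "\<lambda>(c::rat) (d::rat). c * d" g by fact
  show thesis
    by (rule that[of g]) (simp_all add: g.add g.scale g(2))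
qed

lemma central_matrix_scalar:
  fixes A :: "'k::field mat"
  assumes A: "A \<in> carrier_mat n n" and comm: "\<And>M. M \<in> carrier_mat n n \<Longrightarrow> A * M = M * A"
  obtains k where "A = k \<cdot>\<^sub>m 1\<^sub>m n"
proof (rule that, rule eq_matI)
  fix a b assume "a < dim_row (A $$ (0,0) \<cdot>\<^sub>m 1\<^sub>m n)" "b < dim_col (A $$ (0,0) \<cdot>\<^sub>m 1\<^sub>m n)"
  then have ab: "a < n" "b < n" by auto
  \<comment> \<open>Comparing the entries of the products with the matrix unit that has its one in position \<open>(b, 0)\<close>.\<close>
  define M where "M = mat n n (\<lambda>(i, j). if i = b \<and> j = 0 then 1 else 0 :: 'k)"
  have M: "M \<in> carrier_mat n n" by (simp add: M_def)
  have "A $$ (a, b) = (A * M) $$ (a, 0)"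
    using ab A by (simp add: M_def scalar_prod_def if_distrib[of "\<lambda>x. _ * x"] cong: if_cong)
  also have "\<dots> = (M * A) $$ (a, 0)" using comm[OF M] by simp
  also have "\<dots> = (if a = b then A $$ (0, 0) else 0)"
    using ab A by (simp add: M_def scalar_prod_def if_distrib[of "\<lambda>x. x * _"] cong: if_cong)
  finally show "A $$ (a, b) = (A $$ (0,0) \<cdot>\<^sub>m 1\<^sub>m n) $$ (a, b)" using ab by simp
qed (use A in auto)

locale split_rational_algebra = B: ring B for B :: "('r, 'm) ring_scheme" (structure) +
  fixes i :: "rat \<Rightarrow> 'r" and n :: nat and \<phi> :: "('r \<times> 'k::field_char_0 \<Rightarrow>\<^sub>0 int) set \<Rightarrow> 'k mat"
  assumes i_closed [simp]: "i c \<in> carrier B"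
    and i_add: "i (c + d) = i c \<oplus> i d"
    and i_mult: "i (c * d) = i c \<otimes> i d"
    and i_one: "i 1 = \<one>"
    and i_central: "x \<in> carrier B \<Longrightarrow> i c \<otimes> x = x \<otimes> i c"
    and split: "splitting B i n \<phi>"
begin

lemma phi_iso: "\<phi> \<in> ring_iso (scalar_extension B i (of_rat :: rat \<Rightarrow> 'k)) (ring_mat TYPE('k) n ())"
  and n_pos: "0 < n" and phi_scalar: "\<phi> (pure_tensor B i of_rat \<one> k) = k \<cdot>\<^sub>m 1\<^sub>m n"
  using split by (auto simp: splitting_def)

lemma phi_bij: "bij_betw \<phi> (carrier (scalar_extension B i (of_rat :: rat \<Rightarrow> 'k))) (carrier_mat n n)"
  using phi_iso by (simp add: ring_iso_def ring_mat_simps)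

sublocale BK: nontrivial_scalar_extension B i "of_rat :: rat \<Rightarrow> 'k"
proof
  fix t
  show "\<not> carrier (scalar_extension B i (of_rat :: rat \<Rightarrow> 'k)) \<subseteq> {t}"
  proof
    assume sub: "carrier (scalar_extension B i (of_rat :: rat \<Rightarrow> 'k)) \<subseteq> {t}"
    have "\<phi> ` carrier (scalar_extension B i (of_rat :: rat \<Rightarrow> 'k)) = carrier_mat n n"
      using phi_bij by (simp add: bij_betw_def)
    then have sub': "carrier_mat n n \<subseteq> {\<phi> t}" using sub by blast
    have "(0\<^sub>m n n :: 'k mat) = \<phi> t" "(1\<^sub>m n :: 'k mat) = \<phi> t"
      using subsetD[OF sub' zero_carrier_mat] subsetD[OF sub' one_carrier_mat] by auto
    then have "(0\<^sub>m n n :: 'k mat) = 1\<^sub>m n" by simp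
    then have "(0\<^sub>m n n :: 'k mat) $$ (0, 0) = 1\<^sub>m n $$ (0, 0)" by simp
    then show False using n_pos by simp
  qed
qed

definition rat_linear :: "('k \<Rightarrow> rat) \<Rightarrow> bool" where
  "rat_linear \<pi> \<longleftrightarrow> (\<forall>a b. \<pi> (a + b) = \<pi> a + \<pi> b) \<and> (\<forall>c a. \<pi> (of_rat c * a) = c * \<pi> a)"

text \<open>
  For a rational linear \<open>\<pi>\<close> this lifts the map \<open>b \<otimes> k \<mapsto> \<pi>(k) b\<close> from the tensor product back to the
  algebra.  It is chosen by the universal property of the free abelian group.
\<close>

definition contract :: "('k \<Rightarrow> rat) \<Rightarrow> ('r \<times> 'k \<Rightarrow>\<^sub>0 int) \<Rightarrow> 'r" where
  "contract \<pi> = (SOME h. h \<in> hom (free_Abelian_group (carrier B \<times> UNIV)) (add_monoid B) \<and>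
     (\<forall>b k. b \<in> carrier B \<longrightarrow> h (frag_of (b, k)) = i (\<pi> k) \<otimes> b))"

lemma contract: "contract \<pi> \<in> hom (free_Abelian_group (carrier B \<times> UNIV)) (add_monoid B)" (is ?A)
  and contract_frag_of: "b \<in> carrier B \<Longrightarrow> contract \<pi> (frag_of (b, k)) = i (\<pi> k) \<otimes> b"
proof -
  obtain h where "h \<in> hom (free_Abelian_group (carrier B \<times> UNIV)) (add_monoid B)"
    "\<And>x. x \<in> carrier B \<times> UNIV \<Longrightarrow> h (frag_of x) = (case x of (b, k) \<Rightarrow> i (\<pi> k) \<otimes> b)"
    by (rule comm_group.free_Abelian_group_universal[OF B.a_comm_group, of "\<lambda>x. case x of (b, k) \<Rightarrow> i (\<pi> k) \<otimes> b" "carrier B \<times> UNIV"]) auto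
  then have "\<exists>h. h \<in> hom (free_Abelian_group (carrier B \<times> UNIV)) (add_monoid B) \<and>
     (\<forall>b k. b \<in> carrier B \<longrightarrow> h (frag_of (b, k)) = i (\<pi> k) \<otimes> b)" by force
  from someI_ex[OF this] show ?A "b \<in> carrier B \<Longrightarrow> contract \<pi> (frag_of (b, k)) = i (\<pi> k) \<otimes> b"
    unfolding contract_def by blast+
qed

lemma contract_closed: "u \<in> carrier BK.F \<Longrightarrow> contract \<pi> u \<in> carrier B"
  using hom_in_carrier[OF contract, of u \<pi>] by simp

lemma contract_zero: "contract \<pi> 0 = \<zero>"
  using hom_one[OF contract group_free_Abelian_group B.a_group] by simp

lemma contract_add:
  "u \<in> carrier BK.F \<Longrightarrow> v \<in> carrier BK.F \<Longrightarrow> contract \<pi> (u + v) = contract \<pi> u \<oplus> contract \<pi> v"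
  using hom_mult[OF contract, of u v \<pi>] by simp

lemma contract_diff:
  assumes "u \<in> carrier BK.F" "v \<in> carrier BK.F"
  shows "contract \<pi> (u - v) = contract \<pi> u \<ominus> contract \<pi> v"
proof -
  have uv: "u - v \<in> carrier BK.F"
    using keys_diff[of u v] assms by auto
  have "contract \<pi> u = contract \<pi> (u - v) \<oplus> contract \<pi> v"
    using contract_add[OF uv assms(2)] by simp
  then show ?thesis
    using contract_closed uv assms by (metis B.add.inv_solve_right' a_minus_def)
qed

lemma diff_F: "u \<in> carrier BK.F \<Longrightarrow> v \<in> carrier BK.F \<Longrightarrow> u - v \<in> carrier BK.F"
  using keys_diff[of u v] by auto

lemma F_induct [consumes 1, case_names gen diff]:
  assumes "u \<in> carrier BK.F"
    and "\<And>b k. b \<in> carrier B \<Longrightarrow> P (frag_of (b, k))"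
    and "\<And>u v. u \<in> carrier BK.F \<Longrightarrow> v \<in> carrier BK.F \<Longrightarrow> P u \<Longrightarrow> P v \<Longrightarrow> P (u - v)"
  shows "P u"
proof -
  have "P 0" using assms(3)[OF BK.frag_of_in_F BK.frag_of_in_F assms(2) assms(2), OF B.zero_closed B.zero_closed B.zero_closed B.zero_closed, of 0 0]
    by simp
  have "Poly_Mapping.keys u \<subseteq> carrier B \<times> UNIV" using assms(1) by simp
  then have "u \<in> carrier BK.F \<and> P u"
    by (induction rule: frag_induction)
       (use \<open>P 0\<close> assms(2,3) diff_F BK.frag_of_in_F in \<open>auto simp del: tensor_free_ring_simps(1) simp: tensor_free_ring_def keys_frag_of\<close>)
  then show ?thesis ..
qed

lemma contract_mult:
  assumes "u \<in> carrier BK.F" "b \<in> carrier B"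
  shows "contract \<pi> (u \<otimes>\<^bsub>BK.F\<^esub> frag_of (b, s)) = contract (\<lambda>k. \<pi> (k * s)) u \<otimes> b" (is ?right)
    and "contract \<pi> (frag_of (b, s) \<otimes>\<^bsub>BK.F\<^esub> u) = b \<otimes> contract (\<lambda>k. \<pi> (k * s)) u" (is ?left)
proof -
  interpret F: ring BK.F by (rule BK.ring_F)
  let ?w = "frag_of (b, s)"
  have w: "?w \<in> carrier BK.F" by (rule BK.frag_of_in_F[OF assms(2)])
  have gen: "?w \<otimes>\<^bsub>BK.F\<^esub> frag_of (r, k) = frag_of (b \<otimes> r, s * k)"
    "frag_of (r, k) \<otimes>\<^bsub>BK.F\<^esub> ?w = frag_of (r \<otimes> b, k * s)" for r k by simp_all
  have distr: "(u - v) \<otimes>\<^bsub>BK.F\<^esub> ?w = u \<otimes>\<^bsub>BK.F\<^esub> ?w - v \<otimes>\<^bsub>BK.F\<^esub> ?w"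
    "?w \<otimes>\<^bsub>BK.F\<^esub> (u - v) = ?w \<otimes>\<^bsub>BK.F\<^esub> u - ?w \<otimes>\<^bsub>BK.F\<^esub> v" for u v
    by (simp_all add: frag_extend_diff)
  have ib: "i c \<otimes> (b \<otimes> r) = b \<otimes> (i c \<otimes> r)" if "r \<in> carrier B" for r c
    using that assms(2) i_central[of b c] by (metis B.m_assoc i_closed)
  show ?right using assms(1)
  proof (induction rule: F_induct)
    case (gen r k)
    then show ?case unfolding \<open>\<And>r k. frag_of (r, k) \<otimes>\<^bsub>BK.F\<^esub> ?w = _\<close>
      by (simp add: contract_frag_of assms(2) B.m_assoc)
  next
    case (diff u v)
    have "u \<otimes>\<^bsub>BK.F\<^esub> ?w \<in> carrier BK.F" "v \<otimes>\<^bsub>BK.F\<^esub> ?w \<in> carrier BK.F"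
      using diff(1,2) w by (blast intro: F.m_closed)+
    from contract_diff[OF this] diff show ?case
      unfolding distr contract_diff[OF diff(1,2)]
      by (simp only: a_minus_def B.l_distr B.l_minus contract_closed assms(2) B.a_inv_closed)
  qed
  show ?left using assms(1)
  proof (induction rule: F_induct)
    case (gen r k)
    then show ?case unfolding \<open>\<And>r k. ?w \<otimes>\<^bsub>BK.F\<^esub> frag_of (r, k) = _\<close>
      by (simp add: contract_frag_of assms(2) ib mult.commute)
  next
    case (diff u v)
    have "?w \<otimes>\<^bsub>BK.F\<^esub> u \<in> carrier BK.F" "?w \<otimes>\<^bsub>BK.F\<^esub> v \<in> carrier BK.F"
      using diff(1,2) w by (blast intro: F.m_closed)+
    from contract_diff[OF this] diff show ?case
      unfolding distr contract_diff[OF diff(1,2)]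
      by (simp only: a_minus_def B.r_distr B.r_minus contract_closed assms(2) B.a_inv_closed)
  qed
qed

text \<open>
  The kernel of a single contraction is no ideal, because multiplication by \<open>k\<close> changes \<open>\<pi>\<close> into
  \<open>\<pi>(_ k)\<close>.  The common kernel of all contractions is one, and it contains the relations.
\<close>

lemma contract_tensor_ideal:
  assumes "u \<in> BK.I" "rat_linear \<pi>"
  shows "contract \<pi> u = \<zero>"
proof -
  interpret F: ring BK.F by (rule BK.ring_F)
  define J where "J = {u \<in> carrier BK.F. \<forall>\<pi>. rat_linear \<pi> \<longrightarrow> contract \<pi> u = \<zero>}"
  have J: "u \<in> carrier BK.F" "rat_linear \<pi> \<Longrightarrow> contract \<pi> u = \<zero>" if "u \<in> J" for u \<pi>
    using that unfolding J_def by blast+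
  have JI: "u \<in> J" if "u \<in> carrier BK.F" "\<And>\<pi>. rat_linear \<pi> \<Longrightarrow> contract \<pi> u = \<zero>" for u
    using that unfolding J_def by blast
  have shift: "rat_linear (\<lambda>k. \<pi> (k * s))" if "rat_linear \<pi>" for \<pi> s
    using that by (simp add: rat_linear_def distrib_right mult.assoc)
  have diffJ: "u - v \<in> J" if "u \<in> J" "v \<in> J" for u v
    using that by (intro JI diff_F) (simp_all add: J contract_diff a_minus_def del: tensor_free_ring_simps)
  have zeroJ: "0 \<in> J" by (rule JI) (simp_all add: contract_zero)
  have addJ: "u + v \<in> J" if "u \<in> J" "v \<in> J" for u v
    using diffJ[OF that(1) diffJ[OF zeroJ that(2)]] by simp
  have gen: "u \<otimes>\<^bsub>BK.F\<^esub> frag_of (b, k) \<in> J" "frag_of (b, k) \<otimes>\<^bsub>BK.F\<^esub> u \<in> J"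
    if "u \<in> J" "b \<in> carrier B" for u b k
    by (rule JI, blast intro: F.m_closed J that BK.frag_of_in_F, simp only: contract_mult J(1) that J(2)[OF that(1) shift] B.l_null B.r_null)+
  have "ideal J BK.F"
  proof (rule idealI[OF BK.ring_F])
    show "subgroup J (add_monoid BK.F)"
    proof (rule group.subgroupI[OF F.a_group])
      show "J \<subseteq> carrier (add_monoid BK.F)" using J(1) by auto
      show "J \<noteq> {}" using zeroJ by blast
      fix u v assume u: "u \<in> J" and v: "v \<in> J"
      have "\<ominus>\<^bsub>BK.F\<^esub> u = - u"
        by (rule F.minus_equality) (use J(1)[OF u] in simp_all)
      then show "inv\<^bsub>add_monoid BK.F\<^esub> u \<in> J"
        using diffJ[OF zeroJ u] by (simp add: a_inv_def)
      show "u \<otimes>\<^bsub>add_monoid BK.F\<^esub> v \<in> J" using addJ[OF u v] by simp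
    qed
  next
    fix u w assume u: "u \<in> J" and w: "w \<in> carrier BK.F"
    show "w \<otimes>\<^bsub>BK.F\<^esub> u \<in> J" using w
    proof (induction rule: F_induct)
      case (diff v w)
      then show ?case using diffJ by (simp add: frag_extend_diff)
    qed (rule gen[OF u])
    show "u \<otimes>\<^bsub>BK.F\<^esub> w \<in> J" using w
    proof (induction rule: F_induct)
      case (diff v w)
      have "u \<otimes>\<^bsub>BK.F\<^esub> (v - w) = u \<otimes>\<^bsub>BK.F\<^esub> v - u \<otimes>\<^bsub>BK.F\<^esub> w"
        using F.r_distr[OF diff_F[OF diff(1,2)] diff(2) J(1)[OF u]]
        by (metis add_diff_cancel_right' diff_add_cancel tensor_free_ring_simps(5))
      then show ?case using diffJ diff by simp
    qed (rule gen[OF u])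
  qed
  moreover have "tensor_relations B i (of_rat :: rat \<Rightarrow> 'k) \<subseteq> J"
  proof
    fix u assume u: "u \<in> tensor_relations B i (of_rat :: rat \<Rightarrow> 'k)"
    then have "u \<in> carrier BK.F" using BK.relations_carrier by blast
    then show "u \<in> J"
    proof (rule JI)
      fix \<pi> :: "'k \<Rightarrow> rat" assume \<pi>: "rat_linear \<pi>"
      then have \<pi>_simps: "\<pi> (a + b) = \<pi> a + \<pi> b" "\<pi> (of_rat c * a) = c * \<pi> a" for a b c
        by (simp_all add: rat_linear_def)
      note simps = contract_diff contract_frag_of diff_F BK.frag_of_in_F \<pi>_simps i_add i_mult
      show "contract \<pi> u = \<zero>"
        using u
      proof (cases rule: tensor_relationsE)
        case (left r r' s)
        have "i (\<pi> s) \<otimes> (r \<oplus> r') \<ominus> i (\<pi> s) \<otimes> r \<ominus> i (\<pi> s) \<otimes> r' = \<zero>"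
          using left(1,2) i_closed[of "\<pi> s"] by algebra
        then show ?thesis by (simp add: simps left del: tensor_free_ring_simps)
      next
        case (right r s s')
        have "(i (\<pi> s) \<oplus> i (\<pi> s')) \<otimes> r \<ominus> i (\<pi> s) \<otimes> r \<ominus> i (\<pi> s') \<otimes> r = \<zero>"
          using right(1) i_closed[of "\<pi> s"] i_closed[of "\<pi> s'"] by algebra
        then show ?thesis by (simp add: simps right del: tensor_free_ring_simps)
      next
        case (balanced c r s)
        have "i (\<pi> s) \<otimes> (i c \<otimes> r) = i c \<otimes> i (\<pi> s) \<otimes> r"
          using balanced(1) i_central[of "i (\<pi> s)" c] by (simp add: B.m_assoc[symmetric])
        then show ?thesis using balanced(1) by (simp add: simps balanced(2) a_minus_def B.r_neg del: tensor_free_ring_simps)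
      qed
    qed
  qed
  ultimately have "BK.I \<subseteq> J" by (rule BK.I_least)
  then show ?thesis using assms J(2) by blast
qed

text \<open>
  A central \<open>z\<close> stays central after extension of scalars, so it becomes a scalar matrix:
  \<open>z \<otimes> 1 = 1 \<otimes> k\<close>.  Contracting with a projection \<open>\<pi>\<close> that fixes \<open>1\<close> gives \<open>z = \<pi>(k)\<close>.
\<close>

theorem center_eq_rationals:
  assumes "z \<in> center B" shows "z \<in> range i"
proof -
  have z: "z \<in> carrier B" "\<And>x. x \<in> carrier B \<Longrightarrow> z \<otimes> x = x \<otimes> z"
    using assms by (auto simp: center_def)
  have T: "BK.T z 1 \<in> center BK.S" by (rule BK.central_T[OF z])
  then have TS: "BK.T z 1 \<in> carrier BK.S" by (simp add: center_def)
  have "\<phi> (BK.T z 1) * M = M * \<phi> (BK.T z 1)" if M: "M \<in> carrier_mat n n" for M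
  proof -
    obtain t where t: "t \<in> carrier BK.S" "M = \<phi> t"
      using M phi_bij by (force simp: bij_betw_def)
    have hom: "\<phi> (s \<otimes>\<^bsub>BK.S\<^esub> t) = \<phi> s * \<phi> t" if "s \<in> carrier BK.S" "t \<in> carrier BK.S" for s t
      using phi_iso ring_hom_mult[of \<phi> _ "ring_mat TYPE('k) n ()", OF _ that]
      by (simp add: ring_iso_def ring_mat_simps)
    have "BK.T z 1 \<otimes>\<^bsub>BK.S\<^esub> t = t \<otimes>\<^bsub>BK.S\<^esub> BK.T z 1" using T t(1) by (simp add: center_def)
    then show ?thesis unfolding t(2) by (simp flip: hom[OF TS t(1)] hom[OF t(1) TS])
  qed
  moreover have "\<phi> (BK.T z 1) \<in> carrier_mat n n" using phi_bij TS by (auto simp: bij_betw_def)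
  ultimately obtain k where "\<phi> (BK.T z 1) = k \<cdot>\<^sub>m 1\<^sub>m n" using central_matrix_scalar by blast
  then have "\<phi> (BK.T z 1) = \<phi> (BK.T \<one> k)" by (simp add: phi_scalar)
  then have "BK.T z 1 = BK.T \<one> k"
    using phi_bij TS BK.T_closed[OF B.one_closed] by (auto simp: bij_betw_def dest: inj_onD)
  then have I: "frag_of (z, 1) - frag_of (\<one>, k) \<in> BK.I"
    unfolding pure_tensor_def
    by (subst (asm) BK.coset_eq_iff[OF BK.frag_of_in_F[OF z(1)] BK.frag_of_in_F[OF B.one_closed]])
  obtain \<pi> :: "'k \<Rightarrow> rat" where \<pi>: "\<And>a b. \<pi> (a + b) = \<pi> a + \<pi> b" "\<And>c a. \<pi> (of_rat c * a) = c * \<pi> a" "\<pi> 1 = 1"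
    by (rule rat_linear_projection) (rule that)
  have "contract \<pi> (frag_of (z, 1) - frag_of (\<one>, k)) = \<zero>"
    by (rule contract_tensor_ideal[OF I]) (simp add: rat_linear_def \<pi>)
  then have "z \<ominus> i (\<pi> k) = \<zero>"
    by (simp add: contract_diff BK.frag_of_in_F z contract_frag_of \<pi>(3) i_one del: tensor_free_ring_simps)
  then show ?thesis using z(1) by simp
qed

end

section \<open>Finite fields and ternary forms\<close>

lemma prime_CHAR_finite: "prime CHAR('a::{field,finite})"
  by (rule prime_CHAR_semidom) (simp add: finite_imp_CHAR_pos)

text \<open>
  Otherwise a Sylow subgroup of the additive group for another prime \<open>l\<close> contains a nonzero element
  that is killed by a power of \<open>l\<close> and by the characteristic.
\<close>

lemma card_finite_field_power_CHAR:
  obtains n where "n > 0" "CARD('a::{field,finite}) = CHAR('a) ^ n"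
proof -
  define G :: "'a monoid" where "G = \<lparr>carrier = UNIV :: 'a set, monoid.mult = (+), one = 0\<rparr>"
  interpret G: group G
    by (rule groupI) (auto simp: G_def add.assoc intro: exI[of _ "- x" for x])
  have pow: "x [^]\<^bsub>G\<^esub> k = of_nat k * x" for x and k :: nat
    by (induction k) (simp_all add: G_def nat_pow_def algebra_simps)
  have CARD: "CARD('a) > 1"
    using card_mono[of UNIV "{0, 1 :: 'a}"] by simp
  have only: "l = CHAR('a)" if l: "prime l" "l dvd CARD('a)" for l
  proof -
    define a where "a = multiplicity l CARD('a)"
    obtain m where m: "CARD('a) = l ^ a * m"
      using multiplicity_dvd[of l "CARD('a)"] unfolding a_def by (auto elim: dvdE)
    have "a > 0" unfolding a_def using l CARD by (simp add: prime_multiplicity_gt_zero_iff)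
    have "Coset.order G = l ^ a * m" using m by (simp add: Coset.order_def G_def)
    then obtain H where H: "subgroup H G" "card H = l ^ a"
      using sylow_thm[OF l(1) G.group_axioms] by (auto simp: G_def)
    have "1 < l ^ a" by (rule one_less_power[OF prime_gt_1_nat[OF l(1)] \<open>a > 0\<close>])
    then have "\<not> H \<subseteq> {0}" using H(2) card_mono[of "{0::'a}" H] by auto
    then obtain x where x: "x \<in> H" "x \<noteq> 0" by blast
    interpret H: group "G\<lparr>carrier := H\<rparr>" by (rule subgroup.subgroup_is_group[OF H(1) G.group_axioms])
    have "x [^]\<^bsub>G\<lparr>carrier := H\<rparr>\<^esub> Coset.order (G\<lparr>carrier := H\<rparr>) = \<one>\<^bsub>G\<lparr>carrier := H\<rparr>\<^esub>"
      using x(1) by (intro H.pow_order_eq_1) (simp_all add: G_def)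
    then have "x [^]\<^bsub>G\<^esub> (l ^ a) = 0"
      unfolding G.nat_pow_consistent[of x "l ^ a" H] using H(2) by (simp add: Coset.order_def G_def)
    then have "of_nat (l ^ a) = (0 :: 'a)" using x(2) by (simp only: pow mult_eq_0_iff) simp
    then have "CHAR('a) dvd l ^ a" using of_nat_eq_0_iff_char_dvd by blast
    then have "CHAR('a) dvd l" by (rule prime_dvd_power[OF prime_CHAR_finite])
    then show ?thesis by (rule primes_dvd_imp_eq[OF prime_CHAR_finite l(1), symmetric])
  qed
  define k where "k = multiplicity CHAR('a) CARD('a)"
  have "prime_factors CARD('a) \<subseteq> {CHAR('a)}" using only by (auto simp: prime_factors_dvd)
  then have factors: "prime_factors CARD('a) = {} \<or> prime_factors CARD('a) = {CHAR('a)}" by blast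
  have "CARD('a) = (\<Prod>l\<in>prime_factors CARD('a). l ^ multiplicity l CARD('a))"
    by (rule prime_factorization_nat) (use CARD in simp)
  then have eq: "CARD('a) = CHAR('a) ^ k"
    using factors CARD unfolding k_def by (elim disjE) simp_all
  moreover have "k > 0" using CARD eq by (cases k) auto
  ultimately show thesis by (rule that[rotated])
qed

lemma finite_field_power_card: "x ^ CARD('a) = (x :: 'a::{field,finite})"
proof (cases "x = 0")
  case False
  have "(\<Prod>y\<in>UNIV - {0}. x * y) = (\<Prod>y\<in>UNIV - {0}. y)"
    by (rule prod.reindex_bij_witness[of _ "\<lambda>y. y / x" "\<lambda>y. x * y"]) (use False in auto)
  then have "x ^ (CARD('a) - 1) = 1" by (simp add: prod.distrib)
  then show ?thesis
    using power_Suc[of x "CARD('a) - 1"] by simp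
qed simp

lemma CHAR_power_inj:
  fixes x y :: "'b::field"
  assumes "prime CHAR('b)" "m = CHAR('b) ^ k" "x ^ m = y ^ m" shows "x = y"
proof -
  have "x ^ m = (x - y) ^ m + y ^ m"
    using freshmans_dream'[OF assms(1,2), of "x - y" y] by simp
  with assms(3) have "(x - y) ^ m = 0" by simp
  then show ?thesis by simp
qed

lemma finite_field_CHAR_root:
  obtains y where "y ^ (CHAR('a) ^ k) = (x :: 'a::{field,finite})"
proof -
  have "inj (\<lambda>y :: 'a. y ^ (CHAR('a) ^ k))"
    by (rule injI) (rule CHAR_power_inj[OF prime_CHAR_finite refl])
  then have "surj (\<lambda>y :: 'a. y ^ (CHAR('a) ^ k))" by (rule finite_UNIV_inj_surj[OF finite])
  then obtain y :: 'a where "x = y ^ (CHAR('a) ^ k)" by (rule surjE)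
  then show thesis using that by blast
qed

lemma ternary_form_power_CHAR:
  fixes c :: "nat \<Rightarrow> nat \<Rightarrow> 'b::field"
  assumes "prime CHAR('b)" "m = CHAR('b) ^ k"
  shows "ternary_form d c (x, y, z) ^ m = ternary_form d (\<lambda>i j. c i j ^ m) (x ^ m, y ^ m, z ^ m)"
  by (simp add: freshmans_dream_sum'[OF assms] power_mult_distrib power_mult[symmetric] mult.commute[of m])

lemma ternary_form_scale:
  "ternary_form d c (l * x, l * y, l * z) = l ^ d * ternary_form d c (x, y, (z :: 'b::comm_ring_1))"
proof -
  have "c i j * (l * x) ^ i * (l * y) ^ j * (l * z) ^ (d - i - j) = l ^ d * (c i j * x ^ i * y ^ j * z ^ (d - i - j))"
    if "i \<le> d" "j \<le> d - i" for i j
  proof -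
    have "l ^ d = l ^ i * l ^ j * l ^ (d - i - j)" using that by (simp flip: power_add)
    then show ?thesis by (simp add: power_mult_distrib algebra_simps)
  qed
  then show ?thesis by (simp add: sum_distrib_left)
qed

definition is_form :: "nat \<Rightarrow> ('a::field alg_closure \<times> 'a alg_closure \<times> 'a alg_closure \<Rightarrow> 'a alg_closure) \<Rightarrow> bool" where
  "is_form d f \<longleftrightarrow> (\<exists>c. f = ternary_form d (\<lambda>i j. to_ac (c i j)))"

lemma is_form_monomial:
  assumes "i + j + k = d"
  shows "is_form d (\<lambda>(x, y, z). to_ac a * x ^ i * y ^ j * z ^ k)"
  unfolding is_form_def
proof (intro exI ext, clarify)
  fix x y z :: "'a alg_closure"
  have "ternary_form d (\<lambda>i' j'. to_ac (if i' = i \<and> j' = j then a else 0)) (x, y, z)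
    = (\<Sum>i'\<le>d. if i' = i then \<Sum>j'\<le>d - i'. if j' = j then to_ac a * x ^ i * y ^ j * z ^ k else 0 else 0)"
    unfolding ternary_form.simps
  proof (rule sum.cong[OF refl])
    fix i' assume "i' \<in> {..d}"
    have "(\<Sum>j'\<le>d - i'. to_ac (if i' = i \<and> j' = j then a else 0) * x ^ i' * y ^ j' * z ^ (d - i' - j'))
      = (\<Sum>j'\<le>d - i'. if i' = i then if j' = j then to_ac a * x ^ i * y ^ j * z ^ k else 0 else 0)"
      using assms by (intro sum.cong) auto
    then show "(\<Sum>j'\<le>d - i'. to_ac (if i' = i \<and> j' = j then a else 0) * x ^ i' * y ^ j' * z ^ (d - i' - j'))
      = (if i' = i then \<Sum>j'\<le>d - i'. if j' = j then to_ac a * x ^ i * y ^ j * z ^ k else 0 else 0)"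
      by (cases "i' = i") simp_all
  qed
  then show "to_ac a * x ^ i * y ^ j * z ^ k = ternary_form d (\<lambda>i' j'. to_ac (if i' = i \<and> j' = j then a else 0)) (x, y, z)"
    using assms by auto
qed

lemma is_form_add: "is_form d f \<Longrightarrow> is_form d g \<Longrightarrow> is_form d (\<lambda>t. f t + g t)"
proof -
  assume "is_form d f" "is_form d g"
  then obtain c c' where "f = ternary_form d (\<lambda>i j. to_ac (c i j))" "g = ternary_form d (\<lambda>i j. to_ac (c' i j))"
    by (auto simp: is_form_def)
  then show ?thesis
    unfolding is_form_def
    by (intro exI[of _ "\<lambda>i j. c i j + c' i j"] ext) (auto simp: sum.distrib algebra_simps)
qed

lemma is_form_zero: "is_form d (\<lambda>t. 0)"
  unfolding is_form_def by (intro exI[of _ "\<lambda>i j. 0"]) auto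

lemma is_form_sum: "(\<And>a. a \<in> A \<Longrightarrow> is_form d (f a)) \<Longrightarrow> is_form d (\<lambda>t. \<Sum>a\<in>A. f a t)"
  by (induction A rule: infinite_finite_induct) (simp_all add: is_form_zero is_form_add)

lemma is_form_mult:
  assumes "is_form d f" "is_form e g" shows "is_form (d + e) (\<lambda>t. f t * g t)"
proof -
  obtain c c' where f: "f = ternary_form d (\<lambda>i j. to_ac (c i j))" and g: "g = ternary_form e (\<lambda>i j. to_ac (c' i j))"
    using assms by (auto simp: is_form_def)
  have expand: "(\<lambda>t. f t * g t) = (\<lambda>t. \<Sum>i\<le>d. \<Sum>j\<le>d - i. \<Sum>i'\<le>e. \<Sum>j'\<le>e - i'.
     (case t of (x, y, z) \<Rightarrow> to_ac (c i j * c' i' j') * x ^ (i + i') * y ^ (j + j') * z ^ (d - i - j + (e - i' - j'))))"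
    unfolding f g
    by (intro ext, clarify, unfold ternary_form.simps sum_distrib_right, unfold sum_distrib_left,
      simp only: split to_ac_mult power_add mult_ac)
  have monomial: "is_form (d + e) (\<lambda>t. case t of (x, y, z) \<Rightarrow>
        to_ac (c i j * c' i' j') * x ^ (i + i') * y ^ (j + j') * z ^ (d - i - j + (e - i' - j')))"
    if "i \<in> {..d}" "j \<in> {..d - i}" "i' \<in> {..e}" "j' \<in> {..e - i'}" for i j i' j'
  proof -
    have "i + j + (d - i - j) = d" "i' + j' + (e - i' - j') = e" using that by simp_all
    then have "i + i' + (j + j') + (d - i - j + (e - i' - j')) = d + e" by linarith
    then show ?thesis by (rule is_form_monomial)
  qed
  show ?thesis unfolding expand
    by (rule is_form_sum, rule is_form_sum, rule is_form_sum, rule is_form_sum, rule monomial)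
qed

lemma is_form_power: "is_form d f \<Longrightarrow> is_form (n * d) (\<lambda>t. f t ^ n)"
proof (induction n)
  case 0
  show ?case using is_form_monomial[of 0 0 0 0 1] by (simp add: case_prod_unfold)
next
  case (Suc n)
  then show ?case using is_form_mult[of d f "n * d" "\<lambda>t. f t ^ n"] by simp
qed

lemma is_form_compose:
  assumes "is_form e h" "is_form d f1" "is_form d f2" "is_form d f3"
  shows "is_form (e * d) (\<lambda>t. h (f1 t, f2 t, f3 t))"
proof -
  obtain c where h: "h = ternary_form e (\<lambda>i j. to_ac (c i j))" using assms(1) by (auto simp: is_form_def)
  have "is_form (e * d) (\<lambda>t. to_ac (c i j) * f1 t ^ i * f2 t ^ j * f3 t ^ (e - i - j))"
    if "i \<le> e" "j \<le> e - i" for i j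
  proof -
    have "is_form 0 (\<lambda>t. to_ac (c i j))"
      using is_form_monomial[of 0 0 0 0 "c i j"] by (simp add: case_prod_unfold)
    from is_form_mult[OF is_form_mult[OF is_form_mult[OF this is_form_power[OF assms(2)]]
       is_form_power[OF assms(3)]] is_form_power[OF assms(4)], of i j "e - i - j"]
    have "is_form (0 + i * d + j * d + (e - i - j) * d) (\<lambda>t. to_ac (c i j) * f1 t ^ i * f2 t ^ j * f3 t ^ (e - i - j))" .
    moreover have "0 + i * d + j * d + (e - i - j) * d = e * d"
      using that by (simp flip: distrib_right)
    ultimately show ?thesis by simp
  qed
  note monomial = this
  show ?thesis unfolding h ternary_form.simps
    by (rule is_form_sum, rule is_form_sum, rule monomial) simp_all
qed

section \<open>The Frobenius endomorphism is central\<close>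

type_synonym 'k form = "'k \<times> 'k \<times> 'k \<Rightarrow> 'k"

text \<open>
  Three forms of equal degree over the base field whose \<open>m\<close>-th powers are homogeneous coordinates of
  \<open>f Q\<close> wherever the forms do not all vanish, and which do not all vanish at \<open>P\<close>.  For \<open>m = 1\<close> this is
  the local condition on a morphism; for a power \<open>m\<close> of the characteristic it says that \<open>f\<close> is, near \<open>P\<close>,
  a morphism followed by the \<open>m\<close>-th power Frobenius.
\<close>

definition describes_at ::
  "nat \<Rightarrow> 'a::field weierstrass \<Rightarrow> ('a alg_closure point \<Rightarrow> 'a alg_closure point) \<Rightarrow>
    'a alg_closure point \<Rightarrow> 'a alg_closure form \<Rightarrow> 'a alg_closure form \<Rightarrow> 'a alg_closure form \<Rightarrow> bool" where
  "describes_at m E f P F1 F2 F3 \<longleftrightarrow>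
    (\<exists>d. is_form d F1 \<and> is_form d F2 \<and> is_form d F3) \<and>
    \<not> (F1 (homog_coords P) = 0 \<and> F2 (homog_coords P) = 0 \<and> F3 (homog_coords P) = 0) \<and>
    (\<forall>Q\<in>geometric_points E.
      \<not> (F1 (homog_coords Q) = 0 \<and> F2 (homog_coords Q) = 0 \<and> F3 (homog_coords Q) = 0) \<longrightarrow>
      (\<exists>l x y z. l \<noteq> 0 \<and> homog_coords (f Q) = (x, y, z) \<and>
        F1 (homog_coords Q) ^ m = l * x \<and> F2 (homog_coords Q) ^ m = l * y \<and> F3 (homog_coords Q) ^ m = l * z))"

lemma morphism_over_base_iff:
  "morphism_over_base E f \<longleftrightarrow> f \<in> geometric_points E \<rightarrow> geometric_points E \<and>
    (\<forall>P\<in>geometric_points E. \<exists>F1 F2 F3. describes_at 1 E f P F1 F2 F3)"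
proof -
  have aux: "(\<exists>F1 F2 F3. describes_at 1 E f P F1 F2 F3) \<longleftrightarrow>
    (\<exists>d c1 c2 c3.
      let F = (\<lambda>c Q. ternary_form d (\<lambda>i j. to_ac (c i j)) (homog_coords Q));
          \<Phi> = (\<lambda>Q. (F c1 Q, F c2 Q, F c3 Q))
      in \<Phi> P \<noteq> (0, 0, 0) \<and>
         (\<forall>Q\<in>geometric_points E. \<Phi> Q \<noteq> (0, 0, 0) \<longrightarrow>
            (\<exists>l. l \<noteq> 0 \<and>
              (case homog_coords (f Q) of (x, y, z) \<Rightarrow> \<Phi> Q = (l * x, l * y, l * z)))))" (is "?L \<longleftrightarrow> ?R") for P
  proof -
    let ?H = "\<lambda>Q. homog_coords (Q :: 'a alg_closure point)"
    have body: "describes_at 1 E f P F1 F2 F3 \<longleftrightarrow>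
       (\<exists>d. is_form d F1 \<and> is_form d F2 \<and> is_form d F3) \<and>
       (F1 (?H P), F2 (?H P), F3 (?H P)) \<noteq> (0, 0, 0) \<and>
         (\<forall>Q\<in>geometric_points E. (F1 (?H Q), F2 (?H Q), F3 (?H Q)) \<noteq> (0, 0, 0) \<longrightarrow>
            (\<exists>l. l \<noteq> 0 \<and>
              (case ?H (f Q) of (x, y, z) \<Rightarrow> (F1 (?H Q), F2 (?H Q), F3 (?H Q)) = (l * x, l * y, l * z))))" for F1 F2 F3
      unfolding describes_at_def power_one_right prod.inject case_prod_unfold
      by (intro arg_cong2[where f = "(\<and>)"] refl ball_cong imp_cong ex_cong1)
        (auto simp: prod_eq_iff)
    show ?thesis
      unfolding body Let_def is_form_def by blast
  qed
  show ?thesis unfolding morphism_over_base_def aux[symmetric] ..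
qed

lemma homog_coords_inj:
  assumes "homog_coords P = (x, y, z)" "homog_coords P' = (x', y', z')" "l \<noteq> 0" "l' \<noteq> 0"
    "l * x = l' * x'" "l * y = l' * y'" "l * z = l' * (z' :: 'b::field)"
  shows "P = P'"
  using assms by (cases P; cases P') auto

lemma homog_coords_nonzero: "homog_coords P = (x, y, z) \<Longrightarrow> \<not> (x = 0 \<and> y = 0 \<and> z = (0 :: 'b::field))"
  by (cases P) auto

fun point_power :: "nat \<Rightarrow> 'k::monoid_mult point \<Rightarrow> 'k point" where
  "point_power m Infinity = Infinity"
| "point_power m (Affine x y) = Affine (x ^ m) (y ^ m)"

lemma frobenius_point_eq: "frobenius_point = (point_power CARD('a) :: 'a::{field,finite} alg_closure point \<Rightarrow> _)"
proof
  fix P :: "'a alg_closure point"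
  show "frobenius_point P = point_power CARD('a) P" by (cases P) simp_all
qed

lemma homog_coords_power:
  "m > 0 \<Longrightarrow> homog_coords (point_power m P) = (case homog_coords P of (x, y, z) \<Rightarrow> (x ^ m, y ^ m, z ^ m))"
  by (cases P) (auto simp: zero_power)

lemma Infinity_geometric [simp]: "Infinity \<in> geometric_points E"
  by (simp add: geometric_points_def)

context
  fixes q :: nat assumes q: "q = CARD('a::{field,finite})"
begin

lemma prime_CHAR_closure: "prime CHAR('a alg_closure)"
  using prime_CHAR_finite[where 'a = 'a] by simp

lemma q_power_CHAR: "\<exists>n>0. q = CHAR('a alg_closure) ^ n"
  using card_finite_field_power_CHAR[where 'a = 'a] unfolding q CHAR_alg_closure by blast

lemma q_add: "(x + y) ^ q = x ^ q + (y ^ q :: 'a alg_closure)"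
  using q_power_CHAR freshmans_dream'[OF prime_CHAR_closure] by blast

lemma q_base: "to_ac (c :: 'a) ^ q = to_ac c"
  using finite_field_power_card[of c] unfolding q by (metis to_ac_power)

lemma q_pos: "q > 0"
  unfolding q by simp

lemma q_inj: "x ^ q = y ^ q \<Longrightarrow> x = (y :: 'a alg_closure)"
  using q_power_CHAR CHAR_power_inj[OF prime_CHAR_closure] by blast

text \<open>
  Raising the Weierstrass equation to the \<open>q\<close>-th power fixes its coefficients and is injective.
\<close>

lemma on_curve_q:
  fixes E :: "'a weierstrass"
  shows "point_power q P \<in> geometric_points E \<longleftrightarrow> P \<in> geometric_points E"
proof (cases P)
  case (Affine x y)
  obtain a1 a2 a3 a4 a6 where E: "E = Weierstrass a1 a2 a3 a4 a6" by (cases E)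
  let ?c = "to_ac :: 'a \<Rightarrow> 'a alg_closure"
  let ?l = "y^2 + ?c a1 * x * y + ?c a3 * y" and ?r = "x^3 + ?c a2 * x^2 + ?c a4 * x + ?c a6"
  have pow: "(x ^ q) ^ k = (x ^ k) ^ q" for x :: "'a alg_closure" and k by (simp add: mult.commute flip: power_mult)
  have "?l ^ q = (y^q)^2 + ?c a1 * x^q * y^q + ?c a3 * y^q"
    "?r ^ q = (x^q)^3 + ?c a2 * (x^q)^2 + ?c a4 * x^q + ?c a6"
    by (simp_all add: q_add power_mult_distrib q_base pow)
  then have "(y^q)^2 + ?c a1 * x^q * y^q + ?c a3 * y^q = (x^q)^3 + ?c a2 * (x^q)^2 + ?c a4 * x^q + ?c a6 \<longleftrightarrow> ?l = ?r"
    using q_inj by metis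
  then show ?thesis by (simp add: Affine E geometric_points_def geometric_curve_def)
qed simp

lemma form_q:
  assumes "is_form d F" shows "F (x, y, z) ^ q = F (x ^ q, y ^ q, (z :: 'a alg_closure) ^ q)"
proof -
  obtain n where n: "q = CHAR('a alg_closure) ^ n" using q_power_CHAR by blast
  obtain c where F: "F = ternary_form d (\<lambda>i j. to_ac (c i j))" using assms by (auto simp: is_form_def)
  show ?thesis unfolding F ternary_form_power_CHAR[OF prime_CHAR_closure n] by (simp add: q_base)
qed

lemma form_q_point:
  fixes P :: "'a alg_closure point"
  assumes "is_form d F"
  shows "F (homog_coords (point_power q P)) = F (homog_coords P) ^ q"
  by (cases "homog_coords P") (simp add: homog_coords_power q_pos form_q[OF assms])

text \<open>
  The forms have coefficients in the base field, so their values at the image of \<open>Q\<close> under Frobenius are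
  the \<open>q\<close>-th powers of their values at \<open>Q\<close>.  The forms are chosen near the former point and are then
  also valid at \<open>Q\<close>.
\<close>

lemma morphism_commutes_power:
  fixes E :: "'a weierstrass"
  assumes f: "morphism_over_base E f" and Q: "Q \<in> geometric_points E"
  shows "f (point_power q Q) = point_power q (f Q)"
proof -
  let ?Q' = "point_power q Q"
  have Q': "?Q' \<in> geometric_points E" using Q by (simp add: on_curve_q)
  obtain F1 F2 F3 where D: "describes_at 1 E f ?Q' F1 F2 F3"
    using f Q' by (auto simp: morphism_over_base_iff)
  then obtain d where form: "is_form d F1" "is_form d F2" "is_form d F3" by (auto simp: describes_at_def)
  have F': "F1 (homog_coords ?Q') = F1 (homog_coords Q) ^ q" "F2 (homog_coords ?Q') = F2 (homog_coords Q) ^ q"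
    "F3 (homog_coords ?Q') = F3 (homog_coords Q) ^ q"
    by (rule form_q_point[OF form(1)] form_q_point[OF form(2)] form_q_point[OF form(3)])+
  have nz': "\<not> (F1 (homog_coords ?Q') = 0 \<and> F2 (homog_coords ?Q') = 0 \<and> F3 (homog_coords ?Q') = 0)"
    using D by (simp add: describes_at_def)
  then have nz: "\<not> (F1 (homog_coords Q) = 0 \<and> F2 (homog_coords Q) = 0 \<and> F3 (homog_coords Q) = 0)"
    using q_pos by (auto simp: F')
  obtain l x y z where l: "l \<noteq> 0" "homog_coords (f Q) = (x, y, z)"
    "F1 (homog_coords Q) = l * x" "F2 (homog_coords Q) = l * y" "F3 (homog_coords Q) = l * z"
    using D Q nz unfolding describes_at_def power_one_right by metis
  obtain l' x' y' z' where l': "l' \<noteq> 0" "homog_coords (f ?Q') = (x', y', z')"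
    "F1 (homog_coords ?Q') = l' * x'" "F2 (homog_coords ?Q') = l' * y'" "F3 (homog_coords ?Q') = l' * z'"
    using D Q' nz' unfolding describes_at_def power_one_right by metis
  have "homog_coords (point_power q (f Q)) = (x ^ q, y ^ q, z ^ q)"
    by (simp add: homog_coords_power q_pos l)
  from homog_coords_inj[OF l'(2) this l'(1), of "l ^ q"] show ?thesis
    using l l' F' by (simp add: power_mult_distrib)
qed

lemma frobenius_eq: "frobenius E = (\<lambda>P\<in>geometric_points E. point_power q P)" for E :: "'a weierstrass"
  by (simp add: frobenius_def frobenius_point_eq q)

lemma frobenius_End: "frobenius E \<in> carrier (End_ring E)" for E :: "'a weierstrass"
proof -
  have "morphism_over_base E (frobenius E)"
    unfolding morphism_over_base_iff
  proof (intro conjI ballI)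
    show "frobenius E \<in> geometric_points E \<rightarrow> geometric_points E"
      by (simp add: frobenius_eq on_curve_q)
    fix P assume P: "P \<in> geometric_points E"
    let ?F1 = "\<lambda>(x, y, z). to_ac (1::'a) * x ^ q * y ^ 0 * z ^ 0"
    let ?F2 = "\<lambda>(x, y, z). to_ac (1::'a) * x ^ 0 * y ^ q * z ^ 0"
    let ?F3 = "\<lambda>(x, y, z). to_ac (1::'a) * x ^ 0 * y ^ 0 * z ^ q"
    have "is_form q ?F1" "is_form q ?F2" "is_form q ?F3" by (intro is_form_monomial; simp)+
    moreover have "\<not> (?F1 (homog_coords P) = 0 \<and> ?F2 (homog_coords P) = 0 \<and> ?F3 (homog_coords P) = 0)"
      using homog_coords_nonzero[of P] by (cases "homog_coords P") (simp add: q_pos)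
    moreover have "\<exists>l x y z. l \<noteq> 0 \<and> homog_coords (frobenius E Q) = (x, y, z) \<and>
        ?F1 (homog_coords Q) ^ 1 = l * x \<and> ?F2 (homog_coords Q) ^ 1 = l * y \<and> ?F3 (homog_coords Q) ^ 1 = l * z"
      if "Q \<in> geometric_points E" for Q
      by (rule exI[of _ 1]) (use that in \<open>cases "homog_coords Q"; simp add: frobenius_eq homog_coords_power q_pos\<close>)
    ultimately have "describes_at 1 E (frobenius E) P ?F1 ?F2 ?F3"
      unfolding describes_at_def by blast
    then show "\<exists>F1 F2 F3. describes_at 1 E (frobenius E) P F1 F2 F3" by blast
  qed
  then show ?thesis by (simp add: End_ring_def frobenius_eq)
qed

lemma frobenius_commutes:
  fixes E :: "'a weierstrass"
  assumes "f \<in> carrier (End_ring E)"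
  shows "frobenius E \<otimes>\<^bsub>End_ring E\<^esub> f = f \<otimes>\<^bsub>End_ring E\<^esub> frobenius E"
proof -
  have f: "morphism_over_base E f" "f \<in> geometric_points E \<rightarrow> geometric_points E"
    using assms by (auto simp: End_ring_def morphism_over_base_def)
  have "compose (geometric_points E) (frobenius E) f = compose (geometric_points E) f (frobenius E)"
    using f(2) by (intro extensionalityI[OF compose_extensional compose_extensional])
      (auto simp: compose_eq frobenius_eq morphism_commutes_power[OF f(1)] Pi_iff)
  then show ?thesis by (simp add: End_ring_def)
qed

end

section \<open>Laurent series and their poles\<close>

no_notation vec_index (infixl "$" 100) and index_mat (infixl "$$" 100)
unbundle fps_syntax

text \<open>
  Hensel's lemma in the form needed here: if each coefficient of \<open>\<Phi> f\<close> depends only on earlier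
  coefficients of \<open>f\<close>, the iterates of \<open>\<Phi>\<close> stabilize coefficient by coefficient.
\<close>

lemma fps_contraction_fixpoint:
  fixes \<Phi> :: "'a::zero fps \<Rightarrow> 'a fps"
  assumes contr: "\<And>f g n. (\<And>k. k < n \<Longrightarrow> f $ k = g $ k) \<Longrightarrow> \<Phi> f $ n = \<Phi> g $ n"
  obtains s where "\<Phi> s = s"
proof -
  have agree: "((\<Phi> ^^ m) 0) $ k = ((\<Phi> ^^ n) 0) $ k" if "k < n" "n \<le> m" for k n m
    using that
  proof (induction k arbitrary: m n rule: less_induct)
    case (less k)
    obtain m' n' where mn: "m = Suc m'" "n = Suc n'" using less.prems by (cases m; cases n) auto
    show ?case unfolding mn funpow.simps comp_apply
      by (rule contr, rule less.IH) (use less.prems mn in auto)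
  qed
  define s where "s = Abs_fps (\<lambda>n. ((\<Phi> ^^ Suc n) 0) $ n)"
  have s: "s $ k = ((\<Phi> ^^ n) 0) $ k" if "k < n" for k n
    using agree[of k "Suc k" n] that by (simp add: s_def)
  have "\<Phi> s $ n = s $ n" for n
    using contr[of n s "(\<Phi> ^^ n) 0"] s by (simp add: s_def)
  then show thesis using that by (metis fps_ext)
qed

lemma fps_X_mult_nth_cong:
  fixes f g h :: "'a::comm_ring_1 fps"
  assumes "f - g = fps_X * h * (f' - g')" "\<And>k. k < n \<Longrightarrow> f' $ k = g' $ k"
  shows "f $ n = g $ n"
proof (cases n)
  case 0
  then show ?thesis using arg_cong[OF assms(1), of "\<lambda>f. f $ 0"] by (simp add: mult.assoc)
next
  case (Suc m)
  have "(f - g) $ n = (\<Sum>i = 0..m. h $ i * (f' - g') $ (m - i))"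
    unfolding assms(1) Suc mult.assoc fps_mult_nth[of h, symmetric] by simp
  also have "\<dots> = 0" by (intro sum.neutral) (simp add: assms(2) Suc)
  finally show ?thesis by simp
qed

text \<open>
  The pole order is at most \<open>N\<close>; the coefficient at \<open>- N\<close> is then multiplicative, whether or not it is
  zero.
\<close>

definition pole_le :: "int \<Rightarrow> 'a::zero fls \<Rightarrow> bool" where
  "pole_le N f \<longleftrightarrow> (\<forall>k < - N. f $$ k = 0)"

lemma pole_le_iff: "pole_le N f \<longleftrightarrow> f = 0 \<or> - fls_subdegree f \<le> N"
proof (cases "f = 0")
  case False
  show ?thesis
  proof
    assume "pole_le N f"
    then have "- N \<le> fls_subdegree f"
      using False unfolding pole_le_def by (intro fls_subdegree_geI) auto
    then show "f = 0 \<or> - fls_subdegree f \<le> N" by simp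
  qed (auto simp: pole_le_def False)
qed (simp add: pole_le_def)

lemma pole_le_mult:
  fixes f g :: "'a::idom fls"
  assumes "pole_le N f" "pole_le M g"
  shows "pole_le (N + M) (f * g)" "(f * g) $$ (- (N + M)) = f $$ (- N) * g $$ (- M)"
proof -
  consider "f = 0 \<or> g = 0" | "f \<noteq> 0" "g \<noteq> 0" by blast
  then have "pole_le (N + M) (f * g) \<and> (f * g) $$ (- (N + M)) = f $$ (- N) * g $$ (- M)"
  proof cases
    case 1
    then show ?thesis by (auto simp: pole_le_def)
  next
    case 2
    then have le: "- N \<le> fls_subdegree f" "- M \<le> fls_subdegree g"
      using assms by (auto simp: pole_le_iff)
    have "(f * g) $$ (- (N + M)) = f $$ (- N) * g $$ (- M)"
    proof (cases "- N = fls_subdegree f \<and> - M = fls_subdegree g")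
      case True
      then show ?thesis using fls_times_base[of f g] by (simp add: algebra_simps)
    next
      case False
      then have "- N < fls_subdegree f \<or> - M < fls_subdegree g" using le by auto
      then have "f $$ (- N) * g $$ (- M) = 0" by auto
      moreover have "- (N + M) < fls_subdegree f + fls_subdegree g" using False le by linarith
      ultimately show ?thesis by (simp add: fls_times_nth_eq0)
    qed
    then show ?thesis using 2 le by (simp add: pole_le_iff)
  qed
  then show "pole_le (N + M) (f * g)" "(f * g) $$ (- (N + M)) = f $$ (- N) * g $$ (- M)" by auto
qed

lemma pole_le_power:
  fixes f :: "'a::idom fls"
  assumes "pole_le N f"
  shows "pole_le (int n * N) (f ^ n)" "(f ^ n) $$ (- (int n * N)) = (f $$ (- N)) ^ n"
proof (induction n)
  case 0
  show "pole_le (int 0 * N) (f ^ 0)" "(f ^ 0) $$ (- (int 0 * N)) = (f $$ (- N)) ^ 0"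
    by (simp_all add: pole_le_def)
next
  case (Suc n)
  note mult = pole_le_mult[OF assms Suc(1)]
  have eq: "N + int n * N = int (Suc n) * N" by (simp add: algebra_simps)
  show "pole_le (int (Suc n) * N) (f ^ Suc n)" "(f ^ Suc n) $$ (- (int (Suc n) * N)) = (f $$ (- N)) ^ Suc n"
    using mult Suc(2) unfolding eq by simp_all
qed

lemma pole_le_mono: "pole_le N f \<Longrightarrow> N \<le> M \<Longrightarrow> pole_le M f"
  by (auto simp: pole_le_def)

lemma pole_le_less: "pole_le N f \<Longrightarrow> N < M \<Longrightarrow> f $$ (- M) = 0"
  by (auto simp: pole_le_def)

lemma pole_le_const [simp]: "pole_le 0 (fls_const c)"
  by (auto simp: pole_le_def)

lemma pole_le_sum: "(\<And>a. a \<in> A \<Longrightarrow> pole_le N (f a)) \<Longrightarrow> pole_le N (\<Sum>a\<in>A. f a :: 'a::comm_monoid_add fls)"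
  by (simp add: pole_le_def fls_nth_sum)

definition hom_poly :: "('a::zero \<Rightarrow> 'b::comm_semiring_1) \<Rightarrow> 'a poly \<Rightarrow> 'b \<Rightarrow> 'b" where
  "hom_poly h p x = poly (map_poly h p) x"

locale ring_hom_types =
  fixes h :: "'a::field \<Rightarrow> 'b::field"
  assumes h_add: "h (a + b) = h a + h b" and h_mult: "h (a * b) = h a * h b" and h_one: "h 1 = 1"
begin

lemma h_zero [simp]: "h 0 = 0"
  using h_add[of 0 0] by (metis add.right_neutral add_left_cancel)

lemma h_minus: "h (- a) = - h a"
  using h_add[of a "- a"] by (simp add: eq_neg_iff_add_eq_0 add.commute)

lemma h_eq_0_iff [simp]: "h a = 0 \<longleftrightarrow> a = 0"
proof
  assume "h a = 0"
  then have "a \<noteq> 0 \<Longrightarrow> h 1 = 0" using h_mult[of a "inverse a"] by simp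
  then show "a = 0" by (auto simp: h_one)
qed simp

lemma hom_poly_0 [simp]: "hom_poly h 0 x = 0"
  by (simp add: hom_poly_def)

lemma hom_poly_pCons [simp]: "hom_poly h (pCons a p) x = h a + x * hom_poly h p x"
  by (simp add: hom_poly_def map_poly_pCons)

lemma hom_poly_add: "hom_poly h (p + q) x = hom_poly h p x + hom_poly h q x"
  by (induction p q rule: poly_induct2) (simp_all add: h_add algebra_simps)

lemma hom_poly_smult: "hom_poly h (smult c p) x = h c * hom_poly h p x"
  by (induction p) (simp_all add: h_mult algebra_simps)

lemma hom_poly_mult: "hom_poly h (p * q) x = hom_poly h p x * hom_poly h q x"
  by (induction p) (simp_all add: hom_poly_add hom_poly_smult algebra_simps)

lemma hom_poly_minus: "hom_poly h (- p) x = - hom_poly h p x"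
  using hom_poly_smult[of "- 1" p x] by (simp add: h_minus h_one)

lemma hom_poly_diff: "hom_poly h (p - q) x = hom_poly h p x - hom_poly h q x"
  using hom_poly_add[of p "- q" x] by (simp add: hom_poly_minus)

end

lemma ring_hom_to_ac: "ring_hom_types (to_ac :: 'a::field \<Rightarrow> 'a alg_closure)"
  by unfold_locales simp_all

lemma ring_hom_fls_const: "ring_hom_types (fls_const :: 'a::field \<Rightarrow> 'a fls)"
  by unfold_locales (auto intro: fls_eqI)

locale weierstrass_coefficients =
  fixes a1 a2 a3 a4 a6 :: "'a::field"
begin

abbreviation "E \<equiv> Weierstrass a1 a2 a3 a4 a6"

text \<open>
  In the parameter \<open>t = x / y\<close> at the base point, \<open>1 / y = t^3 s\<close>, and this is the Weierstrass
  equation for \<open>s\<close>.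
\<close>

lemma ex_local_parametrization:
  "\<exists>s :: 'a fps. s = 1 - fps_const a1 * fps_X * s + fps_const a2 * fps_X^2 * s
     - fps_const a3 * fps_X^3 * s^2 + fps_const a4 * fps_X^4 * s^2 + fps_const a6 * fps_X^6 * s^3"
proof -
  define \<Phi> :: "'a fps \<Rightarrow> 'a fps" where "\<Phi> s = 1 - fps_const a1 * fps_X * s + fps_const a2 * fps_X^2 * s
     - fps_const a3 * fps_X^3 * s^2 + fps_const a4 * fps_X^4 * s^2 + fps_const a6 * fps_X^6 * s^3" for s
  have "\<exists>h. \<Phi> f - \<Phi> g = fps_X * h * (f - g)" for f g
    by (rule exI[of _ "- fps_const a1 + fps_const a2 * fps_X - fps_const a3 * fps_X^2 * (f + g)
          + fps_const a4 * fps_X^3 * (f + g) + fps_const a6 * fps_X^5 * (f^2 + f * g + g^2)"])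
      (simp add: \<Phi>_def algebra_simps power2_eq_square power3_eq_cube eval_nat_numeral del: fps_const_neg)
  then have "\<Phi> f $ n = \<Phi> g $ n" if "\<And>k. k < n \<Longrightarrow> f $ k = g $ k" for f g n
    using fps_X_mult_nth_cong that by metis
  then obtain s where "\<Phi> s = s" by (rule fps_contraction_fixpoint)
  then show ?thesis unfolding \<Phi>_def by metis
qed

definition local_series :: "'a fps" where
  "local_series = (SOME s. s = 1 - fps_const a1 * fps_X * s + fps_const a2 * fps_X^2 * s
     - fps_const a3 * fps_X^3 * s^2 + fps_const a4 * fps_X^4 * s^2 + fps_const a6 * fps_X^6 * s^3)"

definition local_unit :: "'a fls" where
  "local_unit = fps_to_fls local_series"

lemma local_unit:
  "local_unit = 1 - fls_const a1 * fls_X * local_unit + fls_const a2 * fls_X^2 * local_unit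
     - fls_const a3 * fls_X^3 * local_unit^2 + fls_const a4 * fls_X^4 * local_unit^2
     + fls_const a6 * fls_X^6 * local_unit^3" (is ?eq)
  and local_unit_nth_0: "local_unit $$ 0 = 1" (is ?nth)
  and local_unit_subdegree: "fls_subdegree local_unit = 0" (is ?sub)
proof -
  note S = local_unit_def
  let ?s = local_series
  have s: "?s = 1 - fps_const a1 * fps_X * ?s + fps_const a2 * fps_X^2 * ?s
     - fps_const a3 * fps_X^3 * ?s^2 + fps_const a4 * fps_X^4 * ?s^2 + fps_const a6 * fps_X^6 * ?s^3"
    unfolding local_series_def by (rule someI_ex[OF ex_local_parametrization])
  show ?eq
    unfolding S by (subst s)
      (simp only: fps_to_fls_plus fps_to_fls_minus fls_times_fps_to_fls fps_to_fls_power fps_X_to_fls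
         fps_const_to_fls fps_one_to_fls)
  have "?s $ 0 = 1"
    by (subst s) simp
  then show ?nth by (simp add: S)
  then show ?sub by (intro fls_subdegree_eqI) (simp_all add: S)
qed

end

lemma local_parametrization_curve:
  fixes t S Y :: "'b::comm_ring_1"
  assumes S: "S = 1 - a1 * t * S + a2 * t^2 * S - a3 * t^3 * S^2 + a4 * t^4 * S^2 + a6 * t^6 * S^3"
    and Y: "t^3 * S * Y = 1"
  shows "Y^2 + a1 * (t * Y) * Y + a3 * Y = (t * Y)^3 + a2 * (t * Y)^2 + a4 * (t * Y) + a6"
proof -
  have e: "S * (t^3 * Y^3) = Y^2" "S^2 * (t^3 * (t^3 * Y^3)) = Y" "S^3 * (t^6 * (t^3 * Y^3)) = 1"
  proof -
    have "S * (t^3 * Y^3) = (t^3 * S * Y) * Y^2" by (simp add: power2_eq_square power3_eq_cube)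
    then show "S * (t^3 * Y^3) = Y^2" by (simp add: Y)
    have "S^2 * (t^3 * (t^3 * Y^3)) = (t^3 * S * Y)^2 * Y" by (simp add: power2_eq_square power3_eq_cube)
    then show "S^2 * (t^3 * (t^3 * Y^3)) = Y" by (simp add: Y)
    have "S^3 * (t^6 * (t^3 * Y^3)) = (t^3 * S * Y)^3" by (simp add: eval_nat_numeral)
    then show "S^3 * (t^6 * (t^3 * Y^3)) = 1" by (simp add: Y)
  qed
  have "S * (t^3 * Y^3) = (1 - a1 * t * S + a2 * t^2 * S - a3 * t^3 * S^2 + a4 * t^4 * S^2 + a6 * t^6 * S^3) * (t^3 * Y^3)"
    using S by simp
  also have "\<dots> = (t * Y)^3 - a1 * t * (S * (t^3 * Y^3)) + a2 * t^2 * (S * (t^3 * Y^3)) - a3 * (S^2 * (t^3 * (t^3 * Y^3)))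
     + a4 * t * (S^2 * (t^3 * (t^3 * Y^3))) + a6 * (S^3 * (t^6 * (t^3 * Y^3)))"
    by (simp add: algebra_simps eval_nat_numeral)
  finally show ?thesis unfolding e by (simp add: algebra_simps power2_eq_square)
qed

lemma infinite_alg_closed: "infinite (UNIV :: 'b::alg_closed_field set)"
proof
  assume fin: "finite (UNIV :: 'b set)"
  define p :: "'b poly" where "p = (\<Prod>a\<in>UNIV. [:- a, 1:])"
  have "degree p = CARD('b)"
    unfolding p_def by (subst degree_prod_sum_eq) simp_all
  then have "degree (p + 1) > 0" using fin by (simp add: degree_add_eq_left card_gt_0_iff)
  then obtain x where "poly (p + 1) x = 0" using alg_closed_imp_poly_has_root by blast
  moreover have "poly p x = 0" using fin by (simp add: p_def poly_prod prod_zero_iff)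
  ultimately show False by simp
qed

lemma fls_leading_term_cancel:
  fixes f m :: "'a::field fls"
  assumes "pole_le N f" "pole_le N m" "m $$ (- N) = 1"
  shows "pole_le (N - 1) (f - fls_const (f $$ (- N)) * m)"
  using assms unfolding pole_le_def
proof (intro allI impI)
  fix k assume "k < - (N - 1)"
  then have "k < - N \<or> k = - N" by linarith
  then show "(f - fls_const (f $$ (- N)) * m) $$ k = 0"
    using assms by (auto simp: pole_le_def)
qed

section \<open>The coordinate ring of the curve inside the Laurent series\<close>

fun x_coord :: "'k::zero point \<Rightarrow> 'k" where
  "x_coord (Affine x y) = x" | "x_coord Infinity = 0"
fun y_coord :: "'k::zero point \<Rightarrow> 'k" where
  "y_coord (Affine x y) = y" | "y_coord Infinity = 0"

text \<open>
  The coordinate ring is free over the polynomials in \<open>x\<close> with basis \<open>1, y\<close>; this is its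
  multiplication table, which is used both for Laurent series and for values at points.
\<close>

lemma (in ring_hom_types) coordinate_ring_mult:
  assumes "y^2 + h a1 * x * y + h a3 * y = x^3 + h a2 * x^2 + h a4 * x + h a6"
  shows "(hom_poly h u x + hom_poly h v x * y) * (hom_poly h u' x + hom_poly h v' x * y)
    = hom_poly h (u * u' + v * v' * [:a6, a4, a2, 1:]) x
      + hom_poly h (u * v' + u' * v - v * v' * [:a3, a1:]) x * y"
proof -
  have y2: "y * y = hom_poly h [:a6, a4, a2, 1:] x - hom_poly h [:a3, a1:] x * y"
    using assms by (simp add: h_one power2_eq_square power3_eq_cube algebra_simps)
  have "(p + q * y) * (p' + q' * y) = p * p' + (p * q' + p' * q) * y + q * q' * (y * y)" for p q p' q'
    by (simp add: algebra_simps)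
  then show ?thesis unfolding y2
    by (simp only: hom_poly_add hom_poly_diff hom_poly_mult) (simp add: algebra_simps del: hom_poly_pCons)
qed

lemma hom_poly_fls_subdegree:
  fixes t :: "'a::field fls"
  assumes t: "fls_subdegree t < 0"
  shows "u \<noteq> 0 \<Longrightarrow> hom_poly fls_const u t \<noteq> 0 \<and>
    fls_subdegree (hom_poly fls_const u t) = int (degree u) * fls_subdegree t"
proof (induction u)
  case (pCons c p)
  interpret ring_hom_types "fls_const :: 'a \<Rightarrow> 'a fls" by (rule ring_hom_fls_const)
  show ?case
  proof (cases "p = 0")
    case True
    with pCons show ?thesis by simp
  next
    case False
    with pCons have IH: "hom_poly fls_const p t \<noteq> 0" "fls_subdegree (hom_poly fls_const p t) = int (degree p) * fls_subdegree t"
      by auto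
    have "t \<noteq> 0" using t by auto
    then have sub: "t * hom_poly fls_const p t \<noteq> 0"
      "fls_subdegree (t * hom_poly fls_const p t) = int (Suc (degree p)) * fls_subdegree t"
      using IH by (simp_all add: algebra_simps)
    have neg: "int (Suc (degree p)) * fls_subdegree t < 0" using t by (simp add: mult_pos_neg)
    have "fls_subdegree (fls_const c + t * hom_poly fls_const p t) = int (Suc (degree p)) * fls_subdegree t"
      by (subst fls_subdegree_add_eq2) (use sub neg in auto)
    moreover from this neg have "fls_const c + t * hom_poly fls_const p t \<noteq> 0" by auto
    ultimately show ?thesis using False by simp
  qed
qed simp

context weierstrass_coefficients
begin

text \<open>
  The coordinates of the generic point, expanded at the base point.  They have poles of order
  \<open>2\<close> and \<open>3\<close> with leading coefficient \<open>1\<close>.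
\<close>

definition x_gen :: "'a fls" where "x_gen = fls_X * inverse (fls_X^3 * local_unit)"
definition y_gen :: "'a fls" where "y_gen = inverse (fls_X^3 * local_unit)"

lemma local_unit_nonzero: "local_unit \<noteq> 0"
  using local_unit_nth_0 by auto

lemma parameter_nonzero: "fls_X \<noteq> (0 :: 'a fls)"
  using arg_cong[of "fls_X :: 'a fls" 0 "\<lambda>f. f $$ 1"] by auto

lemma generic_point_on_curve: "y_gen^2 + fls_const a1 * x_gen * y_gen + fls_const a3 * y_gen
    = x_gen^3 + fls_const a2 * x_gen^2 + fls_const a4 * x_gen + fls_const a6"
  unfolding x_gen_def y_gen_def
  by (rule local_parametrization_curve[OF local_unit], rule right_inverse)
    (simp add: local_unit_nonzero parameter_nonzero)

lemma y_gen_lead: "y_gen \<noteq> 0" "fls_subdegree y_gen = -3" "y_gen $$ (- 3) = 1"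
proof -
  define D where "D = fls_X^3 * local_unit"
  have y: "y_gen = inverse D" by (simp only: y_gen_def D_def)
  have D: "D \<noteq> 0" "fls_subdegree D = 3"
    by (simp_all add: D_def local_unit_nonzero local_unit_subdegree parameter_nonzero)
  have "D $$ 3 = 1"
    using fls_times_base[of "fls_X^3" local_unit]
    by (simp add: D_def local_unit_nonzero local_unit_subdegree local_unit_nth_0)
  with D fls_inverse_base[of D] show "y_gen \<noteq> 0" "fls_subdegree y_gen = -3" "y_gen $$ (- 3) = 1"
    by (simp_all add: y)
qed

lemma x_gen_lead: "x_gen \<noteq> 0" "fls_subdegree x_gen = -2" "x_gen $$ (- 2) = 1"
proof -
  have x: "x_gen = fls_X * y_gen" by (simp only: x_gen_def y_gen_def)
  show "x_gen \<noteq> 0" "fls_subdegree x_gen = -2" "x_gen $$ (- 2) = 1"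
    using y_gen_lead fls_times_base[of fls_X y_gen] by (simp_all add: x parameter_nonzero)
qed

lemma pole_le_gen: "pole_le 2 x_gen" "pole_le 3 y_gen"
  by (simp_all add: pole_le_iff x_gen_lead y_gen_lead)

definition monomial :: "nat \<Rightarrow> nat \<Rightarrow> 'a fls" where "monomial i j = x_gen ^ i * y_gen ^ j"

lemma monomial_lead:
  "pole_le (2 * int i + 3 * int j) (monomial i j)" "monomial i j $$ (- (2 * int i + 3 * int j)) = 1"
  using pole_le_mult[OF pole_le_power(1)[OF pole_le_gen(1), of i] pole_le_power(1)[OF pole_le_gen(2), of j]]
    pole_le_power(2)[OF pole_le_gen(1), of i] pole_le_power(2)[OF pole_le_gen(2), of j]
  by (simp_all add: monomial_def mult.commute x_gen_lead y_gen_lead)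

interpretation fc: ring_hom_types "fls_const :: 'a \<Rightarrow> 'a fls" by (rule ring_hom_fls_const)
interpretation ac: ring_hom_types "to_ac :: 'a \<Rightarrow> 'a alg_closure" by (rule ring_hom_to_ac)

lemma affine_geometric:
  "Affine a b \<in> geometric_points E \<longleftrightarrow>
    b^2 + to_ac a1 * a * b + to_ac a3 * b = a^3 + to_ac a2 * a^2 + to_ac a4 * a + to_ac a6"
  by (simp add: geometric_points_def geometric_curve_def)

text \<open>
  An element of the coordinate ring, given both by its expansion \<open>\<kappa>\<close> at the base point and by its
  values \<open>\<phi>\<close> at the affine geometric points.
\<close>

definition regular :: "'a fls \<Rightarrow> ('a alg_closure point \<Rightarrow> 'a alg_closure) \<Rightarrow> bool" where
  "regular \<kappa> \<phi> \<longleftrightarrow> (\<exists>u v. \<kappa> = hom_poly fls_const u x_gen + hom_poly fls_const v x_gen * y_gen \<and>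
     (\<forall>a b. Affine a b \<in> geometric_points E \<longrightarrow>
        \<phi> (Affine a b) = hom_poly to_ac u a + hom_poly to_ac v a * b))"

lemma regular_const: "regular (fls_const c) (\<lambda>P. to_ac c)"
  unfolding regular_def by (intro exI[of _ "[:c:]"] exI[of _ 0]) simp

lemma regular_x_gen: "regular x_gen x_coord"
  unfolding regular_def by (intro exI[of _ "[:0, 1:]"] exI[of _ 0]) simp

lemma regular_y_gen: "regular y_gen y_coord"
  unfolding regular_def by (intro exI[of _ 0] exI[of _ "[:1:]"]) simp

lemma regular_add: "regular \<kappa> \<phi> \<Longrightarrow> regular \<kappa>' \<phi>' \<Longrightarrow> regular (\<kappa> + \<kappa>') (\<lambda>P. \<phi> P + \<phi>' P)"
proof -
  assume "regular \<kappa> \<phi>" "regular \<kappa>' \<phi>'"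
  then obtain u v u' v' where *: "\<kappa> = hom_poly fls_const u x_gen + hom_poly fls_const v x_gen * y_gen"
    "\<kappa>' = hom_poly fls_const u' x_gen + hom_poly fls_const v' x_gen * y_gen"
    "\<And>a b. Affine a b \<in> geometric_points E \<Longrightarrow> \<phi> (Affine a b) = hom_poly to_ac u a + hom_poly to_ac v a * b"
    "\<And>a b. Affine a b \<in> geometric_points E \<Longrightarrow> \<phi>' (Affine a b) = hom_poly to_ac u' a + hom_poly to_ac v' a * b"
    unfolding regular_def by auto
  show ?thesis unfolding regular_def
    by (intro exI[of _ "u + u'"] exI[of _ "v + v'"]) (simp add: * fc.hom_poly_add ac.hom_poly_add algebra_simps)
qed

lemma regular_mult:
  assumes "regular \<kappa> \<phi>" "regular \<kappa>' \<phi>'" shows "regular (\<kappa> * \<kappa>') (\<lambda>P. \<phi> P * \<phi>' P)"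
proof -
  obtain u v u' v' where *: "\<kappa> = hom_poly fls_const u x_gen + hom_poly fls_const v x_gen * y_gen"
    "\<kappa>' = hom_poly fls_const u' x_gen + hom_poly fls_const v' x_gen * y_gen"
    "\<And>a b. Affine a b \<in> geometric_points E \<Longrightarrow> \<phi> (Affine a b) = hom_poly to_ac u a + hom_poly to_ac v a * b"
    "\<And>a b. Affine a b \<in> geometric_points E \<Longrightarrow> \<phi>' (Affine a b) = hom_poly to_ac u' a + hom_poly to_ac v' a * b"
    using assms unfolding regular_def by auto
  show ?thesis unfolding regular_def *(1,2) fc.coordinate_ring_mult[OF generic_point_on_curve]
  proof (rule exI, rule exI, rule conjI[OF refl], intro allI impI)
    fix a b assume ab: "Affine a b \<in> geometric_points E"
    show "\<phi> (Affine a b) * \<phi>' (Affine a b) =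
        hom_poly to_ac (u * u' + v * v' * [:a6, a4, a2, 1:]) a
        + hom_poly to_ac (u * v' + u' * v - v * v' * [:a3, a1:]) a * b"
      unfolding *(3)[OF ab] *(4)[OF ab] by (rule ac.coordinate_ring_mult[OF ab[unfolded affine_geometric]])
  qed
qed

lemma regular_cmult: "regular \<kappa> \<phi> \<Longrightarrow> regular (fls_const c * \<kappa>) (\<lambda>P. to_ac c * \<phi> P)"
  by (rule regular_mult[OF regular_const])

lemma regular_diff: "regular \<kappa> \<phi> \<Longrightarrow> regular \<kappa>' \<phi>' \<Longrightarrow> regular (\<kappa> - \<kappa>') (\<lambda>P. \<phi> P - \<phi>' P)"
  using regular_add[of \<kappa> \<phi> "fls_const (- 1) * \<kappa>'" "\<lambda>P. to_ac (- 1) * \<phi>' P"] regular_cmult[of \<kappa>' \<phi>' "- 1"]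
  by simp

lemma regular_power: "regular \<kappa> \<phi> \<Longrightarrow> regular (\<kappa> ^ n) (\<lambda>P. \<phi> P ^ n)"
  using regular_const[of 1] by (induction n) (simp_all add: regular_mult)

lemma regular_sum:
  "(\<And>a. a \<in> A \<Longrightarrow> regular (\<kappa> a) (\<phi> a)) \<Longrightarrow> regular (\<Sum>a\<in>A. \<kappa> a) (\<lambda>P. \<Sum>a\<in>A. \<phi> a P)"
  using regular_const[of 0] by (induction A rule: infinite_finite_induct) (simp_all add: regular_add)

lemma hom_poly_x_gen_subdegree:
  "u \<noteq> 0 \<Longrightarrow> hom_poly fls_const u x_gen \<noteq> 0 \<and> fls_subdegree (hom_poly fls_const u x_gen) = - 2 * int (degree u)"
  using hom_poly_fls_subdegree[of x_gen u] by (simp add: x_gen_lead)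

text \<open>
  The two summands have poles of even order and of odd order at least \<open>3\<close>, so they cannot cancel, and
  no regular function has a simple pole.
\<close>

lemma normal_form_weight:
  assumes "\<not> (u = 0 \<and> v = 0)"
  defines "\<kappa> \<equiv> hom_poly fls_const u x_gen + hom_poly fls_const v x_gen * y_gen"
  shows "\<kappa> \<noteq> 0" "\<exists>w::nat. w \<noteq> 1 \<and> fls_subdegree \<kappa> = - int w"
proof -
  have vY: "hom_poly fls_const v x_gen * y_gen \<noteq> 0"
    "fls_subdegree (hom_poly fls_const v x_gen * y_gen) = - int (2 * degree v + 3)" if "v \<noteq> 0"
    using hom_poly_x_gen_subdegree[OF that] y_gen_lead by simp_all
  consider "v = 0" "u \<noteq> 0" | "u = 0" "v \<noteq> 0" | "u \<noteq> 0" "v \<noteq> 0" using assms(1) by blast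
  then have "\<kappa> \<noteq> 0 \<and> (\<exists>w::nat. w \<noteq> 1 \<and> fls_subdegree \<kappa> = - int w)"
  proof cases
    case 1
    then show ?thesis using hom_poly_x_gen_subdegree[of u]
      by (auto simp: \<kappa>_def intro!: exI[of _ "2 * degree u"])
  next
    case 2
    then show ?thesis using vY by (auto simp: \<kappa>_def intro!: exI[of _ "2 * degree v + 3"])
  next
    case 3
    note u = hom_poly_x_gen_subdegree[OF 3(1)]
    have "2 * degree u \<noteq> 2 * degree v + 3" by presburger
    then consider "2 * degree u < 2 * degree v + 3" | "2 * degree u > 2 * degree v + 3" by linarith
    then show ?thesis
    proof cases
      case 1
      then have "fls_subdegree \<kappa> = - int (2 * degree v + 3)"
        unfolding \<kappa>_def using u vY[OF 3(2)] by (subst fls_subdegree_add_eq2) auto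
      moreover from this have "\<kappa> \<noteq> 0" by auto
      ultimately show ?thesis by (intro conjI exI[of _ "2 * degree v + 3"]) auto
    next
      case 2
      then have "fls_subdegree \<kappa> = - int (2 * degree u)"
        unfolding \<kappa>_def using u vY[OF 3(2)] by (subst fls_subdegree_add_eq1) auto
      moreover from this 2 have "\<kappa> \<noteq> 0" by auto
      ultimately show ?thesis by (intro conjI exI[of _ "2 * degree u"]) auto
    qed
  qed
  then show "\<kappa> \<noteq> 0" "\<exists>w::nat. w \<noteq> 1 \<and> fls_subdegree \<kappa> = - int w" by auto
qed

lemma regular_weight:
  assumes "regular \<kappa> \<phi>" "\<kappa> \<noteq> 0"
  obtains w :: nat where "w \<noteq> 1" "fls_subdegree \<kappa> = - int w"
proof -
  obtain u v where \<kappa>: "\<kappa> = hom_poly fls_const u x_gen + hom_poly fls_const v x_gen * y_gen"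
    using assms(1) unfolding regular_def by blast
  have "\<not> (u = 0 \<and> v = 0)" using assms(2) \<kappa> by auto
  from normal_form_weight(2)[OF this] obtain w :: nat where "w \<noteq> 1" "fls_subdegree \<kappa> = - int w"
    unfolding \<kappa> by auto
  then show thesis by (rule that)
qed

lemma regular_zero:
  assumes "regular 0 \<phi>" "Affine a b \<in> geometric_points E" shows "\<phi> (Affine a b) = 0"
proof -
  obtain u v where "0 = hom_poly fls_const u x_gen + hom_poly fls_const v x_gen * y_gen"
    "\<phi> (Affine a b) = hom_poly to_ac u a + hom_poly to_ac v a * b"
    using assms by (auto simp: regular_def)
  with normal_form_weight(1)[of u v] show ?thesis by (cases "u = 0 \<and> v = 0") auto
qed

lemma regular_unique:
  assumes "regular \<kappa> \<phi>" "regular \<kappa> \<psi>" "Affine a b \<in> geometric_points E"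
  shows "\<phi> (Affine a b) = \<psi> (Affine a b)"
  using regular_zero[of "\<lambda>P. \<phi> P - \<psi> P", OF _ assms(3)] regular_diff[OF assms(1,2)] by simp

lemma regular_finite_zeros:
  assumes "regular \<kappa> \<phi>" "\<kappa> \<noteq> 0"
  shows "finite {P \<in> geometric_points E. P \<noteq> Infinity \<and> \<phi> P = 0}"
proof -
  obtain u v where \<kappa>: "\<kappa> = hom_poly fls_const u x_gen + hom_poly fls_const v x_gen * y_gen"
    and \<phi>: "\<And>a b. Affine a b \<in> geometric_points E \<Longrightarrow> \<phi> (Affine a b) = hom_poly to_ac u a + hom_poly to_ac v a * b"
    using assms(1) by (auto simp: regular_def)
  \<comment> \<open>The norm of \<open>u + v Y\<close>, that is its product with the conjugate \<open>(u - v (a1 X + a3)) - v Y\<close>.\<close>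
  define u' where "u' = u - v * [:a3, a1:]"
  define N where "N = u * u' + v * (- v) * [:a6, a4, a2, 1:]"
  have zero: "u * - v + u' * v - v * - v * [:a3, a1:] = 0"
    by (simp add: u'_def algebra_simps)
  have "\<kappa> * (hom_poly fls_const u' x_gen + hom_poly fls_const (- v) x_gen * y_gen) = hom_poly fls_const N x_gen"
    unfolding \<kappa> fc.coordinate_ring_mult[OF generic_point_on_curve] zero by (simp add: N_def)
  moreover have "\<not> (u' = 0 \<and> - v = 0)" using assms(2) \<kappa> by (auto simp: u'_def)
  ultimately have "N \<noteq> 0" using normal_form_weight(1)[of u' "- v"] assms(2) by auto
  have N: "hom_poly to_ac N a = 0" if "Affine a b \<in> geometric_points E" "\<phi> (Affine a b) = 0" for a b
  proof -
    have "\<phi> (Affine a b) * (hom_poly to_ac u' a + hom_poly to_ac (- v) a * b) = hom_poly to_ac N a"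
      unfolding \<phi>[OF that(1)] ac.coordinate_ring_mult[OF that(1)[unfolded affine_geometric]] zero by (simp add: N_def)
    then show ?thesis using that(2) by simp
  qed
  have "map_poly to_ac N \<noteq> 0" using \<open>N \<noteq> 0\<close> by (simp add: map_poly_eq_0_iff)
  then have fin: "finite {a. hom_poly to_ac N a = 0}" unfolding hom_poly_def by (rule poly_roots_finite)
  let ?q = "\<lambda>a. [:- (a^3 + to_ac a2 * a^2 + to_ac a4 * a + to_ac a6), to_ac a1 * a + to_ac a3, 1:]"
  have "{P \<in> geometric_points E. P \<noteq> Infinity \<and> \<phi> P = 0}
    \<subseteq> (\<Union>a\<in>{a. hom_poly to_ac N a = 0}. Affine a ` {b. poly (?q a) b = 0})"
  proof
    fix P assume P: "P \<in> {P \<in> geometric_points E. P \<noteq> Infinity \<and> \<phi> P = 0}"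
    then obtain a b where ab: "P = Affine a b" by (cases P) auto
    then have "poly (?q a) b = 0" using P by (simp add: affine_geometric algebra_simps power2_eq_square)
    then show "P \<in> (\<Union>a\<in>{a. hom_poly to_ac N a = 0}. Affine a ` {b. poly (?q a) b = 0})"
      using P N ab by auto
  qed
  then show ?thesis
    by (rule finite_subset) (intro finite_UN_I fin finite_imageI poly_roots_finite; simp)
qed

lemma infinite_geometric_points: "infinite (geometric_points E)"
proof
  assume fin: "finite (geometric_points E)"
  have "a \<in> x_coord ` geometric_points E" for a
  proof -
    let ?q = "[:- (a^3 + to_ac a2 * a^2 + to_ac a4 * a + to_ac a6), to_ac a1 * a + to_ac a3, 1:]"
    obtain b where "poly ?q b = 0" using alg_closed_imp_poly_has_root[of ?q] by auto
    then have "Affine a b \<in> geometric_points E" by (simp add: affine_geometric algebra_simps power2_eq_square)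
    then show ?thesis by (metis image_eqI x_coord.simps(1))
  qed
  then have "(UNIV :: 'a alg_closure set) \<subseteq> x_coord ` geometric_points E" by blast
  then show False using fin infinite_alg_closed finite_subset finite_imageI by blast
qed

end

section \<open>Nonsingular cubics have no polynomial parametrization\<close>

text \<open>
  The polynomials over the algebraic closure thereby have greatest common divisors.
\<close>

instance alg_closure :: (field) field_gcd ..

lemma singular_point_discriminant:
  fixes x y :: "'b::comm_ring_1"
  assumes "y^2 + a1 * x * y + a3 * y = x^3 + a2 * x^2 + a4 * x + a6"
    and "2 * y + a1 * x + a3 = 0" and "a1 * y = 3 * x^2 + 2 * a2 * x + a4"
  shows "discriminant (Weierstrass a1 a2 a3 a4 a6) = 0"
proof -
  have a3: "a3 = - 2 * y - a1 * x" using assms(2) by (simp add: algebra_simps eq_neg_iff_add_eq_0)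
  have a4: "a4 = a1 * y - 3 * x^2 - 2 * a2 * x" using assms(3) by (simp add: algebra_simps)
  have a6: "a6 = y^2 + a1 * x * y + a3 * y - x^3 - a2 * x^2 - a4 * x" using assms(1) by (simp add: algebra_simps)
  show ?thesis
    unfolding a6 unfolding a4 unfolding a3 discriminant.simps Let_def
    by (simp add: algebra_simps eval_nat_numeral)
qed

lemma degree_pderiv_bound: "degree (pderiv q) \<le> degree q - 1"
  by (intro degree_le) (auto simp: coeff_pderiv coeff_eq_0)

text \<open>
  Let \<open>P\<close> and \<open>Q\<close> be the partial derivatives of the Weierstrass equation along the parametrization.  They
  have no common zero, as the curve is nonsingular, and \<open>P b' = Q a'\<close>; so \<open>P\<close> divides \<open>a'\<close> and \<open>Q\<close> divides
  \<open>b'\<close>.  Comparing degrees, the first is impossible if \<open>2\<close> is invertible and the second if \<open>2 = 0\<close>.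
\<close>

lemma no_polynomial_parametrization:
  fixes a b :: "'b::{alg_closed_field, field_gcd} poly"
  assumes curve: "b^2 + [:a1:] * a * b + [:a3:] * b = a^3 + [:a2:] * a^2 + [:a4:] * a + [:a6:]"
    and deg: "degree a = 2" "degree b = 3"
    and disc: "discriminant (Weierstrass a1 a2 a3 a4 a6) \<noteq> 0"
  shows False
proof -
  define P where "P = 2 * b + [:a1:] * a + [:a3:]"
  define Q where "Q = 3 * a^2 + 2 * [:a2:] * a + [:a4:] - [:a1:] * b"
  have no_root: "\<not> (poly P t = 0 \<and> poly Q t = 0)" for t
  proof
    assume *: "poly P t = 0 \<and> poly Q t = 0"
    have "poly (b^2 + [:a1:] * a * b + [:a3:] * b) t = poly (a^3 + [:a2:] * a^2 + [:a4:] * a + [:a6:]) t"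
      using curve by simp
    then have "discriminant (Weierstrass a1 a2 a3 a4 a6) = 0"
      using * by (intro singular_point_discriminant[of "poly b t" a1 "poly a t"])
        (simp_all add: P_def Q_def poly_power algebra_simps)
    with disc show False ..
  qed
  have coprime: "coprime P Q"
  proof (rule ccontr)
    assume "\<not> coprime P Q"
    then have "\<not> is_unit (gcd P Q)" using is_unit_gcd by blast
    then have "gcd P Q = 0 \<or> degree (gcd P Q) > 0" using is_unit_iff_degree[of "gcd P Q"] by blast
    then have "\<exists>t. poly (gcd P Q) t = 0"
    proof
      assume "gcd P Q = 0"
      then show ?thesis by (metis poly_0)
    qed (rule alg_closed_imp_poly_has_root)
    then obtain t where "poly (gcd P Q) t = 0" ..
    then have "[:- t, 1:] dvd gcd P Q" by (simp add: poly_eq_0_iff_dvd)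
    then have "[:- t, 1:] dvd P" "[:- t, 1:] dvd Q" by (rule dvd_trans, simp)+
    then show False using no_root[of t] by (simp add: poly_eq_0_iff_dvd)
  qed
  have "pderiv (b^2 + [:a1:] * a * b + [:a3:] * b) = pderiv (a^3 + [:a2:] * a^2 + [:a4:] * a + [:a6:])"
    using curve by simp
  then have deriv: "P * pderiv b = Q * pderiv a"
    by (simp add: P_def Q_def pderiv_add pderiv_mult pderiv_smult smult_add_right power2_eq_square power3_eq_cube pderiv_pCons algebra_simps)
  have lead: "coeff a 2 \<noteq> 0" "coeff b 3 \<noteq> 0"
    using deg leading_coeff_0_iff[of a] leading_coeff_0_iff[of b] by auto
  show False
  proof (cases "(2 :: 'b) = 0")
    case False
    have "P dvd Q * pderiv a" by (simp flip: deriv)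
    then have dvd: "P dvd pderiv a" using coprime by (simp add: coprime_dvd_mult_right_iff)
    have "coeff P 3 = 2 * coeff b 3"
      using deg by (simp add: P_def coeff_eq_0 numeral_poly coeff_pCons split: nat.split)
    then have "coeff P 3 \<noteq> 0" using False lead by simp
    then have "3 \<le> degree P" by (rule le_degree)
    moreover have "degree (pderiv a) \<le> 1" using degree_pderiv_bound[of a] deg by simp
    ultimately have "pderiv a = 0" using dvd dvd_imp_degree_le[of P "pderiv a"] by linarith
    then have "coeff (pderiv a) 1 = 0" by simp
    then have "2 * coeff a 2 = 0" by (simp add: coeff_pderiv numeral_2_eq_2)
    then show False using False lead by simp
  next
    case True
    have "(3 :: 'b) = 2 + 1" by simp
    then have three: "(3 :: 'b) = 1" by (simp only: True add_0_left)
    have "Q dvd P * pderiv b" by (simp add: deriv)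
    then have dvd: "Q dvd pderiv b" using coprime by (simp add: coprime_dvd_mult_right_iff coprime_commute)
    have "coeff (a^2) 4 = coeff a 2 ^ 2"
      using coeff_mult_degree_sum[of a a] deg by (simp add: power2_eq_square)
    then have "coeff Q 4 = 3 * coeff a 2 ^ 2"
      using deg by (simp add: Q_def coeff_eq_0 numeral_poly coeff_pCons split: nat.split)
    then have "coeff Q 4 \<noteq> 0" using three lead by simp
    then have "4 \<le> degree Q" by (rule le_degree)
    moreover have "degree (pderiv b) \<le> 2" using degree_pderiv_bound[of b] deg by simp
    ultimately have "pderiv b = 0" using dvd dvd_imp_degree_le[of Q "pderiv b"] by linarith
    then have "coeff (pderiv b) 2 = 0" by simp
    then have "3 * coeff b 3 = 0" by (simp add: coeff_pderiv numeral_3_eq_3 numeral_2_eq_2)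
    then show False using three lead by simp
  qed
qed

section \<open>Forms as regular functions with bounded poles\<close>

context weierstrass_coefficients
begin

text \<open>
  The form evaluated at the generic point, in the affine chart \<open>z = 1\<close>.
\<close>

definition form_value :: "nat \<Rightarrow> (nat \<Rightarrow> nat \<Rightarrow> 'a) \<Rightarrow> 'a fls" where
  "form_value d c = (\<Sum>i\<le>d. \<Sum>j\<le>d - i. fls_const (c i j) * monomial i j)"

lemma regular_cong:
  "regular \<kappa> \<phi> \<Longrightarrow> (\<And>a b. Affine a b \<in> geometric_points E \<Longrightarrow> \<phi> (Affine a b) = \<psi> (Affine a b)) \<Longrightarrow> regular \<kappa> \<psi>"
  unfolding regular_def by fastforce

lemma regular_monomial: "regular (monomial i j) (\<lambda>P. x_coord P ^ i * y_coord P ^ j)"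
  unfolding monomial_def by (intro regular_mult regular_power regular_x_gen regular_y_gen)

lemma regular_form: "regular (form_value d c) (\<lambda>P. ternary_form d (\<lambda>i j. to_ac (c i j)) (homog_coords P))"
proof (rule regular_cong)
  show "regular (form_value d c) (\<lambda>P. \<Sum>i\<le>d. \<Sum>j\<le>d - i. to_ac (c i j) * (x_coord P ^ i * y_coord P ^ j))"
    unfolding form_value_def by (intro regular_sum regular_cmult regular_monomial)
qed (simp add: mult.assoc)

lemma form_value_pole:
  "pole_le (3 * int d) (form_value d c)" "form_value d c $$ (- (3 * int d)) = c 0 d"
proof -
  have le: "2 * int i + 3 * int j \<le> 3 * int d" if "i \<le> d" "j \<le> d - i" for i j using that by linarith
  have "pole_le (3 * int d) (fls_const (c i j) * monomial i j)" if "i \<le> d" "j \<le> d - i" for i j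
    using pole_le_mult(1)[OF pole_le_const monomial_lead(1)] le[OF that] by (metis add_0 pole_le_mono)
  then show "pole_le (3 * int d) (form_value d c)"
    unfolding form_value_def by (intro pole_le_sum) auto
  have "(fls_const (c i j) * monomial i j) $$ (- (3 * int d)) = (if i = 0 then if j = d then c 0 d else 0 else 0)"
    if "i \<le> d" "j \<le> d - i" for i j
  proof (cases "i = 0 \<and> j = d")
    case True
    then show ?thesis using monomial_lead(2)[of 0 d] by simp
  next
    case False
    then have "2 * int i + 3 * int j < 3 * int d" using that by (cases "i = 0") auto
    then have "monomial i j $$ (- (3 * int d)) = 0" by (rule pole_le_less[OF monomial_lead(1)])
    then show ?thesis using False by auto
  qed
  then have "form_value d c $$ (- (3 * int d)) = (\<Sum>i\<le>d. \<Sum>j\<le>d - i. if i = 0 then if j = d then c 0 d else 0 else 0)"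
    unfolding form_value_def fls_nth_sum by (intro sum.cong refl) auto
  also have "\<dots> = (\<Sum>i\<le>d. if i = 0 then \<Sum>j\<le>d - i. if j = d then c 0 d else 0 else 0)"
    by (intro sum.cong) auto
  also have "\<dots> = c 0 d" by simp
  finally show "form_value d c $$ (- (3 * int d)) = c 0 d" .
qed

text \<open>
  The value of a form of degree \<open>d\<close> at the base point is the coefficient of its expansion there at the
  highest possible pole order \<open>3 d\<close>; in this way
  identities between expansions also hold at the base point.
\<close>

lemma form_at_Infinity:
  "ternary_form d (\<lambda>i j. to_ac (c i j)) (homog_coords Infinity) = to_ac (form_value d c $$ (- (3 * int d)))"
proof -
  have "ternary_form d (\<lambda>i j. to_ac (c i j)) (homog_coords Infinity)
    = (\<Sum>i\<le>d. if i = 0 then \<Sum>j\<le>d - i. if j = d then to_ac (c 0 d) else 0 else 0)"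
    unfolding homog_coords.simps ternary_form.simps
  proof (rule sum.cong[OF refl])
    fix i assume "i \<in> {..d}"
    show "(\<Sum>j\<le>d - i. to_ac (c i j) * 0 ^ i * 1 ^ j * 0 ^ (d - i - j))
      = (if i = 0 then \<Sum>j\<le>d - i. if j = d then to_ac (c 0 d) else 0 else 0)"
      by (auto intro!: sum.cong sum.neutral simp: power_0_left if_distrib[of "\<lambda>x. _ * x"] eq_commute[of d] cong: if_cong)
  qed
  also have "\<dots> = to_ac (c 0 d)" by simp
  finally show ?thesis by (simp add: form_value_pole)
qed

text \<open>
  The exponent of \<open>x\<close> is at most \<open>2\<close>, so that the degree of the monomial is at most a third of its pole
  order, rounded up.
\<close>

lemma weight_monomial:
  assumes "w \<noteq> 1" "w \<le> 3 * d"
  obtains i j where "2 * i + 3 * j = (w :: nat)" "i + j \<le> d"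
proof -
  have "(\<exists>k. w = 3 * k) \<or> (\<exists>k. w = 3 * k + 4) \<or> (\<exists>k. w = 3 * k + 2)"
    using assms(1) by presburger
  then consider k where "w = 3 * k" | k where "w = 3 * k + 4" | k where "w = 3 * k + 2" by blast
  then show thesis
  proof cases
    case (1 k)
    then show thesis using assms(2) by (intro that[of 0 k]) simp_all
  next
    case (2 k)
    then show thesis using assms(2) by (intro that[of 2 k]) simp_all
  next
    case (3 k)
    then show thesis using assms(2) by (intro that[of 1 k]) simp_all
  qed
qed

lemma regular_pole_le_minus_one:
  assumes "regular \<kappa> \<phi>" "pole_le (- 1) \<kappa>" shows "\<kappa> = 0"
proof (rule ccontr)
  assume nz: "\<kappa> \<noteq> 0"
  obtain w :: nat where "fls_subdegree \<kappa> = - int w" by (rule regular_weight[OF assms(1) nz])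
  then show False using assms(2) nz by (simp add: pole_le_iff)
qed

lemma regular_pole_le_one:
  assumes "regular \<kappa> \<phi>" "pole_le 1 \<kappa>" shows "pole_le 0 \<kappa>"
proof (cases "\<kappa> = 0")
  case False
  obtain w :: nat where "w \<noteq> 1" "fls_subdegree \<kappa> = - int w" by (rule regular_weight[OF assms(1) False])
  then show ?thesis using assms(2) False by (simp add: pole_le_iff)
qed (simp add: pole_le_iff)

lemma form_value_add: "form_value d c + form_value d c' = form_value d (\<lambda>i j. c i j + c' i j)"
proof -
  interpret fc: ring_hom_types "fls_const :: 'a \<Rightarrow> 'a fls" by (rule ring_hom_fls_const)
  show ?thesis by (simp add: form_value_def fc.h_add distrib_right sum.distrib)
qed

lemma form_value_monomial:
  assumes "i + j \<le> d"
  shows "form_value d (\<lambda>i' j'. if i' = i then if j' = j then a else 0 else 0) = fls_const a * monomial i j"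
proof -
  have "form_value d (\<lambda>i' j'. if i' = i then if j' = j then a else 0 else 0)
    = (\<Sum>i'\<le>d. if i' = i then \<Sum>j'\<le>d - i. if j' = j then fls_const a * monomial i j else 0 else 0)"
    unfolding form_value_def
    by (intro sum.cong refl)
      (auto intro!: sum.cong simp: if_distrib[of fls_const] if_distrib[of "\<lambda>x. x * _"] cong: if_cong)
  then show ?thesis using assms by simp
qed

text \<open>
  Conversely to \<open>form_value_pole\<close>, the forms of degree \<open>d\<close> exhaust the regular functions with a pole of
  order at most \<open>3 d\<close>: subtract multiples of monomials until nothing is left.
\<close>

lemma regular_is_form:
  assumes "regular \<kappa> \<phi>" "pole_le (3 * int d) \<kappa>"
  obtains c where "\<kappa> = form_value d c"
proof -
  have "\<exists>c. \<kappa> = form_value d c" if "regular \<kappa> \<phi>" "pole_le (int w - 1) \<kappa>" "w \<le> 3 * d + 1" for w \<kappa> \<phi>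
    using that
  proof (induction w arbitrary: \<kappa> \<phi>)
    case 0
    then have "\<kappa> = 0" using regular_pole_le_minus_one[of \<kappa> \<phi>] by simp
    then have "\<kappa> = form_value d (\<lambda>i j. 0)" by (simp add: form_value_def)
    then show ?case by (rule exI[of _ "\<lambda>i j. 0"])
  next
    case (Suc w)
    show ?case
    proof (cases "w = 1")
      case True
      then show ?thesis using Suc regular_pole_le_one[of \<kappa> \<phi>] by simp
    next
      case False
      then obtain i j where ij: "2 * i + 3 * j = w" "i + j \<le> d"
        using weight_monomial[of w d] Suc.prems(3) by auto
      define a where "a = \<kappa> $$ (- int w)"
      have w: "2 * int i + 3 * int j = int w" using ij(1) by linarith
      have "pole_le (int w) \<kappa>" using Suc.prems(2) by simp
      then have "pole_le (int w - 1) (\<kappa> - fls_const a * monomial i j)"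
        unfolding a_def using monomial_lead[of i j] unfolding w by (rule fls_leading_term_cancel)
      moreover have "regular (\<kappa> - fls_const a * monomial i j) (\<lambda>P. \<phi> P - to_ac a * (x_coord P ^ i * y_coord P ^ j))"
        by (intro regular_diff Suc.prems regular_cmult regular_monomial)
      ultimately obtain c where c: "\<kappa> - fls_const a * monomial i j = form_value d c"
        using Suc.IH Suc.prems(3) by fastforce
      have "\<kappa> = form_value d c + form_value d (\<lambda>i' j'. if i' = i then if j' = j then a else 0 else 0)"
        unfolding form_value_monomial[OF ij(2)] c[symmetric] by simp
      then show ?thesis unfolding form_value_add by blast
    qed
  qed
  from this[of \<kappa> \<phi> "3 * d + 1"] assms that show thesis by auto
qed

end

section \<open>Regular functions with derivative zero\<close>

lemma pole_le_minus_one: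
  assumes "pole_le N f" "f $$ (- N) = 0" shows "pole_le (N - 1) f"
  unfolding pole_le_def
proof (intro allI impI)
  fix k assume "k < - (N - 1)"
  then have "k < - N \<or> k = - N" by linarith
  then show "f $$ k = 0" using assms by (auto simp: pole_le_def)
qed

locale perfect_weierstrass = weierstrass_coefficients +
  fixes p :: nat
  assumes p_CHAR: "p = CHAR('a)" and p_prime: "prime p"
    and perfect: "\<And>a :: 'a. \<exists>b. b ^ p = a"
    and nonsingular: "elliptic_curve E"
begin

interpretation fc: ring_hom_types "fls_const :: 'a \<Rightarrow> 'a fls" by (rule ring_hom_fls_const)
interpretation ac: ring_hom_types "to_ac :: 'a \<Rightarrow> 'a alg_closure" by (rule ring_hom_to_ac)

lemma of_nat_p [simp]: "of_nat p = (0 :: 'a fls)"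
  unfolding p_CHAR by (metis of_nat_CHAR semiring_char_fls)

lemma fls_add_p: "(f + g) ^ p = f ^ p + (g ^ p :: 'a fls)"
  by (rule freshmans_dream) (use p_prime p_CHAR in simp_all)

lemma ac_add_p: "(f + g) ^ p = f ^ p + (g ^ p :: 'a alg_closure)"
  by (rule freshmans_dream) (use p_prime p_CHAR in simp_all)

lemma deriv_p_power [simp]: "fls_deriv (f ^ p) = (0 :: 'a fls)"
  by (simp add: fls_deriv_power)

lemma deriv_zero_subdegree:
  assumes "f \<noteq> 0" "fls_deriv f = (0 :: 'a fls)"
  shows "int p dvd fls_subdegree f"
proof -
  let ?n = "fls_subdegree f"
  have "fls_deriv f $$ (?n - 1) = of_int ?n * f $$ ?n" by simp
  then have "of_int ?n = (0 :: 'a)" using assms by simp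
  then show ?thesis unfolding p_CHAR by (simp add: of_int_eq_0_iff_char_dvd)
qed

lemma deriv_zero_pole_le:
  assumes "fls_deriv f = (0 :: 'a fls)" "pole_le (int p * int (Suc m) - 1) f"
  shows "pole_le (int p * int m) f"
proof (cases "f = 0")
  case False
  then obtain k where k: "fls_subdegree f = int p * k" using deriv_zero_subdegree[OF _ assms(1)] by (auto elim: dvdE)
  have "int p * (- k) < int p * int (Suc m)" using assms(2) False by (simp add: pole_le_iff k)
  then have "- k < int (Suc m)" by (rule mult_left_less_imp_less) simp
  then have "- k \<le> int m" by simp
  then have "int p * (- k) \<le> int p * int m" by (intro mult_left_mono) simp_all
  then show ?thesis by (simp add: pole_le_iff k)
qed (simp add: pole_le_iff)

text \<open>
  If some function \<open>H\<close> with derivative \<open>0\<close> has a pole of order exactly \<open>p\<close>, then it generates all of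
  them: their pole orders are divisible by \<open>p\<close>, so powers of \<open>H\<close> can cancel every leading term.
\<close>

lemma kernel_polynomial:
  assumes H: "regular H \<psi>" "fls_deriv H = 0" "pole_le (int p) H" "H $$ (- int p) = 1"
    and F: "regular F \<phi>" "fls_deriv F = 0" "pole_le (int p * int m) F"
  obtains a where "F = hom_poly fls_const a H" "degree a \<le> m" "coeff a m = F $$ (- (int p * int m))"
proof -
  have "\<exists>a. F = hom_poly fls_const a H \<and> degree a \<le> m \<and> coeff a m = F $$ (- (int p * int m))"
    using F
  proof (induction m arbitrary: F \<phi>)
    case 0
    have pole0: "pole_le (0 - 1) (F - fls_const (F $$ (- 0)) * 1)"
      by (rule fls_leading_term_cancel) (use 0(3) in \<open>simp_all add: pole_le_iff\<close>)
    have "regular (F - fls_const (F $$ 0)) (\<lambda>P. \<phi> P - to_ac (F $$ 0))"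
      by (intro regular_diff 0 regular_const)
    from regular_pole_le_minus_one[OF this] pole0 have "F - fls_const (F $$ 0) = 0" by simp
    then have "F = hom_poly fls_const [:F $$ 0:] H" by simp
    then show ?case by (intro exI[of _ "[:F $$ 0:]"]) simp
  next
    case (Suc m)
    define c where "c = F $$ (- (int p * int (Suc m)))"
    have pow: "pole_le (int p * int (Suc m)) (H ^ Suc m)" "(H ^ Suc m) $$ (- (int p * int (Suc m))) = 1"
      using pole_le_power[OF H(3), of "Suc m"] unfolding H(4) power_one mult.commute[of "int (Suc m)"] .
    have D: "fls_deriv (F - fls_const c * H ^ Suc m) = 0"
      using Suc.prems(2) H(2) by (simp add: fls_deriv_power del: power_Suc)
    have pole: "pole_le (int p * int (Suc m) - 1) (F - fls_const c * H ^ Suc m)"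
      unfolding c_def by (rule fls_leading_term_cancel[OF Suc.prems(3) pow])
    have reg: "regular (F - fls_const c * H ^ Suc m) (\<lambda>P. \<phi> P - to_ac c * \<psi> P ^ Suc m)"
      by (intro regular_diff Suc.prems regular_cmult regular_power H)
    obtain a where a: "F - fls_const c * H ^ Suc m = hom_poly fls_const a H" "degree a \<le> m"
      using Suc.IH[OF reg D deriv_zero_pole_le[OF D pole]] by blast
    have "hom_poly fls_const (a + monom c (Suc m)) H = F"
      unfolding fc.hom_poly_add a(1)[symmetric] by (simp add: hom_poly_def map_poly_monom poly_monom)
    moreover have "degree (a + monom c (Suc m)) \<le> Suc m"
      using a(2) by (intro degree_add_le) (simp_all add: degree_monom_le)
    moreover have "coeff (a + monom c (Suc m)) (Suc m) = c"
      using a(2) by (simp add: coeff_eq_0)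
    ultimately show ?case unfolding c_def by (intro exI[of _ "a + monom (F $$ (- (int p * int (Suc m)))) (Suc m)"] conjI) simp_all
  qed
  then obtain a where "F = hom_poly fls_const a H \<and> degree a \<le> m \<and> coeff a m = F $$ (- (int p * int m))" ..
  then show thesis by (intro that[of a]) simp_all
qed

lemma discriminant_p_power:
  "discriminant (Weierstrass (to_ac a1 ^ p) (to_ac a2 ^ p) (to_ac a3 ^ p) (to_ac a4 ^ p) (to_ac a6 ^ p)) \<noteq> 0"
proof -
  have minus: "(f - g) ^ p = f ^ p - (g ^ p :: 'a alg_closure)" for f g
    using ac_add_p[of "f - g" g] by simp
  have neg: "(- f) ^ p = - (f ^ p :: 'a alg_closure)" for f
    using minus[of 0 f] p_prime by (simp add: zero_power prime_gt_0_nat)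
  have num: "of_nat n ^ p = (of_nat n :: 'a alg_closure)" for n
    by (induction n) (simp_all add: ac_add_p zero_power prime_gt_0_nat p_prime)
  have num: "numeral n ^ p = (numeral n :: 'a alg_closure)" for n
    using num[of "numeral n"] by simp
  have pow: "(x ^ k) ^ p = (x ^ p) ^ k" for x :: "'a alg_closure" and k
    by (simp add: mult.commute flip: power_mult)
  have "discriminant (Weierstrass (to_ac a1 ^ p) (to_ac a2 ^ p) (to_ac a3 ^ p) (to_ac a4 ^ p) (to_ac a6 ^ p))
     = to_ac (discriminant E) ^ p"
    by (simp add: Let_def minus neg ac_add_p num pow power_mult_distrib)
  then show ?thesis using nonsingular by (simp add: elliptic_curve_def del: discriminant.simps)
qed

text \<open>
  By \<open>kernel_polynomial\<close> the functions \<open>x^p\<close> and \<open>y^p\<close> would be polynomials of degree \<open>2\<close> and \<open>3\<close> in \<open>H\<close>,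
  and these satisfy the Weierstrass equation with \<open>p\<close>-th powers as coefficients, which is nonsingular.
\<close>

lemma no_kernel_element_of_pole_p:
  assumes H: "regular H \<psi>" "fls_deriv H = 0" "pole_le (int p) H" "H $$ (- int p) = 1"
  shows False
proof -
  have x: "pole_le (int p * int 2) (x_gen ^ p)" "(x_gen ^ p) $$ (- (int p * int 2)) = 1"
    using pole_le_power[OF pole_le_gen(1), of p] by (simp_all add: x_gen_lead)
  obtain a where a: "x_gen ^ p = hom_poly fls_const a H" "degree a \<le> 2" "coeff a 2 = 1"
    using kernel_polynomial[OF H regular_power[OF regular_x_gen] deriv_p_power x(1)] unfolding x(2) .
  have y: "pole_le (int p * int 3) (y_gen ^ p)" "(y_gen ^ p) $$ (- (int p * int 3)) = 1"
    using pole_le_power[OF pole_le_gen(2), of p] by (simp_all add: y_gen_lead)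
  obtain b where b: "y_gen ^ p = hom_poly fls_const b H" "degree b \<le> 3" "coeff b 3 = 1"
    using kernel_polynomial[OF H regular_power[OF regular_y_gen] deriv_p_power y(1)] unfolding y(2) .
  have deg: "degree a = 2" "degree b = 3" using a b le_degree[of a 2] le_degree[of b 3] by auto
  define R where "R = b * b + [:a1 ^ p:] * a * b + [:a3 ^ p:] * b
     - (a * a * a + [:a2 ^ p:] * a * a + [:a4 ^ p:] * a + [:a6 ^ p:])"
  have "hom_poly fls_const R H = (y_gen^2 + fls_const a1 * x_gen * y_gen + fls_const a3 * y_gen) ^ p
    - (x_gen^3 + fls_const a2 * x_gen^2 + fls_const a4 * x_gen + fls_const a6) ^ p"
    unfolding R_def
    by (simp add: fc.hom_poly_add fc.hom_poly_diff fc.hom_poly_mult fc.hom_poly_smult fls_add_p power_mult_distrib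
      fls_const_power power2_eq_square power3_eq_cube flip: a(1) b(1))
  then have "hom_poly fls_const R H = 0" unfolding generic_point_on_curve by simp
  moreover have "fls_subdegree H < 0"
  proof -
    have "fls_subdegree H \<le> - int p" by (rule fls_subdegree_leI) (simp add: H(4))
    then show ?thesis using prime_gt_0_nat[OF p_prime] by linarith
  qed
  ultimately have R0: "R = 0" using hom_poly_fls_subdegree by blast
  define A B where AB: "A = map_poly to_ac a" "B = map_poly to_ac b"
  have ev: "poly A t = hom_poly to_ac a t" "poly B t = hom_poly to_ac b t" for t
    by (simp_all add: AB hom_poly_def)
  let ?D = "B^2 + [:to_ac a1 ^ p:] * A * B + [:to_ac a3 ^ p:] * B
     - (A^3 + [:to_ac a2 ^ p:] * A^2 + [:to_ac a4 ^ p:] * A + [:to_ac a6 ^ p:])"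
  have "poly ?D t = 0" for t
  proof -
    have "hom_poly to_ac R t = poly ?D t"
      unfolding R_def
      by (simp add: ac.hom_poly_add ac.hom_poly_diff ac.hom_poly_mult ac.hom_poly_smult ev poly_power power2_eq_square power3_eq_cube algebra_simps)
    then show ?thesis by (simp add: R0)
  qed
  then have "{t. poly ?D t = 0} = UNIV" by blast
  then have "?D = 0" using poly_roots_finite[of ?D] infinite_alg_closed by metis
  then have "B^2 + [:to_ac a1 ^ p:] * A * B + [:to_ac a3 ^ p:] * B
     = A^3 + [:to_ac a2 ^ p:] * A^2 + [:to_ac a4 ^ p:] * A + [:to_ac a6 ^ p:]" by simp
  moreover have "degree A = 2" "degree B = 3"
    using deg a(3) b(3) by (simp_all add: AB map_poly_degree_eq)
  ultimately show False
    by (rule no_polynomial_parametrization[OF _ _ _ discriminant_p_power])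
qed

text \<open>
  The induction is on the pole order.  The leading term is cancelled by the \<open>p\<close>-th power of a monomial
  except when the pole has order \<open>p\<close>, and that case does not occur.
\<close>

theorem regular_p_th_root:
  assumes "regular H \<phi>" "fls_deriv H = 0"
  obtains g \<psi> where "regular g \<psi>" "H = g ^ p"
proof -
  have "\<exists>g \<psi>. regular g \<psi> \<and> H = g ^ p"
    if "regular H \<phi>" "fls_deriv H = 0" "pole_le (int p * int m) H" for m H \<phi>
    using that
  proof (induction m arbitrary: H \<phi> rule: less_induct)
    case (less m)
    obtain b where b: "b ^ p = H $$ (- (int p * int m))" using perfect by blast
    show ?case
    proof (cases "m = 1")
      case True
      have "H $$ (- int p) = 0"
      proof (rule ccontr)
        assume nz: "H $$ (- int p) \<noteq> 0"
        define c where "c = inverse (H $$ (- int p))"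
        have "regular (fls_const c * H) (\<lambda>P. to_ac c * \<phi> P)" by (rule regular_cmult[OF less.prems(1)])
        moreover have "fls_deriv (fls_const c * H) = 0" by (simp add: less.prems(2))
        moreover have "pole_le (int p) (fls_const c * H)"
          using pole_le_mult(1)[OF pole_le_const less.prems(3)] True by simp
        moreover have "(fls_const c * H) $$ (- int p) = 1" using nz by (simp add: c_def)
        ultimately show False by (rule no_kernel_element_of_pole_p)
      qed
      then have "pole_le (int p * int (Suc 0) - 1) H"
        using less.prems(3) True by (intro pole_le_minus_one) simp_all
      then have "pole_le (int p * int 0) H" by (rule deriv_zero_pole_le[OF less.prems(2)])
      then show ?thesis using less.IH[of 0 H \<phi>] less.prems True by simp
    next
      case False
      then obtain i j where ij: "2 * i + 3 * j = m" using weight_monomial[of m m] by auto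
      define g0 where "g0 = fls_const b * monomial i j"
      have m: "2 * int i + 3 * int j = int m" using ij by linarith
      have g0: "regular g0 (\<lambda>P. to_ac b * (x_coord P ^ i * y_coord P ^ j))"
        unfolding g0_def by (intro regular_cmult regular_monomial)
      have mon: "pole_le (int p * int m) (monomial i j ^ p)" "(monomial i j ^ p) $$ (- (int p * int m)) = 1"
        using pole_le_power(1)[OF monomial_lead(1)[of i j], of p]
          pole_le_power(2)[OF monomial_lead(1)[of i j], of p] monomial_lead(2)[of i j]
        unfolding m by simp_all
      have g0p: "g0 ^ p = fls_const (H $$ (- (int p * int m))) * monomial i j ^ p"
        unfolding g0_def by (simp add: power_mult_distrib b[symmetric] fls_const_power)
      have D: "fls_deriv (H - g0 ^ p) = 0" by (simp add: less.prems(2))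
      have pole: "pole_le (int p * int m - 1) (H - g0 ^ p)"
        unfolding g0p by (rule fls_leading_term_cancel[OF less.prems(3) mon])
      have reg: "regular (H - g0 ^ p) (\<lambda>P. \<phi> P - (to_ac b * (x_coord P ^ i * y_coord P ^ j)) ^ p)"
        by (intro regular_diff less.prems regular_power g0)
      have "\<exists>g \<psi>. regular g \<psi> \<and> H - g0 ^ p = g ^ p"
      proof (cases m)
        case 0
        then have "H - g0 ^ p = 0" using regular_pole_le_minus_one[OF reg] pole by simp
        then have "H - g0 ^ p = fls_const 0 ^ p" using prime_gt_0_nat[OF p_prime] by (simp add: zero_power)
        then show ?thesis using regular_const by blast
      next
        case (Suc m')
        show ?thesis
          by (rule less.IH[OF _ reg D, of m']) (use deriv_zero_pole_le[OF D, of m'] pole Suc in auto)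
      qed
      then obtain g \<psi> where "regular g \<psi>" "H - g0 ^ p = g ^ p" by blast
      note g = this
      have "H = g0 ^ p + g ^ p" unfolding g(2)[symmetric] by simp
      then have "H = (g0 + g) ^ p" by (simp only: fls_add_p)
      then show ?thesis using regular_add[OF g0 g(1)] by blast
    qed
  qed
  moreover have "\<exists>m. pole_le (int p * int m) H"
  proof -
    have "1 * int (nat (- fls_subdegree H)) \<le> int p * int (nat (- fls_subdegree H))"
      using prime_gt_0_nat[OF p_prime] by (intro mult_right_mono) auto
    then have "- fls_subdegree H \<le> int p * int (nat (- fls_subdegree H))" by linarith
    then have "pole_le (int p * int (nat (- fls_subdegree H))) H" by (simp only: pole_le_iff simp_thms)
    then show ?thesis ..
  qed
  ultimately show thesis using assms that by blast
qed

end

section \<open>The group law and the invariant differential\<close>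

text \<open>
  The Weierstrass equation on the line of slope \<open>l\<close> through \<open>(x1, y1)\<close> is a monic cubic up to sign, and
  its quadratic coefficient determines \<open>x3\<close>.  The remaining linear term vanishes when the line also
  passes through the second point, or is tangent (\<open>chord_relation\<close>).
\<close>

lemma secant_line_cubic:
  fixes a1 a2 x1 x2 y1 l T :: "'b::comm_ring_1"
  defines "x3 \<equiv> l^2 + a1 * l - a2 - x1 - x2"
  shows "(y1 + l * (T - x1))^2 + a1 * T * (y1 + l * (T - x1)) + a3 * (y1 + l * (T - x1))
      - (T^3 + a2 * T^2 + a4 * T + a6)
    = - ((T - x1) * (T - x2) * (T - x3))
      + ((2 * l * (y1 - l * x1) + a1 * (y1 - l * x1) + a3 * l - a4 + x1 * x2 + x1 * x3 + x2 * x3) * T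
        + ((y1 - l * x1)^2 + a3 * (y1 - l * x1) - a6 - x1 * x2 * x3))"
  unfolding x3_def by (simp add: algebra_simps power2_eq_square power3_eq_cube)

lemma secant_slope:
  fixes a1 a2 x1 x2 y1 l :: "'b::comm_ring_1"
  defines "x3 \<equiv> l^2 + a1 * l - a2 - x1 - x2"
  shows "l * (2 * y1 + a1 * x1 + a3) - (3 * x1^2 + 2 * a2 * x1 + a4 - a1 * y1)
    = (x2 - x1) * (x1 - x3)
      + (2 * l * (y1 - l * x1) + a1 * (y1 - l * x1) + a3 * l - a4 + x1 * x2 + x1 * x3 + x2 * x3)"
  unfolding x3_def by (simp add: algebra_simps power2_eq_square)

lemma chord_relation:
  fixes a1 a2 x1 x2 y1 y2 l :: "'b::field"
  assumes P1: "y1^2 + a1 * x1 * y1 + a3 * y1 = x1^3 + a2 * x1^2 + a4 * x1 + a6"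
    and P2: "y2^2 + a1 * x2 * y2 + a3 * y2 = x2^3 + a2 * x2^2 + a4 * x2 + a6"
    and l: "y2 = y1 + l * (x2 - x1)"
    and slope: "x1 \<noteq> x2 \<or> l * (2 * y1 + a1 * x1 + a3) = 3 * x1^2 + 2 * a2 * x1 + a4 - a1 * y1"
  defines "x3 \<equiv> l^2 + a1 * l - a2 - x1 - x2"
  shows "2 * l * (y1 - l * x1) + a1 * (y1 - l * x1) + a3 * l - a4 + x1 * x2 + x1 * x3 + x2 * x3 = 0" (is "?\<alpha> = 0")
    and "(y1 - l * x1)^2 + a3 * (y1 - l * x1) - a6 - x1 * x2 * x3 = 0" (is "?\<beta> = 0")
proof -
  have 1: "?\<alpha> * x1 + ?\<beta> = 0"
    using secant_line_cubic[of y1 l x1 x1 a1 a3 a2 a4 a6 x2] P1 unfolding x3_def by simp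
  have 2: "?\<alpha> * x2 + ?\<beta> = 0"
    using secant_line_cubic[of y1 l x2 x1 a1 a3 a2 a4 a6 x2] P2 unfolding x3_def l[symmetric] by simp
  show "?\<alpha> = 0"
  proof (cases "x1 = x2")
    case False
    have "?\<alpha> * (x1 - x2) = (?\<alpha> * x1 + ?\<beta>) - (?\<alpha> * x2 + ?\<beta>)" by (simp add: algebra_simps)
    then show ?thesis using False unfolding 1 2 by simp
  next
    case True
    then show ?thesis
      using slope secant_slope[of l y1 a1 x1 a3 a2 a4 x2] unfolding x3_def by simp
  qed
  with 1 show "?\<beta> = 0" by simp
qed

lemma third_point_on_curve:
  fixes a1 a2 a3 x1 x2 y1 l :: "'b::comm_ring_1"
  defines "x3 \<equiv> l^2 + a1 * l - a2 - x1 - x2"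
  assumes "2 * l * (y1 - l * x1) + a1 * (y1 - l * x1) + a3 * l - a4 + x1 * x2 + x1 * x3 + x2 * x3 = 0"
    and "(y1 - l * x1)^2 + a3 * (y1 - l * x1) - a6 - x1 * x2 * x3 = 0"
  defines "y3 \<equiv> - (l + a1) * x3 - (y1 - l * x1) - a3"
  shows "y3^2 + a1 * x3 * y3 + a3 * y3 = x3^3 + a2 * x3^2 + a4 * x3 + a6"
proof -
  define Y where "Y = y1 + l * (x3 - x1)"
  have "Y^2 + a1 * x3 * Y + a3 * Y - (x3^3 + a2 * x3^2 + a4 * x3 + a6) = 0"
    using secant_line_cubic[of y1 l x3 x1 a1 a3 a2 a4 a6 x2] assms(2,3) unfolding x3_def Y_def by simp
  moreover have y3: "y3 = - Y - a1 * x3 - a3" by (simp add: y3_def Y_def algebra_simps)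
  have "y3^2 + a1 * x3 * y3 + a3 * y3 = Y^2 + a1 * x3 * Y + a3 * Y"
    unfolding y3 by (simp add: algebra_simps power2_eq_square)
  ultimately show ?thesis by simp
qed

text \<open>
  The invariant differential is additive: \<open>w1\<close> and \<open>w2\<close> stand for its values at the two summands, and the
  \<open>d\<close>-variables for derivatives.  The assumption on \<open>dl\<close> is the derivative of the slope, which takes the
  same form for chords and tangents.
\<close>

lemma group_law_differential:
  fixes a1 a2 a3 x1 x2 y1 y2 l w1 w2 dl :: "'b::comm_ring_1"
  defines "x3 \<equiv> l^2 + a1 * l - a2 - x1 - x2"
  defines "y3 \<equiv> - (l + a1) * x3 - (y1 - l * x1) - a3"
  assumes \<alpha>: "2 * l * (y1 - l * x1) + a1 * (y1 - l * x1) + a3 * l - a4 + x1 * x2 + x1 * x3 + x2 * x3 = 0"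
    and l: "y2 = y1 + l * (x2 - x1)"
    and d1: "dx1 = w1 * (2 * y1 + a1 * x1 + a3)" "dy1 = w1 * (3 * x1^2 + 2 * a2 * x1 + a4 - a1 * y1)"
    and d2: "dx2 = w2 * (2 * y2 + a1 * x2 + a3)"
    and dl: "dl = w1 * (x1 - x3) + w2 * (x2 - x3)"
    and d3: "dx3 = (2 * l + a1) * dl - dx1 - dx2" "dy3 = - (dl * x3 + (l + a1) * dx3) - (dy1 - (dl * x1 + l * dx1))"
  shows "dx3 = (w1 + w2) * (2 * y3 + a1 * x3 + a3)"
    and "dy3 = (w1 + w2) * (3 * x3^2 + 2 * a2 * x3 + a4 - a1 * y3)"
proof -
  define A where "A = 2 * y3 + a1 * x3 + a3"
  have A1: "2 * y1 + a1 * x1 + a3 = (2 * l + a1) * (x1 - x3) - A"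
    and A2: "2 * y2 + a1 * x2 + a3 = (2 * l + a1) * (x2 - x3) - A"
    unfolding A_def y3_def l by (simp_all add: algebra_simps)
  show dx3: "dx3 = (w1 + w2) * (2 * y3 + a1 * x3 + a3)"
    unfolding d3 d1 d2 A1 A2 dl A_def[symmetric] by (simp add: algebra_simps)
  have C1: "l * (2 * y1 + a1 * x1 + a3) - (3 * x1^2 + 2 * a2 * x1 + a4 - a1 * y1) = (x2 - x1) * (x1 - x3)"
    using secant_slope[of l y1 a1 x1 a3 a2 a4 x2] \<alpha> unfolding x3_def by simp
  have C3: "3 * x3^2 + 2 * a2 * x3 + a4 - a1 * y3 = (x3 - x1) * (x3 - x2) - (l + a1) * A"
  proof -
    have "3 * x3^2 + 2 * a2 * x3 + a4 - a1 * y3 - ((x3 - x1) * (x3 - x2) - (l + a1) * A)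
      = - (2 * l * (y1 - l * x1) + a1 * (y1 - l * x1) + a3 * l - a4 + x1 * x2 + x1 * x3 + x2 * x3)"
      unfolding A_def y3_def x3_def by (simp add: algebra_simps power2_eq_square)
    then show ?thesis using \<alpha> by simp
  qed
  have "dy3 = dl * (x1 - x3) - (l + a1) * dx3 + w1 * (l * (2 * y1 + a1 * x1 + a3) - (3 * x1^2 + 2 * a2 * x1 + a4 - a1 * y1))"
    unfolding d3(2) d1 by (simp add: algebra_simps)
  also have "\<dots> = (w1 + w2) * ((x3 - x1) * (x3 - x2) - (l + a1) * A)"
    unfolding C1 dx3 A_def[symmetric] dl by (simp add: algebra_simps)
  finally show "dy3 = (w1 + w2) * (3 * x3^2 + 2 * a2 * x3 + a4 - a1 * y3)" unfolding C3 .
qed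

context weierstrass_coefficients
begin

abbreviation "EK \<equiv> Weierstrass (fls_const a1) (fls_const a2) (fls_const a3) (fls_const a4) (fls_const a6)"

text \<open>
  The invariant differential pulled back to the point is \<open>\<omega>\<close>.  The two equations replace the quotients
  \<open>dx / (2 y + a1 x + a3)\<close> and \<open>dy / (3 x^2 + 2 a2 x + a4 - a1 y)\<close>, whose denominators may vanish.
\<close>

fun has_differential :: "'a fls point \<Rightarrow> 'a fls \<Rightarrow> bool" where
  "has_differential Infinity \<omega> \<longleftrightarrow> False"
| "has_differential (Affine x y) \<omega> \<longleftrightarrow>
    fls_deriv x = \<omega> * (2 * y + fls_const a1 * x + fls_const a3) \<and>
    fls_deriv y = \<omega> * (3 * x^2 + 2 * fls_const a2 * x + fls_const a4 - fls_const a1 * y)"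

lemma point_add_differential:
  assumes on: "on_curve EK P1" "on_curve EK P2"
    and diff: "has_differential P1 w1" "has_differential P2 w2"
    and fin: "point_add EK P1 P2 \<noteq> Infinity"
  shows "on_curve EK (point_add EK P1 P2)" "has_differential (point_add EK P1 P2) (w1 + w2)"
proof -
  let ?c = "fls_const :: 'a \<Rightarrow> 'a fls"
  obtain x1 y1 where P1: "P1 = Affine x1 y1" using diff(1) by (cases P1) auto
  obtain x2 y2 where P2: "P2 = Affine x2 y2" using diff(2) by (cases P2) auto
  have not_inv: "\<not> (x1 = x2 \<and> y1 + y2 + ?c a1 * x2 + ?c a3 = 0)" using fin by (auto simp: P1 P2)
  define l where "l = (if x1 = x2
                then (3 * x1^2 + 2 * ?c a2 * x1 + ?c a4 - ?c a1 * y1) / (2 * y1 + ?c a1 * x1 + ?c a3)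
                else (y2 - y1) / (x2 - x1))"
  define x3 where "x3 = l^2 + ?c a1 * l - ?c a2 - x1 - x2"
  define y3 where "y3 = - (l + ?c a1) * x3 - (y1 - l * x1) - ?c a3"
  have sum: "point_add EK P1 P2 = Affine x3 y3"
    unfolding P1 P2 point_add.simps Let_def l_def[symmetric] x3_def[symmetric] y3_def[symmetric] if_not_P[OF not_inv] ..
  have c1: "y1^2 + ?c a1 * x1 * y1 + ?c a3 * y1 = x1^3 + ?c a2 * x1^2 + ?c a4 * x1 + ?c a6"
    and c2: "y2^2 + ?c a1 * x2 * y2 + ?c a3 * y2 = x2^3 + ?c a2 * x2^2 + ?c a4 * x2 + ?c a6"
    using on by (simp_all add: P1 P2)
  have same: "y1 = y2 \<and> 2 * y1 + ?c a1 * x1 + ?c a3 \<noteq> 0" if "x1 = x2"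
  proof -
    have "(y1 - y2) * (y1 + y2 + ?c a1 * x2 + ?c a3)
      = (y1^2 + ?c a1 * x1 * y1 + ?c a3 * y1) - (y2^2 + ?c a1 * x2 * y2 + ?c a3 * y2)"
      unfolding that by (simp add: algebra_simps power2_eq_square)
    also have "\<dots> = 0" unfolding c1 c2 by (simp add: that)
    finally have zero: "(y1 - y2) * (y1 + y2 + ?c a1 * x2 + ?c a3) = 0" .
    have nz: "y1 + y2 + ?c a1 * x2 + ?c a3 \<noteq> 0" using not_inv that by blast
    have y: "y1 = y2" using zero nz by (simp only: mult_eq_0_iff simp_thms) simp
    have "2 * y1 + ?c a1 * x1 + ?c a3 = y1 + y2 + ?c a1 * x2 + ?c a3"
      unfolding y that by (simp only: mult_2)
    then have "2 * y1 + ?c a1 * x1 + ?c a3 \<noteq> 0" using nz by (simp only: not_False_eq_True)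
    with y show ?thesis by blast
  qed
  have line: "y2 = y1 + l * (x2 - x1)"
    using same by (cases "x1 = x2") (auto simp: l_def)
  have slope: "x1 \<noteq> x2 \<or> l * (2 * y1 + ?c a1 * x1 + ?c a3) = 3 * x1^2 + 2 * ?c a2 * x1 + ?c a4 - ?c a1 * y1"
    using same by (cases "x1 = x2") (auto simp: l_def)
  note rel = chord_relation[OF c1 c2 line slope, folded x3_def]
  have "y3^2 + ?c a1 * x3 * y3 + ?c a3 * y3 = x3^3 + ?c a2 * x3^2 + ?c a4 * x3 + ?c a6"
    unfolding y3_def
    by (rule third_point_on_curve[where l = l and ?a1.0 = "?c a1" and ?a2.0 = "?c a2" and ?x1.0 = x1 and ?x2.0 = x2,
      folded x3_def, OF rel])
  then show "on_curve EK (point_add EK P1 P2)" by (simp add: sum)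
  have d1: "fls_deriv x1 = w1 * (2 * y1 + ?c a1 * x1 + ?c a3)"
    "fls_deriv y1 = w1 * (3 * x1^2 + 2 * ?c a2 * x1 + ?c a4 - ?c a1 * y1)"
    and d2: "fls_deriv x2 = w2 * (2 * y2 + ?c a1 * x2 + ?c a3)"
    "fls_deriv y2 = w2 * (3 * x2^2 + 2 * ?c a2 * x2 + ?c a4 - ?c a1 * y2)"
    using diff by (simp_all add: P1 P2)
  have dl: "fls_deriv l = w1 * (x1 - x3) + w2 * (x2 - x3)"
  proof (cases "x1 = x2")
    case False
    have s1: "l * (2 * y1 + ?c a1 * x1 + ?c a3) - (3 * x1^2 + 2 * ?c a2 * x1 + ?c a4 - ?c a1 * y1) = (x2 - x1) * (x1 - x3)"
      using secant_slope[of l y1 "?c a1" x1 "?c a3" "?c a2" "?c a4" x2, folded x3_def] unfolding rel by simp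
    have line': "y1 = y2 + l * (x1 - x2)" using line by (simp add: algebra_simps)
    have x3': "x3 = l^2 + ?c a1 * l - ?c a2 - x2 - x1" by (simp add: x3_def)
    have slope': "x2 \<noteq> x1 \<or> l * (2 * y2 + ?c a1 * x2 + ?c a3) = 3 * x2^2 + 2 * ?c a2 * x2 + ?c a4 - ?c a1 * y2"
      using False by simp
    have s2: "l * (2 * y2 + ?c a1 * x2 + ?c a3) - (3 * x2^2 + 2 * ?c a2 * x2 + ?c a4 - ?c a1 * y2) = (x1 - x2) * (x2 - x3)"
      using secant_slope[of l y2 "?c a1" x2 "?c a3" "?c a2" "?c a4" x1, folded x3']
      unfolding chord_relation(1)[OF c2 c1 line' slope', folded x3'] by simp
    have "fls_deriv y2 = fls_deriv y1 + (fls_deriv l * (x2 - x1) + l * (fls_deriv x2 - fls_deriv x1))"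
      using arg_cong[OF line, of fls_deriv] by (simp add: algebra_simps)
    then have "fls_deriv l * (x2 - x1) = w1 * (l * (2 * y1 + ?c a1 * x1 + ?c a3) - (3 * x1^2 + 2 * ?c a2 * x1 + ?c a4 - ?c a1 * y1))
      - w2 * (l * (2 * y2 + ?c a1 * x2 + ?c a3) - (3 * x2^2 + 2 * ?c a2 * x2 + ?c a4 - ?c a1 * y2))"
      unfolding d1 d2 by (simp add: algebra_simps)
    also have "\<dots> = (w1 * (x1 - x3) + w2 * (x2 - x3)) * (x2 - x1)"
      unfolding s1 s2 by (simp add: algebra_simps)
    finally show ?thesis using False by simp
  next
    case True
    define A where "A = 2 * y1 + ?c a1 * x1 + ?c a3"
    define C where "C = 3 * x1^2 + 2 * ?c a2 * x1 + ?c a4 - ?c a1 * y1"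
    have A: "A \<noteq> 0" and y: "y1 = y2" using same[OF True] unfolding A_def by blast+
    have w: "w1 = w2" using A d1(1) d2(1) True y unfolding A_def by simp
    have dA: "fls_deriv A = w1 * (2 * C + ?c a1 * A)"
      unfolding A_def C_def by (simp add: d1 algebra_simps)
    have dC: "fls_deriv C = w1 * (6 * x1 * A + 2 * ?c a2 * A - ?c a1 * C)"
      unfolding A_def C_def by (simp add: d1 power2_eq_square algebra_simps)
    have lA: "l * A = C" using A True by (simp add: l_def A_def C_def)
    have "fls_deriv l * A + l * fls_deriv A = fls_deriv C"
      using arg_cong[OF lA, of fls_deriv] by (simp add: algebra_simps)
    then have "fls_deriv l * A = fls_deriv C - l * fls_deriv A" by (simp add: algebra_simps)
    also have "\<dots> = w1 * (6 * x1 + 2 * ?c a2 - ?c a1 * l - 2 * l^2 - ?c a1 * l) * A"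
      unfolding dA dC unfolding lA[symmetric] by (simp add: algebra_simps power2_eq_square)
    finally have "fls_deriv l = w1 * (6 * x1 + 2 * ?c a2 - ?c a1 * l - 2 * l^2 - ?c a1 * l)" using A by simp
    then show ?thesis
      using True w by (simp add: x3_def algebra_simps)
  qed
  have d3: "fls_deriv x3 = (2 * l + ?c a1) * fls_deriv l - fls_deriv x1 - fls_deriv x2"
    "fls_deriv y3 = - (fls_deriv l * x3 + (l + ?c a1) * fls_deriv x3) - (fls_deriv y1 - (fls_deriv l * x1 + l * fls_deriv x1))"
    by (simp_all add: x3_def y3_def power2_eq_square algebra_simps)
  show "has_differential (point_add EK P1 P2) (w1 + w2)"
    unfolding sum has_differential.simps y3_def
    using group_law_differential[where l = l and ?a1.0 = "?c a1" and ?a2.0 = "?c a2" and ?x1.0 = x1 and ?x2.0 = x2,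
      folded x3_def, OF rel(1) line d1 d2(1) dl d3[unfolded y3_def]] by blast
qed

end

section \<open>Specialization of the generic point\<close>

context weierstrass_coefficients
begin

definition almost_all :: "('a alg_closure point \<Rightarrow> bool) \<Rightarrow> bool" where
  "almost_all P \<longleftrightarrow> finite {Q \<in> geometric_points E. \<not> P Q}"

lemma almost_all_mono:
  "almost_all P \<Longrightarrow> (\<And>Q. Q \<in> geometric_points E \<Longrightarrow> P Q \<Longrightarrow> R Q) \<Longrightarrow> almost_all R"
  unfolding almost_all_def by (erule rev_finite_subset) blast

lemma almost_all_conj: "almost_all P \<Longrightarrow> almost_all R \<Longrightarrow> almost_all (\<lambda>Q. P Q \<and> R Q)"
  unfolding almost_all_def
  by (rule finite_subset[of _ "{Q \<in> geometric_points E. \<not> P Q} \<union> {Q \<in> geometric_points E. \<not> R Q}"]) auto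

lemma almost_all_ex:
  assumes "almost_all P" obtains Q where "Q \<in> geometric_points E" "P Q"
proof -
  have "\<not> geometric_points E \<subseteq> {Q \<in> geometric_points E. \<not> P Q}"
    using assms infinite_geometric_points finite_subset unfolding almost_all_def by metis
  then show thesis using that by blast
qed

lemma almost_all_not_Infinity: "almost_all (\<lambda>Q. Q \<noteq> Infinity)"
  unfolding almost_all_def by (rule finite_subset[of _ "{Infinity}"]) auto

lemma regular_almost_all_nonzero:
  assumes "regular \<kappa> \<phi>" "\<kappa> \<noteq> 0" shows "almost_all (\<lambda>Q. \<phi> Q \<noteq> 0)"
proof -
  have "almost_all (\<lambda>Q. Q = Infinity \<or> \<phi> Q \<noteq> 0)"
    using regular_finite_zeros[OF assms] unfolding almost_all_def by (rule rev_finite_subset) auto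
  from almost_all_conj[OF this almost_all_not_Infinity] show ?thesis by (rule almost_all_mono) auto
qed

lemma regular_eq_zero_almost_all:
  assumes "regular 0 \<phi>" shows "almost_all (\<lambda>Q. \<phi> Q = 0)"
  by (rule almost_all_mono[OF almost_all_not_Infinity]) (metis assms point.exhaust regular_zero)

text \<open>
  A Laurent series and a function on points that come from the same rational function; the function is
  only determined outside a finite set.
\<close>

definition rational :: "'a fls \<Rightarrow> ('a alg_closure point \<Rightarrow> 'a alg_closure) \<Rightarrow> bool" where
  "rational \<kappa> \<phi> \<longleftrightarrow> (\<exists>n n' d d'. regular n n' \<and> regular d d' \<and> d \<noteq> 0 \<and> \<kappa> = n / d \<and>
     almost_all (\<lambda>Q. \<phi> Q = n' Q / d' Q))"

lemma rationalE:
  assumes "rational \<kappa> \<phi>"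
  obtains n n' d d' where "regular n n'" "regular d d'" "d \<noteq> 0" "\<kappa> = n / d"
    "almost_all (\<lambda>Q. \<phi> Q = n' Q / d' Q \<and> d' Q \<noteq> 0)"
proof -
  obtain n n' d d' where *: "regular n n'" "regular d d'" "d \<noteq> 0" "\<kappa> = n / d"
    "almost_all (\<lambda>Q. \<phi> Q = n' Q / d' Q)"
    using assms unfolding rational_def by blast
  show thesis
    by (rule that[OF *(1-4) almost_all_conj[OF *(5) regular_almost_all_nonzero[OF *(2,3)]]])
qed

lemma rationalI:
  assumes "regular n n'" "regular d d'" "d \<noteq> 0" "\<kappa> = n / d" "almost_all (\<lambda>Q. \<phi> Q = n' Q / d' Q)"
  shows "rational \<kappa> \<phi>"
  using assms unfolding rational_def by blast

lemma rational_regular: "regular \<kappa> \<phi> \<Longrightarrow> rational \<kappa> \<phi>"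
  by (rule rationalI[OF _ regular_const[of 1]]) (auto simp: almost_all_def)

lemma rational_cong:
  assumes "rational \<kappa> \<phi>" "almost_all (\<lambda>Q. \<phi> Q = \<psi> Q)" shows "rational \<kappa> \<psi>"
proof -
  obtain n n' d d' where *: "regular n n'" "regular d d'" "d \<noteq> 0" "\<kappa> = n / d"
    "almost_all (\<lambda>Q. \<phi> Q = n' Q / d' Q)"
    using assms(1) unfolding rational_def by blast
  show ?thesis
    by (rule rationalI[OF *(1-4)], rule almost_all_mono[OF almost_all_conj[OF assms(2) *(5)]]) auto
qed

lemma rational_add:
  assumes "rational \<kappa> \<phi>" "rational \<kappa>' \<phi>'" shows "rational (\<kappa> + \<kappa>') (\<lambda>Q. \<phi> Q + \<phi>' Q)"
proof -
  obtain n n' d d' where 1: "regular n n'" "regular d d'" "d \<noteq> 0" "\<kappa> = n / d"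
    "almost_all (\<lambda>Q. \<phi> Q = n' Q / d' Q \<and> d' Q \<noteq> 0)" by (rule rationalE[OF assms(1)])
  obtain m m' e e' where 2: "regular m m'" "regular e e'" "e \<noteq> 0" "\<kappa>' = m / e"
    "almost_all (\<lambda>Q. \<phi>' Q = m' Q / e' Q \<and> e' Q \<noteq> 0)" by (rule rationalE[OF assms(2)])
  show ?thesis
  proof (rule rationalI)
    show "regular (n * e + m * d) (\<lambda>Q. n' Q * e' Q + m' Q * d' Q)" by (intro regular_add regular_mult 1 2)
    show "regular (d * e) (\<lambda>Q. d' Q * e' Q)" by (intro regular_mult 1 2)
    show "almost_all (\<lambda>Q. \<phi> Q + \<phi>' Q = (n' Q * e' Q + m' Q * d' Q) / (d' Q * e' Q))"
      by (rule almost_all_mono[OF almost_all_conj[OF 1(5) 2(5)]]) (simp add: add_frac_eq)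
  qed (use 1 2 in \<open>simp_all add: add_frac_eq\<close>)
qed

lemma rational_mult:
  assumes "rational \<kappa> \<phi>" "rational \<kappa>' \<phi>'" shows "rational (\<kappa> * \<kappa>') (\<lambda>Q. \<phi> Q * \<phi>' Q)"
proof -
  obtain n n' d d' where 1: "regular n n'" "regular d d'" "d \<noteq> 0" "\<kappa> = n / d"
    "almost_all (\<lambda>Q. \<phi> Q = n' Q / d' Q \<and> d' Q \<noteq> 0)" by (rule rationalE[OF assms(1)])
  obtain m m' e e' where 2: "regular m m'" "regular e e'" "e \<noteq> 0" "\<kappa>' = m / e"
    "almost_all (\<lambda>Q. \<phi>' Q = m' Q / e' Q \<and> e' Q \<noteq> 0)" by (rule rationalE[OF assms(2)])
  show ?thesis
  proof (rule rationalI)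
    show "regular (n * m) (\<lambda>Q. n' Q * m' Q)" by (intro regular_mult 1 2)
    show "regular (d * e) (\<lambda>Q. d' Q * e' Q)" by (intro regular_mult 1 2)
    show "almost_all (\<lambda>Q. \<phi> Q * \<phi>' Q = (n' Q * m' Q) / (d' Q * e' Q))"
      by (rule almost_all_mono[OF almost_all_conj[OF 1(5) 2(5)]]) simp
  qed (use 1 2 in simp_all)
qed

lemma rational_nonzero:
  assumes "rational \<kappa> \<phi>" "\<kappa> \<noteq> 0" shows "almost_all (\<lambda>Q. \<phi> Q \<noteq> 0)"
proof -
  obtain n n' d d' where 1: "regular n n'" "regular d d'" "d \<noteq> 0" "\<kappa> = n / d"
    "almost_all (\<lambda>Q. \<phi> Q = n' Q / d' Q \<and> d' Q \<noteq> 0)" by (rule rationalE[OF assms(1)])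
  have "n \<noteq> 0" using assms(2) 1(4) by auto
  from almost_all_conj[OF 1(5) regular_almost_all_nonzero[OF 1(1) this]]
  show ?thesis by (rule almost_all_mono) simp
qed

lemma rational_eq_zero:
  assumes "rational 0 \<phi>" shows "almost_all (\<lambda>Q. \<phi> Q = 0)"
proof -
  obtain n n' d d' where 1: "regular n n'" "regular d d'" "d \<noteq> 0" "0 = n / d"
    "almost_all (\<lambda>Q. \<phi> Q = n' Q / d' Q \<and> d' Q \<noteq> 0)" by (rule rationalE[OF assms(1)])
  have n: "n = 0" using 1(3,4) by simp
  from almost_all_conj[OF 1(5) regular_eq_zero_almost_all[OF 1(1)[unfolded n]]]
  show ?thesis by (rule almost_all_mono) simp
qed

lemma rational_inverse:
  assumes "rational \<kappa> \<phi>" "\<kappa> \<noteq> 0" shows "rational (inverse \<kappa>) (\<lambda>Q. inverse (\<phi> Q))"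
proof -
  obtain n n' d d' where 1: "regular n n'" "regular d d'" "d \<noteq> 0" "\<kappa> = n / d"
    "almost_all (\<lambda>Q. \<phi> Q = n' Q / d' Q \<and> d' Q \<noteq> 0)" by (rule rationalE[OF assms(1)])
  show ?thesis
  proof (rule rationalI[OF 1(2,1)])
    show "n \<noteq> 0" using assms(2) 1(4) by auto
    show "almost_all (\<lambda>Q. inverse (\<phi> Q) = d' Q / n' Q)"
      by (rule almost_all_mono[OF 1(5)]) simp
  qed (simp add: 1(4))
qed

lemma rational_const: "rational (fls_const c) (\<lambda>Q. to_ac c)"
  by (rule rational_regular[OF regular_const])

lemma rational_numeral: "rational (numeral k) (\<lambda>Q. numeral k)"
  using rational_const[of "numeral k"] by simp

lemma rational_diff:
  assumes "rational \<kappa> \<phi>" "rational \<kappa>' \<phi>'" shows "rational (\<kappa> - \<kappa>') (\<lambda>Q. \<phi> Q - \<phi>' Q)"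
  using rational_add[OF assms(1) rational_mult[OF rational_const[of "- 1"] assms(2)]] by simp

lemma rational_minus: "rational \<kappa> \<phi> \<Longrightarrow> rational (- \<kappa>) (\<lambda>Q. - \<phi> Q)"
  using rational_mult[OF rational_const[of "- 1"]] by fastforce

lemma rational_power: "rational \<kappa> \<phi> \<Longrightarrow> rational (\<kappa> ^ n) (\<lambda>Q. \<phi> Q ^ n)"
  using rational_const[of 1] by (induction n) (simp_all add: rational_mult)

lemma rational_divide:
  assumes "rational \<kappa> \<phi>" "rational \<kappa>' \<phi>'" "\<kappa>' \<noteq> 0" shows "rational (\<kappa> / \<kappa>') (\<lambda>Q. \<phi> Q / \<phi>' Q)"
  using rational_mult[OF assms(1) rational_inverse[OF assms(2,3)]] by (simp add: divide_inverse)

lemmas rational_intros = rational_add rational_diff rational_mult rational_minus rational_power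
  rational_divide rational_const rational_numeral

lemma rational_unique:
  assumes "rational \<kappa> \<phi>" "rational \<kappa>' \<psi>" "almost_all (\<lambda>Q. \<phi> Q = \<psi> Q)"
  shows "\<kappa> = \<kappa>'"
proof (rule ccontr)
  assume "\<kappa> \<noteq> \<kappa>'"
  then have "almost_all (\<lambda>Q. \<phi> Q - \<psi> Q \<noteq> 0)"
    by (intro rational_nonzero[OF rational_diff[OF assms(1,2)]]) simp
  from almost_all_conj[OF this assms(3)] show False by (rule almost_all_ex) simp
qed

text \<open>
  The map \<open>f\<close> is, outside a finite set, the evaluation of a point over the function field.
\<close>

fun specializes :: "'a fls point \<Rightarrow> ('a alg_closure point \<Rightarrow> 'a alg_closure point) \<Rightarrow> bool" where
  "specializes Infinity f \<longleftrightarrow> almost_all (\<lambda>Q. f Q = Infinity)"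
| "specializes (Affine x y) f \<longleftrightarrow>
    (\<exists>\<phi> \<psi>. rational x \<phi> \<and> rational y \<psi> \<and> almost_all (\<lambda>Q. f Q = Affine (\<phi> Q) (\<psi> Q)))"

lemma specializes_cong:
  assumes "specializes P f" "almost_all (\<lambda>Q. f Q = g Q)" shows "specializes P g"
proof (cases P)
  case Infinity
  have "almost_all (\<lambda>Q. f Q = Infinity)" using assms(1) Infinity by simp
  from almost_all_conj[OF this assms(2)] have "almost_all (\<lambda>Q. g Q = Infinity)"
    by (rule almost_all_mono) auto
  then show ?thesis using Infinity by simp
next
  case (Affine x y)
  then obtain \<phi> \<psi> where *: "rational x \<phi>" "rational y \<psi>" "almost_all (\<lambda>Q. f Q = Affine (\<phi> Q) (\<psi> Q))"
    using assms(1) by auto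
  have "almost_all (\<lambda>Q. g Q = Affine (\<phi> Q) (\<psi> Q))"
    by (rule almost_all_mono[OF almost_all_conj[OF assms(2) *(3)]]) auto
  then show ?thesis using * Affine by auto
qed

lemma geometric_curve_E: "geometric_curve E = Weierstrass (to_ac a1) (to_ac a2) (to_ac a3) (to_ac a4) (to_ac a6)"
  by (simp add: geometric_curve_def)

text \<open>
  Every condition in the chord and tangent law is an equation between rational functions, so outside a
  finite set of points it holds or fails as it does for the generic expressions.
\<close>

lemma specializes_add:
  assumes "specializes P1 f" "specializes P2 g"
  shows "specializes (point_add EK P1 P2) (\<lambda>Q. point_add (geometric_curve E) (f Q) (g Q))"
proof -
  have add_Infinity: "point_add W P Infinity = P" "point_add W Infinity P = P" for W :: "'b::field weierstrass" and P
    by (cases P; simp)+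
  let ?W = "geometric_curve E"
  show ?thesis
  proof (cases P1)
    case Infinity
    have "almost_all (\<lambda>Q. g Q = point_add ?W (f Q) (g Q))"
      using assms(1) unfolding Infinity specializes.simps by (rule almost_all_mono) (simp add: add_Infinity)
    then show ?thesis using specializes_cong[OF assms(2)] by (simp add: Infinity add_Infinity)
  next
    case P1: (Affine x1 y1)
    show ?thesis
    proof (cases P2)
      case Infinity
      have "almost_all (\<lambda>Q. f Q = point_add ?W (f Q) (g Q))"
        using assms(2) unfolding Infinity specializes.simps by (rule almost_all_mono) (simp add: add_Infinity)
      then show ?thesis using specializes_cong[OF assms(1)] by (simp add: Infinity add_Infinity)
    next
      case P2: (Affine x2 y2)
      obtain X1 Y1 where 1: "rational x1 X1" "rational y1 Y1" "almost_all (\<lambda>Q. f Q = Affine (X1 Q) (Y1 Q))"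
        using assms(1) P1 by auto
      obtain X2 Y2 where 2: "rational x2 X2" "rational y2 Y2" "almost_all (\<lambda>Q. g Q = Affine (X2 Q) (Y2 Q))"
        using assms(2) P2 by auto
      have fg: "almost_all (\<lambda>Q. f Q = Affine (X1 Q) (Y1 Q) \<and> g Q = Affine (X2 Q) (Y2 Q))"
        by (rule almost_all_conj[OF 1(3) 2(3)])
      define S where "S = y1 + y2 + fls_const a1 * x2 + fls_const a3"
      define S' where "S' Q = Y1 Q + Y2 Q + to_ac a1 * X2 Q + to_ac a3" for Q
      have S: "rational S S'" unfolding S_def S'_def by (intro rational_intros 1 2)
      have x: "rational (x1 - x2) (\<lambda>Q. X1 Q - X2 Q)" by (intro rational_intros 1 2)
      define D where "D = 2 * y1 + fls_const a1 * x1 + fls_const a3"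
      define D' where "D' Q = 2 * Y1 Q + to_ac a1 * X1 Q + to_ac a3" for Q
      define l where "l = (if x1 = x2
        then (3 * x1^2 + 2 * fls_const a2 * x1 + fls_const a4 - fls_const a1 * y1) / D
        else (y2 - y1) / (x2 - x1))"
      define l' where "l' Q = (if X1 Q = X2 Q
        then (3 * X1 Q^2 + 2 * to_ac a2 * X1 Q + to_ac a4 - to_ac a1 * Y1 Q) / D' Q
        else (Y2 Q - Y1 Q) / (X2 Q - X1 Q))" for Q
      show ?thesis
      proof (cases "x1 = x2 \<and> S = 0")
        case True
        have "almost_all (\<lambda>Q. X1 Q - X2 Q = 0 \<and> S' Q = 0)"
          by (intro almost_all_conj; rule rational_eq_zero) (use x S True in simp_all)
        from almost_all_conj[OF fg this]
        have "almost_all (\<lambda>Q. point_add ?W (f Q) (g Q) = Infinity)"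
          by (rule almost_all_mono) (simp add: geometric_curve_E S'_def)
        moreover have "point_add EK P1 P2 = Infinity" using True by (simp add: P1 P2 S_def)
        ultimately show ?thesis by simp
      next
        case False
        have not_inv: "almost_all (\<lambda>Q. \<not> (X1 Q = X2 Q \<and> S' Q = 0))"
        proof (cases "x1 = x2")
          case True
          with False have "S \<noteq> 0" by simp
          from rational_nonzero[OF S this] show ?thesis by (rule almost_all_mono) simp
        next
          case False
          then have "x1 - x2 \<noteq> 0" by simp
          from rational_nonzero[OF x this] show ?thesis by (rule almost_all_mono) simp
        qed
        have l: "rational l l'"
        proof (cases "x1 = x2")
          case True
          have D: "rational D D'" unfolding D_def D'_def by (intro rational_intros 1)
          have X: "almost_all (\<lambda>Q. X1 Q - X2 Q = 0)"
            by (rule rational_eq_zero) (use x True in simp)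
          show ?thesis
          proof (cases "D = 0")
            case False
            have "rational l (\<lambda>Q. (3 * X1 Q^2 + 2 * to_ac a2 * X1 Q + to_ac a4 - to_ac a1 * Y1 Q) / D' Q)"
              unfolding l_def if_P[OF True] by (intro rational_intros 1 D False)
            then show ?thesis by (rule rational_cong) (rule almost_all_mono[OF X], simp add: l'_def)
          next
            case True
            \<comment> \<open>Both slopes are then the quotient by zero, which is zero.\<close>
            have "almost_all (\<lambda>Q. D' Q = 0)"
              by (rule rational_eq_zero) (use D True in simp)
            from almost_all_conj[OF this X] have "almost_all (\<lambda>Q. to_ac 0 = l' Q)"
              by (rule almost_all_mono) (simp add: l'_def)
            from rational_cong[OF rational_const[of 0] this] show ?thesis
              using \<open>x1 = x2\<close> True by (simp add: l_def)
          qed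
        next
          case False
          have "rational l (\<lambda>Q. (Y2 Q - Y1 Q) / (X2 Q - X1 Q))"
            unfolding l_def if_not_P[OF False] by (intro rational_intros 1 2) (use False in simp)
          then show ?thesis
          proof (rule rational_cong)
            have "x1 - x2 \<noteq> 0" using False by simp
            from rational_nonzero[OF x this] show "almost_all (\<lambda>Q. (Y2 Q - Y1 Q) / (X2 Q - X1 Q) = l' Q)"
              by (rule almost_all_mono) (simp add: l'_def)
          qed
        qed
        define x3 where "x3 = l^2 + fls_const a1 * l - fls_const a2 - x1 - x2"
        define X3 where "X3 Q = l' Q^2 + to_ac a1 * l' Q - to_ac a2 - X1 Q - X2 Q" for Q
        define y3 where "y3 = - (l + fls_const a1) * x3 - (y1 - l * x1) - fls_const a3"
        define Y3 where "Y3 Q = - (l' Q + to_ac a1) * X3 Q - (Y1 Q - l' Q * X1 Q) - to_ac a3" for Q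
        have x3: "rational x3 X3" unfolding x3_def X3_def by (intro rational_intros 1 2 l)
        have y3: "rational y3 Y3" unfolding y3_def Y3_def by (intro rational_intros 1 2 l x3)
        have sum: "point_add EK P1 P2 = Affine x3 y3"
          unfolding P1 P2 point_add.simps Let_def D_def[symmetric] S_def[symmetric] l_def[symmetric]
            x3_def[symmetric] y3_def[symmetric] if_not_P[OF False] ..
        have sum': "point_add ?W (Affine (X1 Q) (Y1 Q)) (Affine (X2 Q) (Y2 Q)) = Affine (X3 Q) (Y3 Q)"
          if "\<not> (X1 Q = X2 Q \<and> S' Q = 0)" for Q
          unfolding geometric_curve_E point_add.simps Let_def D'_def[symmetric] S'_def[symmetric] l'_def[symmetric]
            X3_def[symmetric] Y3_def[symmetric] if_not_P[OF that] ..
        have "almost_all (\<lambda>Q. point_add ?W (f Q) (g Q) = Affine (X3 Q) (Y3 Q))"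
        proof (rule almost_all_mono[OF almost_all_conj[OF fg not_inv]])
          fix Q assume Q: "(f Q = Affine (X1 Q) (Y1 Q) \<and> g Q = Affine (X2 Q) (Y2 Q)) \<and> \<not> (X1 Q = X2 Q \<and> S' Q = 0)"
          then have "f Q = Affine (X1 Q) (Y1 Q)" "g Q = Affine (X2 Q) (Y2 Q)" by blast+
          then show "point_add ?W (f Q) (g Q) = Affine (X3 Q) (Y3 Q)" using sum' Q by simp
        qed
        then show ?thesis unfolding sum specializes.simps using x3 y3 by blast
      qed
    qed
  qed
qed

end

section \<open>Multiplication by the characteristic is inseparable\<close>

fun multiple :: "'b::field weierstrass \<Rightarrow> nat \<Rightarrow> 'b point \<Rightarrow> 'b point" where
  "multiple W 0 P = Infinity"
| "multiple W (Suc m) P = point_add W (multiple W m P) P"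

context weierstrass_coefficients
begin

abbreviation "generic_point \<equiv> Affine x_gen y_gen"

lemma specializes_multiple:
  "specializes (multiple EK m generic_point) (multiple (geometric_curve E) m)"
proof (induction m)
  case 0
  show ?case by (simp add: almost_all_def)
next
  case (Suc m)
  have "specializes generic_point (\<lambda>Q. Q)"
    unfolding specializes.simps
  proof (intro exI conjI)
    show "rational x_gen x_coord" "rational y_gen y_coord"
      by (intro rational_regular regular_x_gen regular_y_gen)+
    show "almost_all (\<lambda>Q. Q = Affine (x_coord Q) (y_coord Q))"
      by (rule almost_all_mono[OF almost_all_not_Infinity]) (metis point.exhaust x_coord.simps(1) y_coord.simps(1))
  qed
  from specializes_add[OF Suc this] show ?case by simp
qed

text \<open>
  The denominator \<open>2 y + a1 x + a3\<close> can only be zero in characteristic \<open>2\<close> with \<open>a1 = a3 = 0\<close>, and then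
  the discriminant vanishes.
\<close>

lemma generic_differential:
  assumes "elliptic_curve E"
  obtains \<omega> where "has_differential generic_point \<omega>"
proof -
  interpret fc: ring_hom_types "fls_const :: 'a \<Rightarrow> 'a fls" by (rule ring_hom_fls_const)
  define A where "A = 2 * y_gen + fls_const a1 * x_gen + fls_const a3"
  define C where "C = 3 * x_gen^2 + 2 * fls_const a2 * x_gen + fls_const a4 - fls_const a1 * y_gen"
  have "\<not> ([:a3, a1:] = 0 \<and> [:2:] = (0 :: 'a poly))"
  proof
    assume "[:a3, a1:] = 0 \<and> [:2:] = (0 :: 'a poly)"
    then have *: "a3 = 0" "a1 = 0" "(2 :: 'a) = 0" by simp_all
    have "(4 :: 'a) = 2 * 2" by simp
    then have "(4 :: 'a) = 0" by (simp only: *(3) mult_zero_left)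
    then show False using assms by (simp add: elliptic_curve_def Let_def *)
  qed
  from normal_form_weight(1)[OF this] have A: "A \<noteq> 0"
    by (simp add: A_def algebra_simps)
  have "fls_deriv (y_gen^2 + fls_const a1 * x_gen * y_gen + fls_const a3 * y_gen)
    = fls_deriv (x_gen^3 + fls_const a2 * x_gen^2 + fls_const a4 * x_gen + fls_const a6)"
    by (simp only: generic_point_on_curve)
  then have rel: "A * fls_deriv y_gen = C * fls_deriv x_gen"
    by (simp add: A_def C_def power2_eq_square power3_eq_cube algebra_simps)
  have "has_differential generic_point (fls_deriv x_gen / A)"
    unfolding has_differential.simps A_def[symmetric] C_def[symmetric] using A rel by (simp add: field_simps)
  then show thesis by (rule that)
qed

lemma generic_multiple_differential:
  assumes \<omega>: "has_differential generic_point \<omega>"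
    and inf: "\<And>k. 0 < k \<Longrightarrow> k \<le> Suc m \<Longrightarrow> multiple EK k generic_point \<noteq> Infinity"
  shows "on_curve EK (multiple EK (Suc m) generic_point) \<and>
    has_differential (multiple EK (Suc m) generic_point) (of_nat (Suc m) * \<omega>)"
  using inf
proof (induction m)
  case 0
  show ?case using \<omega> generic_point_on_curve by simp
next
  case (Suc m)
  have fin: "point_add EK (multiple EK (Suc m) generic_point) generic_point \<noteq> Infinity"
    using Suc.prems[of "Suc (Suc m)"] by simp
  have IH: "on_curve EK (multiple EK (Suc m) generic_point)"
    "has_differential (multiple EK (Suc m) generic_point) (of_nat (Suc m) * \<omega>)"
    using Suc by simp_all
  have "on_curve EK generic_point" using generic_point_on_curve by simp
  from point_add_differential[OF IH(1) this IH(2) \<omega> fin] show ?case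
    by (simp add: distrib_right add.commute)
qed

lemma is_formE:
  assumes "is_form d F"
  obtains c where "F = ternary_form d (\<lambda>i j. to_ac (c i j))" "regular (form_value d c) (\<lambda>P. F (homog_coords P))"
    "F (homog_coords Infinity) = to_ac (c 0 d)"
proof -
  obtain c where F: "F = ternary_form d (\<lambda>i j. to_ac (c i j))" using assms by (auto simp: is_form_def)
  show thesis
    by (rule that[OF F]) (simp_all only: F regular_form form_at_Infinity form_value_pole(2))
qed

lemma form_zero_on_curve:
  assumes "is_form d F" "almost_all (\<lambda>Q. F (homog_coords Q) = 0)" "P \<in> geometric_points E"
  shows "F (homog_coords P) = 0"
proof -
  obtain c where c: "regular (form_value d c) (\<lambda>P. F (homog_coords P))" "F (homog_coords Infinity) = to_ac (c 0 d)"
    by (rule is_formE[OF assms(1)])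
  have zero: "form_value d c = 0"
  proof (rule ccontr)
    assume "form_value d c \<noteq> 0"
    from almost_all_conj[OF assms(2) regular_almost_all_nonzero[OF c(1) this]]
    show False by (rule almost_all_ex) simp
  qed
  show ?thesis
  proof (cases P)
    case Infinity
    then show ?thesis using c(2) form_value_pole(2)[of d c] by (simp add: zero)
  next
    case (Affine a b)
    then show ?thesis using regular_zero[OF c(1)[unfolded zero]] assms(3) by simp
  qed
qed

lemma describes_atE:
  assumes "describes_at m E f P F1 F2 F3"
  obtains d where "is_form d F1" "is_form d F2" "is_form d F3"
  using assms unfolding describes_at_def by blast

lemma describes_at_nonzero:
  assumes "describes_at m E f P F1 F2 F3"
  shows "F1 (homog_coords P) \<noteq> 0 \<or> F2 (homog_coords P) \<noteq> 0 \<or> F3 (homog_coords P) \<noteq> 0"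
  using assms unfolding describes_at_def by blast

lemma describes_at_value:
  assumes "describes_at m E f P F1 F2 F3" "Q \<in> geometric_points E"
    "F1 (homog_coords Q) \<noteq> 0 \<or> F2 (homog_coords Q) \<noteq> 0 \<or> F3 (homog_coords Q) \<noteq> 0"
  obtains l x y z where "l \<noteq> 0" "homog_coords (f Q) = (x, y, z)"
    "F1 (homog_coords Q) ^ m = l * x" "F2 (homog_coords Q) ^ m = l * y" "F3 (homog_coords Q) ^ m = l * z"
proof -
  have "\<exists>l x y z. l \<noteq> 0 \<and> homog_coords (f Q) = (x, y, z) \<and>
        F1 (homog_coords Q) ^ m = l * x \<and> F2 (homog_coords Q) ^ m = l * y \<and> F3 (homog_coords Q) ^ m = l * z"
    using assms unfolding describes_at_def by simp
  then show thesis using that by blast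
qed

text \<open>
  The third coordinate form vanishes at all but finitely many points, hence everywhere on the curve.
\<close>

lemma morphism_almost_all_Infinity:
  assumes f: "\<And>P. P \<in> geometric_points E \<Longrightarrow> \<exists>F1 F2 F3. describes_at 1 E f P F1 F2 F3"
    and inf: "almost_all (\<lambda>Q. f Q = Infinity)" and P: "P \<in> geometric_points E"
  shows "f P = Infinity"
proof -
  obtain F1 F2 F3 where D: "describes_at 1 E f P F1 F2 F3" using f[OF P] by blast
  obtain d where d: "is_form d F1" "is_form d F2" "is_form d F3" by (rule describes_atE[OF D])
  have "almost_all (\<lambda>Q. F3 (homog_coords Q) = 0)"
    using inf
  proof (rule almost_all_mono)
    fix Q assume Q: "Q \<in> geometric_points E" and fQ: "f Q = Infinity"
    show "F3 (homog_coords Q) = 0"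
    proof (rule ccontr)
      assume nz: "F3 (homog_coords Q) \<noteq> 0"
      then obtain l x y z where "l \<noteq> 0" "homog_coords (f Q) = (x, y, z)" "F3 (homog_coords Q) ^ 1 = l * z"
        using describes_at_value[OF D Q] by metis
      with fQ nz show False by simp
    qed
  qed
  then have "F3 (homog_coords P) = 0" by (rule form_zero_on_curve[OF d(3) _ P])
  obtain l x y z where "l \<noteq> 0" "homog_coords (f P) = (x, y, z)" "F3 (homog_coords P) ^ 1 = l * z"
    using describes_at_value[OF D P describes_at_nonzero[OF D]] by metis
  with \<open>F3 (homog_coords P) = 0\<close> show ?thesis by (cases "f P") auto
qed

end

context perfect_weierstrass
begin

text \<open>
  The product of \<open>F\<close> with \<open>F'^(p - 1)\<close> differs from a \<open>p\<close>-th power by the factor \<open>F / F'\<close>, whose derivative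
  is zero; its \<open>p\<close>-th root has a pole of order at most \<open>3 d\<close> and therefore is again a form of degree \<open>d\<close>.
\<close>

lemma p_th_root_of_forms:
  assumes \<kappa>: "\<kappa> = form_value d c" "\<kappa>' = form_value d c'"
    and t: "\<kappa> = t * \<kappa>'" "fls_deriv t = 0"
    and F: "F = ternary_form d (\<lambda>i j. to_ac (c i j))" "F' = ternary_form d (\<lambda>i j. to_ac (c' i j))"
  obtains G where "is_form d G"
    "\<And>Q. Q \<in> geometric_points E \<Longrightarrow> G (homog_coords Q) ^ p = F (homog_coords Q) * F' (homog_coords Q) ^ (p - 1)"
proof -
  have p: "p = Suc (p - 1)" using prime_gt_0_nat[OF p_prime] by simp
  define H where "H = \<kappa> * \<kappa>' ^ (p - 1)"
  have H: "regular H (\<lambda>Q. F (homog_coords Q) * F' (homog_coords Q) ^ (p - 1))"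
    unfolding H_def \<kappa> F by (intro regular_mult regular_power regular_form)
  have "\<kappa>' ^ p = \<kappa>' * \<kappa>' ^ (p - 1)" by (metis p power_Suc)
  then have "H = t * \<kappa>' ^ p" unfolding H_def t(1) by simp
  then have "fls_deriv H = 0" by (simp add: t(2))
  then obtain g \<psi> where g: "regular g \<psi>" "H = g ^ p" by (rule regular_p_th_root[OF H])
  note pole_\<kappa>' = pole_le_power[OF form_value_pole(1)[of d c'], of "p - 1"]
  note pole_H = pole_le_mult[OF form_value_pole(1)[of d c] pole_\<kappa>'(1), folded \<kappa>]
  have N: "3 * int d + int (p - 1) * (3 * int d) = int p * (3 * int d)"
    by (subst (2) p) (simp only: of_nat_Suc distrib_right mult_1 add.commute)
  have pole_H1: "pole_le (int p * (3 * int d)) H" and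
    pole_H2: "H $$ (- (int p * (3 * int d))) = c 0 d * (c' 0 d) ^ (p - 1)"
    using pole_H pole_\<kappa>'(2) unfolding N H_def \<kappa> form_value_pole(2) by simp_all
  have "pole_le (3 * int d) g"
  proof (cases "g = 0")
    case False
    then have "int p * (- fls_subdegree g) \<le> int p * (3 * int d)"
      using pole_H1 unfolding g(2) by (simp add: pole_le_iff fls_subdegree_pow)
    then have "- fls_subdegree g \<le> 3 * int d"
      by (rule mult_left_le_imp_le) (use prime_gt_0_nat[OF p_prime] in simp)
    then show ?thesis by (simp add: pole_le_iff)
  qed (simp add: pole_le_iff)
  then obtain e where e: "g = form_value d e" by (rule regular_is_form[OF g(1)])
  define G where "G = ternary_form d (\<lambda>i j. to_ac (e i j))"
  have G: "regular (g ^ p) (\<lambda>Q. G (homog_coords Q) ^ p)"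
    unfolding e G_def by (intro regular_power regular_form)
  show thesis
  proof (rule that)
    show "is_form d G" unfolding is_form_def G_def by blast
    fix Q assume Q: "Q \<in> geometric_points E"
    show "G (homog_coords Q) ^ p = F (homog_coords Q) * F' (homog_coords Q) ^ (p - 1)"
    proof (cases Q)
      case (Affine a b)
      then show ?thesis using regular_unique[OF G H[unfolded g(2)]] Q by simp
    next
      case Infinity
      have "(e 0 d) ^ p = c 0 d * (c' 0 d) ^ (p - 1)"
        using pole_H2 pole_le_power(2)[OF form_value_pole(1)[of d e], of p] unfolding g(2) e form_value_pole(2) by simp
      then have "to_ac (e 0 d) ^ p = to_ac (c 0 d) * to_ac (c' 0 d) ^ (p - 1)"
        by (simp flip: to_ac_power to_ac_mult)
      then show ?thesis unfolding Infinity G_def F form_at_Infinity form_value_pole(2) .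
    qed
  qed
qed

text \<open>
  If the generic value of \<open>f\<close> has derivative zero, then \<open>f\<close> factors through the \<open>p\<close>-th power Frobenius
  without losing regularity at any point.
\<close>

lemma inseparable_morphism_p_th_root:
  assumes f: "\<And>P. P \<in> geometric_points E \<Longrightarrow> \<exists>F1 F2 F3. describes_at 1 E f P F1 F2 F3"
    and spec: "specializes (Affine xf yf) f" and xf: "fls_deriv xf = 0" and yf: "fls_deriv yf = 0"
    and P: "P \<in> geometric_points E"
  shows "\<exists>G1 G2 G3. describes_at p E f P G1 G2 G3"
proof -
  obtain \<phi> \<psi> where \<phi>\<psi>: "rational xf \<phi>" "rational yf \<psi>" and f_eq: "almost_all (\<lambda>Q. f Q = Affine (\<phi> Q) (\<psi> Q))"
    using spec by auto
  obtain F1 F2 F3 where D: "describes_at 1 E f P F1 F2 F3" using f[OF P] by blast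
  obtain d where d: "is_form d F1" "is_form d F2" "is_form d F3" by (rule describes_atE[OF D])
  obtain c1 where c1: "F1 = ternary_form d (\<lambda>i j. to_ac (c1 i j))" "regular (form_value d c1) (\<lambda>P. F1 (homog_coords P))"
    by (rule is_formE[OF d(1)])
  obtain c2 where c2: "F2 = ternary_form d (\<lambda>i j. to_ac (c2 i j))" "regular (form_value d c2) (\<lambda>P. F2 (homog_coords P))"
    by (rule is_formE[OF d(2)])
  obtain c3 where c3: "F3 = ternary_form d (\<lambda>i j. to_ac (c3 i j))" "regular (form_value d c3) (\<lambda>P. F3 (homog_coords P))"
    by (rule is_formE[OF d(3)])
  let ?k1 = "form_value d c1" and ?k2 = "form_value d c2" and ?k3 = "form_value d c3"
  have eq: "almost_all (\<lambda>Q. F1 (homog_coords Q) = \<phi> Q * F3 (homog_coords Q) \<and>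
    F2 (homog_coords Q) = \<psi> Q * F3 (homog_coords Q))"
    using f_eq
  proof (rule almost_all_mono)
    fix Q assume Q: "Q \<in> geometric_points E" and fQ: "f Q = Affine (\<phi> Q) (\<psi> Q)"
    show "F1 (homog_coords Q) = \<phi> Q * F3 (homog_coords Q) \<and> F2 (homog_coords Q) = \<psi> Q * F3 (homog_coords Q)"
    proof (cases "F1 (homog_coords Q) \<noteq> 0 \<or> F2 (homog_coords Q) \<noteq> 0 \<or> F3 (homog_coords Q) \<noteq> 0")
      case True
      obtain l x y z where "l \<noteq> 0" "homog_coords (f Q) = (x, y, z)" "F1 (homog_coords Q) ^ 1 = l * x"
        "F2 (homog_coords Q) ^ 1 = l * y" "F3 (homog_coords Q) ^ 1 = l * z"
        by (rule describes_at_value[OF D Q True])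
      then show ?thesis using fQ by simp
    qed simp
  qed
  have k1: "?k1 = xf * ?k3"
    by (rule rational_unique[OF rational_regular[OF c1(2)] rational_mult[OF \<phi>\<psi>(1) rational_regular[OF c3(2)]]])
      (rule almost_all_mono[OF eq], simp)
  have k2: "?k2 = yf * ?k3"
    by (rule rational_unique[OF rational_regular[OF c2(2)] rational_mult[OF \<phi>\<psi>(2) rational_regular[OF c3(2)]]])
      (rule almost_all_mono[OF eq], simp)
  have nonzero: "form_value d c \<noteq> 0"
    if "F (homog_coords P) \<noteq> 0" "F = ternary_form d (\<lambda>i j. to_ac (c i j))" for F c
  proof
    assume "form_value d c = 0"
    then have "regular 0 (\<lambda>Q. F (homog_coords Q))" using regular_form[of d c] by (simp add: that(2))
    then have "almost_all (\<lambda>Q. F (homog_coords Q) = 0)" by (rule regular_eq_zero_almost_all)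
    moreover have "is_form d F" unfolding is_form_def that(2) by blast
    ultimately show False using form_zero_on_curve P that(1) by blast
  qed
  \<comment> \<open>A form that does not vanish at \<open>P\<close> serves as the common denominator.\<close>
  obtain F c r where F: "F = ternary_form d (\<lambda>i j. to_ac (c i j))" "F (homog_coords P) \<noteq> 0"
    "F = F1 \<or> F = F2 \<or> F = F3" and r: "form_value d c = r * ?k3" "fls_deriv r = 0"
  proof -
    consider "F1 (homog_coords P) \<noteq> 0" | "F2 (homog_coords P) \<noteq> 0" | "F3 (homog_coords P) \<noteq> 0"
      using describes_at_nonzero[OF D] by blast
    then show thesis
    proof cases
      case 1
      show thesis by (rule that[OF c1(1) 1 _ k1 xf]) simp
    next
      case 2
      show thesis by (rule that[OF c2(1) 2 _ k2 yf]) simp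
    next
      case 3
      show thesis by (rule that[OF c3(1) 3, of 1]) simp_all
    qed
  qed
  have "form_value d c \<noteq> 0" by (rule nonzero[OF F(2,1)])
  then have r0: "r \<noteq> 0" using r(1) by auto
  have quot: "s * ?k3 = s / r * form_value d c \<and> fls_deriv (s / r) = 0" if "fls_deriv s = 0" for s
  proof
    show "s * ?k3 = s / r * form_value d c" using r0 by (simp add: r(1))
    have "fls_deriv (s / r * r) = 0" using that r0 by simp
    then have "fls_deriv (s / r) * r = 0" unfolding fls_deriv_mult r(2) by simp
    then show "fls_deriv (s / r) = 0" using r0 by simp
  qed
  have one: "?k3 = 1 * ?k3" by simp
  obtain G1 where G1: "is_form d G1"
    "\<And>Q. Q \<in> geometric_points E \<Longrightarrow> G1 (homog_coords Q) ^ p = F1 (homog_coords Q) * F (homog_coords Q) ^ (p - 1)"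
    by (rule p_th_root_of_forms[OF refl refl _ _ c1(1) F(1)]) (use quot[OF xf] k1 in auto)
  obtain G2 where G2: "is_form d G2"
    "\<And>Q. Q \<in> geometric_points E \<Longrightarrow> G2 (homog_coords Q) ^ p = F2 (homog_coords Q) * F (homog_coords Q) ^ (p - 1)"
    by (rule p_th_root_of_forms[OF refl refl _ _ c2(1) F(1)]) (use quot[OF yf] k2 in auto)
  obtain G3 where G3: "is_form d G3"
    "\<And>Q. Q \<in> geometric_points E \<Longrightarrow> G3 (homog_coords Q) ^ p = F3 (homog_coords Q) * F (homog_coords Q) ^ (p - 1)"
    by (rule p_th_root_of_forms[OF refl refl _ _ c3(1) F(1)]) (use quot[of 1] one in auto)
  have p: "0 < p" "1 \<le> p - 1" using prime_ge_2_nat[OF p_prime] by simp_all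
  have "describes_at p E f P G1 G2 G3"
    unfolding describes_at_def
  proof (intro conjI ballI impI)
    show "\<exists>d. is_form d G1 \<and> is_form d G2 \<and> is_form d G3" using G1 G2 G3 by blast
    show "\<not> (G1 (homog_coords P) = 0 \<and> G2 (homog_coords P) = 0 \<and> G3 (homog_coords P) = 0)"
    proof
      assume "G1 (homog_coords P) = 0 \<and> G2 (homog_coords P) = 0 \<and> G3 (homog_coords P) = 0"
      then have "F1 (homog_coords P) = 0" "F2 (homog_coords P) = 0" "F3 (homog_coords P) = 0"
        using G1(2)[OF P] G2(2)[OF P] G3(2)[OF P] F(2) p(1) by (simp_all add: zero_power)
      then show False using describes_at_nonzero[OF D] by blast
    qed
    fix Q assume Q: "Q \<in> geometric_points E"
      and nz: "\<not> (G1 (homog_coords Q) = 0 \<and> G2 (homog_coords Q) = 0 \<and> G3 (homog_coords Q) = 0)"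
    have FQ: "F (homog_coords Q) \<noteq> 0"
    proof
      assume "F (homog_coords Q) = 0"
      then have "G1 (homog_coords Q) ^ p = 0" "G2 (homog_coords Q) ^ p = 0" "G3 (homog_coords Q) ^ p = 0"
        using G1(2)[OF Q] G2(2)[OF Q] G3(2)[OF Q] p(2) by (simp_all add: zero_power)
      then show False using nz by simp
    qed
    then have "F1 (homog_coords Q) \<noteq> 0 \<or> F2 (homog_coords Q) \<noteq> 0 \<or> F3 (homog_coords Q) \<noteq> 0"
      using F(3) by blast
    then obtain l x y z where l: "l \<noteq> 0" "homog_coords (f Q) = (x, y, z)" "F1 (homog_coords Q) ^ 1 = l * x"
        "F2 (homog_coords Q) ^ 1 = l * y" "F3 (homog_coords Q) ^ 1 = l * z"
      by (rule describes_at_value[OF D Q])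
    show "\<exists>l x y z. l \<noteq> 0 \<and> homog_coords (f Q) = (x, y, z) \<and>
        G1 (homog_coords Q) ^ p = l * x \<and> G2 (homog_coords Q) ^ p = l * y \<and> G3 (homog_coords Q) ^ p = l * z"
      by (rule exI[of _ "l * F (homog_coords Q) ^ (p - 1)"])
        (use l FQ in \<open>simp add: G1(2)[OF Q] G2(2)[OF Q] G3(2)[OF Q]\<close>)
  qed
  then show ?thesis by blast
qed

end

context perfect_weierstrass
begin

lemma perfect_power: "\<exists>b. b ^ (p ^ k) = (a :: 'a)"
proof (induction k arbitrary: a)
  case (Suc k)
  obtain b where "b ^ p = a" using perfect by blast
  moreover obtain b' where "b' ^ (p ^ k) = b" using Suc by blast
  ultimately have "b' ^ (p ^ Suc k) = a" by (simp add: power_mult mult.commute[of p])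
  then show ?case ..
qed simp

lemma twisted_form:
  fixes H :: "'a alg_closure form"
  assumes "is_form e H"
  obtains H' where "is_form e H'" "\<And>x y z. H' (x, y, z) ^ (p ^ k) = H (x ^ (p ^ k), y ^ (p ^ k), z ^ (p ^ k))"
proof -
  obtain c where H: "H = ternary_form e (\<lambda>i j. to_ac (c i j))" using assms by (auto simp: is_form_def)
  define b where "b i j = (SOME b. b ^ (p ^ k) = c i j)" for i j
  have b: "b i j ^ (p ^ k) = c i j" for i j
    unfolding b_def by (rule someI_ex[of "\<lambda>b. b ^ (p ^ k) = c i j"]) (rule perfect_power)
  have CHAR: "prime CHAR('a alg_closure)" "p ^ k = CHAR('a alg_closure) ^ k"
    using p_prime by (simp_all add: p_CHAR)
  show thesis
  proof (rule that)
    show "is_form e (ternary_form e (\<lambda>i j. to_ac (b i j)))" unfolding is_form_def by blast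
    show "ternary_form e (\<lambda>i j. to_ac (b i j)) (x, y, z) ^ (p ^ k) = H (x ^ (p ^ k), y ^ (p ^ k), z ^ (p ^ k))" for x y z
      unfolding ternary_form_power_CHAR[OF CHAR] H by (simp only: b flip: to_ac_power)
  qed
qed

lemma form_scale: "is_form e H \<Longrightarrow> H (l * x, l * y, l * z) = l ^ e * H (x, y, z)"
  by (auto simp: is_form_def ternary_form_scale simp del: ternary_form.simps)

text \<open>
  Moving the \<open>p^k\<close>-th power past the forms for \<open>g\<close> replaces their coefficients by \<open>p^k\<close>-th roots.
  The factor \<open>F\<close>, one of the forms for \<open>f\<close>, makes the composite forms vanish where those for \<open>f\<close> do; without
  it this could fail for forms of degree \<open>0\<close>.
\<close>

lemma describes_at_compose:
  assumes f: "describes_at (p ^ k) E f P F1 F2 F3" and g: "describes_at p E g (f P) H1 H2 H3"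
    and maps: "f \<in> geometric_points E \<rightarrow> geometric_points E" and P: "P \<in> geometric_points E"
  shows "\<exists>G1 G2 G3. describes_at (p ^ Suc k) E (\<lambda>Q. g (f Q)) P G1 G2 G3"
proof -
  let ?m = "p ^ k"
  have m: "0 < ?m" and p0: "0 < p" using prime_gt_0_nat[OF p_prime] by simp_all
  obtain d where d: "is_form d F1" "is_form d F2" "is_form d F3" by (rule describes_atE[OF f])
  obtain e where e: "is_form e H1" "is_form e H2" "is_form e H3" by (rule describes_atE[OF g])
  obtain K1 where K1: "is_form e K1" "\<And>x y z. K1 (x, y, z) ^ ?m = H1 (x ^ ?m, y ^ ?m, z ^ ?m)"
    by (rule twisted_form[OF e(1), of k]) (rule that)
  obtain K2 where K2: "is_form e K2" "\<And>x y z. K2 (x, y, z) ^ ?m = H2 (x ^ ?m, y ^ ?m, z ^ ?m)"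
    by (rule twisted_form[OF e(2), of k]) (rule that)
  obtain K3 where K3: "is_form e K3" "\<And>x y z. K3 (x, y, z) ^ ?m = H3 (x ^ ?m, y ^ ?m, z ^ ?m)"
    by (rule twisted_form[OF e(3), of k]) (rule that)
  obtain F where F: "F = F1 \<or> F = F2 \<or> F = F3" "F (homog_coords P) \<noteq> 0"
    using describes_at_nonzero[OF f] by metis
  have Fd: "is_form d F" using F(1) d by blast
  define G where "G K = (\<lambda>t. F t * K (F1 t, F2 t, F3 t))" for K
  have G_form: "is_form (d + e * d) (G K)" if "is_form e K" for K
    unfolding G_def by (intro is_form_mult Fd is_form_compose that d)
  have val: "\<exists>l. l \<noteq> 0 \<and> G K1 (homog_coords Q) ^ ?m = l * H1 (homog_coords (f Q)) \<and>
      G K2 (homog_coords Q) ^ ?m = l * H2 (homog_coords (f Q)) \<and> G K3 (homog_coords Q) ^ ?m = l * H3 (homog_coords (f Q))"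
    if Q: "Q \<in> geometric_points E" and FQ: "F (homog_coords Q) \<noteq> 0" for Q
  proof -
    have "F1 (homog_coords Q) \<noteq> 0 \<or> F2 (homog_coords Q) \<noteq> 0 \<or> F3 (homog_coords Q) \<noteq> 0"
      using F(1) FQ by blast
    then obtain l x y z where l: "l \<noteq> 0" "homog_coords (f Q) = (x, y, z)" "F1 (homog_coords Q) ^ ?m = l * x"
        "F2 (homog_coords Q) ^ ?m = l * y" "F3 (homog_coords Q) ^ ?m = l * z"
      by (rule describes_at_value[OF f Q])
    have "G K (homog_coords Q) ^ ?m = F (homog_coords Q) ^ ?m * l ^ e * H (homog_coords (f Q))"
      if "is_form e H" "\<And>x y z. K (x, y, z) ^ ?m = H (x ^ ?m, y ^ ?m, z ^ ?m)" for K H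
      unfolding G_def power_mult_distrib that(2) l form_scale[OF that(1)] by (simp only: mult.assoc)
    note G_eq = this[OF e(1) K1(2)] this[OF e(2) K2(2)] this[OF e(3) K3(2)]
    show ?thesis
      by (rule exI[of _ "F (homog_coords Q) ^ ?m * l ^ e"], intro conjI G_eq) (simp add: FQ l(1))
  qed
  have "describes_at (p ^ Suc k) E (\<lambda>Q. g (f Q)) P (G K1) (G K2) (G K3)"
    unfolding describes_at_def
  proof (intro conjI ballI impI)
    show "\<exists>d. is_form d (G K1) \<and> is_form d (G K2) \<and> is_form d (G K3)"
      using G_form K1(1) K2(1) K3(1) by blast
    obtain l where l: "l \<noteq> 0" "G K1 (homog_coords P) ^ ?m = l * H1 (homog_coords (f P))"
      "G K2 (homog_coords P) ^ ?m = l * H2 (homog_coords (f P))" "G K3 (homog_coords P) ^ ?m = l * H3 (homog_coords (f P))"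
      using val[OF P F(2)] by blast
    show "\<not> (G K1 (homog_coords P) = 0 \<and> G K2 (homog_coords P) = 0 \<and> G K3 (homog_coords P) = 0)"
    proof
      assume "G K1 (homog_coords P) = 0 \<and> G K2 (homog_coords P) = 0 \<and> G K3 (homog_coords P) = 0"
      then have "H1 (homog_coords (f P)) = 0" "H2 (homog_coords (f P)) = 0" "H3 (homog_coords (f P)) = 0"
        using l m by (simp_all add: zero_power)
      then show False using describes_at_nonzero[OF g] by blast
    qed
    fix Q assume Q: "Q \<in> geometric_points E"
      and nz: "\<not> (G K1 (homog_coords Q) = 0 \<and> G K2 (homog_coords Q) = 0 \<and> G K3 (homog_coords Q) = 0)"
    then have FQ: "F (homog_coords Q) \<noteq> 0" by (auto simp: G_def)
    obtain l where l: "l \<noteq> 0" "G K1 (homog_coords Q) ^ ?m = l * H1 (homog_coords (f Q))"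
      "G K2 (homog_coords Q) ^ ?m = l * H2 (homog_coords (f Q))" "G K3 (homog_coords Q) ^ ?m = l * H3 (homog_coords (f Q))"
      using val[OF Q FQ] by blast
    have "f Q \<in> geometric_points E" using maps Q by blast
    moreover have "H1 (homog_coords (f Q)) \<noteq> 0 \<or> H2 (homog_coords (f Q)) \<noteq> 0 \<or> H3 (homog_coords (f Q)) \<noteq> 0"
    proof (rule ccontr)
      assume "\<not> ?thesis"
      then have "G K1 (homog_coords Q) ^ ?m = 0" "G K2 (homog_coords Q) ^ ?m = 0" "G K3 (homog_coords Q) ^ ?m = 0"
        using l by simp_all
      then show False using nz by simp
    qed
    ultimately obtain l' x y z where l': "l' \<noteq> 0" "homog_coords (g (f Q)) = (x, y, z)"
      "H1 (homog_coords (f Q)) ^ p = l' * x" "H2 (homog_coords (f Q)) ^ p = l' * y" "H3 (homog_coords (f Q)) ^ p = l' * z"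
      by (rule describes_at_value[OF g])
    have pow: "t ^ (p ^ Suc k) = (t ^ ?m) ^ p" for t :: "'a alg_closure"
      by (simp add: mult.commute flip: power_mult)
    show "\<exists>l x y z. l \<noteq> 0 \<and> homog_coords (g (f Q)) = (x, y, z) \<and> G K1 (homog_coords Q) ^ (p ^ Suc k) = l * x \<and>
        G K2 (homog_coords Q) ^ (p ^ Suc k) = l * y \<and> G K3 (homog_coords Q) ^ (p ^ Suc k) = l * z"
      by (rule exI[of _ "l ^ p * l'"], rule exI[of _ x], rule exI[of _ y], rule exI[of _ z])
        (simp only: pow l l' power_mult_distrib, simp add: l(1) l'(1))
  qed
  then show ?thesis by blast
qed

lemma describes_at_iterate:
  assumes f: "\<And>P. P \<in> geometric_points E \<Longrightarrow> \<exists>F1 F2 F3. describes_at p E f P F1 F2 F3"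
    and maps: "f \<in> geometric_points E \<rightarrow> geometric_points E" and P: "P \<in> geometric_points E"
  shows "(f ^^ k) \<in> geometric_points E \<rightarrow> geometric_points E \<and>
    (\<exists>F1 F2 F3. describes_at (p ^ k) E (f ^^ k) P F1 F2 F3)"
proof (induction k)
  case 0
  let ?F1 = "\<lambda>(x, y, z). to_ac (1::'a) * x ^ 1 * y ^ 0 * z ^ 0"
  let ?F2 = "\<lambda>(x, y, z). to_ac (1::'a) * x ^ 0 * y ^ 1 * z ^ 0"
  let ?F3 = "\<lambda>(x, y, z). to_ac (1::'a) * x ^ 0 * y ^ 0 * z ^ 1"
  have forms: "is_form 1 ?F1" "is_form 1 ?F2" "is_form 1 ?F3" by (intro is_form_monomial; simp)+
  have "describes_at (p ^ 0) E (f ^^ 0) P ?F1 ?F2 ?F3"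
    unfolding describes_at_def
  proof (intro conjI ballI impI)
    show "\<exists>d. is_form d ?F1 \<and> is_form d ?F2 \<and> is_form d ?F3" using forms by blast
    show "\<not> (?F1 (homog_coords P) = 0 \<and> ?F2 (homog_coords P) = 0 \<and> ?F3 (homog_coords P) = 0)"
      using homog_coords_nonzero[of P] by (cases "homog_coords P") simp
    fix Q
    show "\<exists>l x y z. l \<noteq> 0 \<and> homog_coords ((f ^^ 0) Q) = (x, y, z) \<and>
        ?F1 (homog_coords Q) ^ (p ^ 0) = l * x \<and> ?F2 (homog_coords Q) ^ (p ^ 0) = l * y \<and> ?F3 (homog_coords Q) ^ (p ^ 0) = l * z"
      by (rule exI[of _ 1]) (cases "homog_coords Q"; simp)
  qed
  moreover have "(f ^^ 0) \<in> geometric_points E \<rightarrow> geometric_points E" by simp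
  ultimately show ?case by blast
next
  case (Suc k)
  then obtain F1 F2 F3 where F: "describes_at (p ^ k) E (f ^^ k) P F1 F2 F3"
    and k: "(f ^^ k) \<in> geometric_points E \<rightarrow> geometric_points E" by blast
  have "(f ^^ k) P \<in> geometric_points E" using k P by blast
  then obtain H1 H2 H3 where "describes_at p E f ((f ^^ k) P) H1 H2 H3" using f by blast
  from describes_at_compose[OF F this k P]
  have "\<exists>F1 F2 F3. describes_at (p ^ Suc k) E (f ^^ Suc k) P F1 F2 F3"
    by (simp only: funpow.simps comp_def)
  moreover have "(f ^^ Suc k) \<in> geometric_points E \<rightarrow> geometric_points E"
  proof
    fix Q assume "Q \<in> geometric_points E"
    then have "(f ^^ k) Q \<in> geometric_points E" using k by blast
    then have "f ((f ^^ k) Q) \<in> geometric_points E" using maps by blast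
    then show "(f ^^ Suc k) Q \<in> geometric_points E" by (simp only: funpow.simps comp_def)
  qed
  ultimately show ?case by blast
qed

text \<open>
  The differential of the \<open>p\<close>-th multiple of the generic point is \<open>p\<close> times that of the generic point.
  The intermediate multiples must not be the point at infinity, which has no differential.
\<close>

lemma multiple_p_inseparable:
  assumes morphism: "\<And>m P. P \<in> geometric_points E \<Longrightarrow> \<exists>F1 F2 F3. describes_at 1 E (multiple (geometric_curve E) m) P F1 F2 F3"
    and nonzero: "\<And>m. 0 < m \<Longrightarrow> \<exists>Q\<in>geometric_points E. multiple (geometric_curve E) m Q \<noteq> Infinity"
    and P: "P \<in> geometric_points E"
  shows "\<exists>F1 F2 F3. describes_at p E (multiple (geometric_curve E) p) P F1 F2 F3"
proof -
  have inf: "multiple EK m generic_point \<noteq> Infinity" if "0 < m" for m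
  proof
    assume "multiple EK m generic_point = Infinity"
    then have "almost_all (\<lambda>Q. multiple (geometric_curve E) m Q = Infinity)"
      using specializes_multiple[of m] by simp
    then show False using nonzero[OF that] morphism_almost_all_Infinity[OF morphism] by blast
  qed
  obtain \<omega> where \<omega>: "has_differential generic_point \<omega>" by (rule generic_differential[OF nonsingular])
  have p: "p = Suc (p - 1)" using prime_gt_0_nat[OF p_prime] by simp
  have diff: "has_differential (multiple EK p generic_point) (of_nat p * \<omega>)"
    using generic_multiple_differential[OF \<omega>, of "p - 1"] inf unfolding p[symmetric] by blast
  then obtain x y where xy: "multiple EK p generic_point = Affine x y"
    by (cases "multiple EK p generic_point") auto
  have "fls_deriv x = 0" "fls_deriv y = 0" using diff unfolding xy by simp_all
  moreover have "specializes (Affine x y) (multiple (geometric_curve E) p)"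
    using specializes_multiple[of p] unfolding xy .
  ultimately show ?thesis using inseparable_morphism_p_th_root[OF morphism _ _ _ P] by blast
qed

end

lemma finite_field_perfect_weierstrass:
  fixes a1 :: "'a::{field,finite}"
  assumes "elliptic_curve (Weierstrass a1 a2 a3 a4 a6)"
  shows "perfect_weierstrass a1 a2 a3 a4 a6 CHAR('a)"
proof
  show "prime CHAR('a)" by (rule prime_CHAR_finite)
  show "\<exists>b. b ^ CHAR('a) = a" for a :: 'a
    using finite_field_CHAR_root[of 1 a] by auto
qed (use assms in simp_all)

definition End_multiple :: "'a::field weierstrass \<Rightarrow> nat \<Rightarrow> 'a alg_closure point \<Rightarrow> 'a alg_closure point" where
  "End_multiple E m = (\<lambda>P\<in>geometric_points E. multiple (geometric_curve E) m P)"

section \<open>The Verschiebung\<close>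

lemma describes_at_cong:
  assumes "describes_at m E f P F1 F2 F3" "\<And>Q. Q \<in> geometric_points E \<Longrightarrow> f Q = g Q"
  shows "describes_at m E g P F1 F2 F3"
  using assms unfolding describes_at_def by simp

lemma End_carrierD:
  assumes "f \<in> carrier (End_ring E)"
  shows "f \<in> extensional (geometric_points E)" "f \<in> geometric_points E \<rightarrow> geometric_points E"
    "f Infinity = Infinity" "P \<in> geometric_points E \<Longrightarrow> \<exists>F1 F2 F3. describes_at 1 E f P F1 F2 F3"
  using assms unfolding End_ring_def by (simp_all add: morphism_over_base_iff)

lemma End_carrierI:
  assumes "f \<in> extensional (geometric_points E)" "f \<in> geometric_points E \<rightarrow> geometric_points E"
    "f Infinity = Infinity" "\<And>P. P \<in> geometric_points E \<Longrightarrow> \<exists>F1 F2 F3. describes_at 1 E f P F1 F2 F3"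
  shows "f \<in> carrier (End_ring E)"
  using assms unfolding End_ring_def by (simp add: morphism_over_base_iff)

lemma End_ring_simps:
  "f \<otimes>\<^bsub>End_ring E\<^esub> g = compose (geometric_points E) f g"
  "\<one>\<^bsub>End_ring E\<^esub> = (\<lambda>P\<in>geometric_points E. P)"
  "\<zero>\<^bsub>End_ring E\<^esub> = (\<lambda>P\<in>geometric_points E. Infinity)"
  "f \<oplus>\<^bsub>End_ring E\<^esub> g = (\<lambda>P\<in>geometric_points E. point_add (geometric_curve E) (f P) (g P))"
  by (simp_all add: End_ring_def)

lemma End_pow_Suc:
  "g [^]\<^bsub>End_ring E\<^esub> Suc n = g [^]\<^bsub>End_ring E\<^esub> n \<otimes>\<^bsub>End_ring E\<^esub> g"
  by (simp add: nat_pow_def)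

lemma End_pow:
  assumes "f \<in> geometric_points E \<rightarrow> geometric_points E"
  shows "(\<lambda>P\<in>geometric_points E. f P) [^]\<^bsub>End_ring E\<^esub> (n :: nat) = (\<lambda>P\<in>geometric_points E. (f ^^ n) P)"
proof (induction n)
  case 0
  show ?case by (simp add: nat_pow_def End_ring_simps)
next
  case (Suc n)
  have "(\<lambda>P\<in>geometric_points E. f P) [^]\<^bsub>End_ring E\<^esub> Suc n
    = compose (geometric_points E) (\<lambda>P\<in>geometric_points E. (f ^^ n) P) (\<lambda>P\<in>geometric_points E. f P)"
    unfolding End_pow_Suc Suc End_ring_simps ..
  also have "\<dots> = (\<lambda>P\<in>geometric_points E. (f ^^ Suc n) P)"
  proof (rule extensionalityI[OF compose_extensional restrict_extensional])
    fix Q assume Q: "Q \<in> geometric_points E"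
    then have "f Q \<in> geometric_points E" using assms by blast
    then show "compose (geometric_points E) (\<lambda>P\<in>geometric_points E. (f ^^ n) P) (\<lambda>P\<in>geometric_points E. f P) Q
      = (\<lambda>P\<in>geometric_points E. (f ^^ Suc n) P) Q"
      using Q by (simp add: compose_eq funpow_swap1)
  qed
  finally show ?case .
qed

text \<open>
  Frobenius is bijective on geometric points, so \<open>g\<close> followed by its inverse is a map; its coordinates
  are given by the forms whose \<open>q\<close>-th powers describe \<open>g\<close>.
\<close>

lemma Frobenius_root_of_morphism:
  fixes E :: "'a::{field,finite} weierstrass" and g :: "'a alg_closure point \<Rightarrow> 'a alg_closure point"
  assumes maps: "g \<in> geometric_points E \<rightarrow> geometric_points E" and inf: "g Infinity = Infinity"
    and g: "\<And>P. P \<in> geometric_points E \<Longrightarrow> \<exists>F1 F2 F3. describes_at CARD('a) E g P F1 F2 F3"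
  obtains V where "V \<in> carrier (End_ring E)"
    "frobenius E \<otimes>\<^bsub>End_ring E\<^esub> V = (\<lambda>P\<in>geometric_points E. g P)"
proof -
  let ?q = "CARD('a)"
  have q: "?q > 0" by (rule q_pos[OF refl])
  have root: "\<exists>R\<in>geometric_points E. point_power ?q R = P" if P: "P \<in> geometric_points E" for P
  proof (cases P)
    case Infinity
    then show ?thesis by (intro bexI[of _ Infinity]) simp_all
  next
    case (Affine a b)
    obtain a' b' where "a' ^ ?q = a" "b' ^ ?q = b" using nth_root_exists[OF q] by metis
    then have "point_power ?q (Affine a' b') = P" by (simp add: Affine)
    then show ?thesis using on_curve_q[OF refl, of "Affine a' b'" E] P by metis
  qed
  define V where "V = (\<lambda>P\<in>geometric_points E. SOME R. R \<in> geometric_points E \<and> point_power ?q R = g P)"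
  have V: "V P \<in> geometric_points E" "point_power ?q (V P) = g P" if P: "P \<in> geometric_points E" for P
  proof -
    have "\<exists>R. R \<in> geometric_points E \<and> point_power ?q R = g P" using root maps P by blast
    from someI_ex[OF this] show "V P \<in> geometric_points E" "point_power ?q (V P) = g P"
      using P by (simp_all add: V_def)
  qed
  have "V Infinity = Infinity"
    using V(2)[OF Infinity_geometric] inf by (cases "V Infinity") simp_all
  moreover have "\<exists>F1 F2 F3. describes_at 1 E V P F1 F2 F3" if P: "P \<in> geometric_points E" for P
  proof -
    obtain F1 F2 F3 where D: "describes_at ?q E g P F1 F2 F3" using g[OF P] by blast
    have "describes_at 1 E V P F1 F2 F3"
      unfolding describes_at_def
    proof (intro conjI ballI impI)
      show "\<exists>d. is_form d F1 \<and> is_form d F2 \<and> is_form d F3"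
        "\<not> (F1 (homog_coords P) = 0 \<and> F2 (homog_coords P) = 0 \<and> F3 (homog_coords P) = 0)"
        using D unfolding describes_at_def by blast+
      fix Q assume Q: "Q \<in> geometric_points E"
        and nz: "\<not> (F1 (homog_coords Q) = 0 \<and> F2 (homog_coords Q) = 0 \<and> F3 (homog_coords Q) = 0)"
      have "\<exists>l x y z. l \<noteq> 0 \<and> homog_coords (g Q) = (x, y, z) \<and>
        F1 (homog_coords Q) ^ ?q = l * x \<and> F2 (homog_coords Q) ^ ?q = l * y \<and> F3 (homog_coords Q) ^ ?q = l * z"
        using D Q nz unfolding describes_at_def by simp
      then obtain l x y z where l: "l \<noteq> 0" "homog_coords (g Q) = (x, y, z)"
        "F1 (homog_coords Q) ^ ?q = l * x" "F2 (homog_coords Q) ^ ?q = l * y" "F3 (homog_coords Q) ^ ?q = l * z"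
        by blast
      obtain k where k: "k ^ ?q = l" using nth_root_exists[OF q] by blast
      obtain x' y' z' where V': "homog_coords (V Q) = (x', y', z')" by (cases "homog_coords (V Q)")
      have xyz: "x = x' ^ ?q" "y = y' ^ ?q" "z = z' ^ ?q"
        using homog_coords_power[OF q, of "V Q"] l(2) unfolding V(2)[OF Q] V' by simp_all
      have "F1 (homog_coords Q) = k * x'" "F2 (homog_coords Q) = k * y'" "F3 (homog_coords Q) = k * z'"
        by (rule q_inj[OF refl], simp only: l xyz power_mult_distrib k)+
      then show "\<exists>l x y z. l \<noteq> 0 \<and> homog_coords (V Q) = (x, y, z) \<and>
        F1 (homog_coords Q) ^ 1 = l * x \<and> F2 (homog_coords Q) ^ 1 = l * y \<and> F3 (homog_coords Q) ^ 1 = l * z"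
        using V' l(1) k q by (intro exI[of _ k] exI[of _ x'] exI[of _ y'] exI[of _ z']) (auto simp: zero_power)
    qed
    then show ?thesis by blast
  qed
  ultimately have "V \<in> carrier (End_ring E)"
    using V(1) by (intro End_carrierI) (simp_all add: V_def)
  moreover have "frobenius E \<otimes>\<^bsub>End_ring E\<^esub> V = (\<lambda>P\<in>geometric_points E. g P)"
    unfolding End_ring_simps
    by (rule extensionalityI[OF compose_extensional restrict_extensional])
      (simp add: compose_eq frobenius_eq[OF refl] V)
  ultimately show thesis by (rule that)
qed

theorem Verschiebung_exists:
  fixes E :: "'a::{field,finite} weierstrass"
  assumes E: "elliptic_curve E"
    and closed: "\<And>m. End_multiple E m \<in> carrier (End_ring E)"
    and nonzero: "\<And>m. 0 < m \<Longrightarrow> End_multiple E m \<noteq> \<zero>\<^bsub>End_ring E\<^esub>"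
  obtains V n where "V \<in> carrier (End_ring E)"
    "frobenius E \<otimes>\<^bsub>End_ring E\<^esub> V = End_multiple E CHAR('a) [^]\<^bsub>End_ring E\<^esub> (n :: nat)"
proof -
  obtain a1 a2 a3 a4 a6 where Eq: "E = Weierstrass a1 a2 a3 a4 a6" by (cases E)
  interpret W: perfect_weierstrass a1 a2 a3 a4 a6 "CHAR('a)"
    by (rule finite_field_perfect_weierstrass) (use E Eq in simp)
  obtain n where q: "CARD('a) = CHAR('a) ^ n" by (rule card_finite_field_power_CHAR)
  let ?G = "geometric_points E"
  let ?f = "multiple (geometric_curve E)"
  have morphism: "\<exists>F1 F2 F3. describes_at 1 E (?f m) P F1 F2 F3" if "P \<in> ?G" for m P
    using End_carrierD(4)[OF closed that, of m] describes_at_cong[of 1 E "End_multiple E m" P _ _ _ "?f m"]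
    by (simp add: End_multiple_def) blast
  have maps: "?f m \<in> ?G \<rightarrow> ?G" for m
    using End_carrierD(2)[OF closed, of m] by (simp add: End_multiple_def Pi_iff)
  have inf: "?f m Infinity = Infinity" for m
    using End_carrierD(3)[OF closed, of m] by (simp add: End_multiple_def)
  have nz: "\<exists>Q\<in>?G. ?f m Q \<noteq> Infinity" if "0 < m" for m
  proof (rule ccontr)
    assume "\<not> ?thesis"
    then have "End_multiple E m = \<zero>\<^bsub>End_ring E\<^esub>"
      unfolding End_multiple_def End_ring_simps by (intro restrict_ext) blast
    with nonzero[OF that] show False ..
  qed
  let ?h = "?f CHAR('a)"
  have insep: "\<exists>F1 F2 F3. describes_at CHAR('a) E ?h P F1 F2 F3" if "P \<in> ?G" for P
    using W.multiple_p_inseparable morphism nz that unfolding Eq by blast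
  have iter: "(?h ^^ n) \<in> ?G \<rightarrow> ?G \<and> (\<exists>F1 F2 F3. describes_at (CHAR('a) ^ n) E (?h ^^ n) P F1 F2 F3)"
    if "P \<in> ?G" for P
    using W.describes_at_iterate[of ?h P n] insep maps[of "CHAR('a)"] that unfolding Eq by blast
  have "(?h ^^ n) Infinity = Infinity" by (induction n) (simp_all add: inf)
  then obtain V where V: "V \<in> carrier (End_ring E)"
    "frobenius E \<otimes>\<^bsub>End_ring E\<^esub> V = (\<lambda>P\<in>?G. (?h ^^ n) P)"
    using Frobenius_root_of_morphism[of "?h ^^ n" E] iter Infinity_geometric unfolding q by blast
  show thesis
    by (rule that[OF V(1)]) (simp only: V(2) End_multiple_def End_pow[OF maps])
qed

section \<open>Frobenius as a similitude\<close>

lemma Infinity_add: "point_add W Infinity P = P" "point_add W P Infinity = P"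
  by (cases P; simp)+

lemma zero_End: "\<zero>\<^bsub>End_ring E\<^esub> \<in> carrier (End_ring (E :: 'a::field weierstrass))"
proof (rule End_carrierI)
  fix P assume "P \<in> geometric_points E"
  let ?F0 = "\<lambda>(x, y, z). to_ac (0::'a) * x ^ 0 * y ^ 0 * z ^ 0"
  let ?F1 = "\<lambda>(x, y, z). to_ac (1::'a) * x ^ 0 * y ^ 0 * z ^ 0"
  have "is_form 0 ?F0" "is_form 0 ?F1" by (intro is_form_monomial; simp)+
  then have "\<exists>d. is_form d ?F0 \<and> is_form d ?F1 \<and> is_form d ?F0" by blast
  then have "describes_at 1 E \<zero>\<^bsub>End_ring E\<^esub> P ?F0 ?F1 ?F0"
    unfolding describes_at_def End_ring_simps by (auto simp: case_prod_unfold)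
  then show "\<exists>F1 F2 F3. describes_at 1 E \<zero>\<^bsub>End_ring E\<^esub> P F1 F2 F3" by blast
qed (simp_all add: End_ring_simps)

lemma End_multiple_Suc:
  "End_multiple E (Suc m) = End_multiple E m \<oplus>\<^bsub>End_ring E\<^esub> \<one>\<^bsub>End_ring E\<^esub>"
  unfolding End_multiple_def End_ring_simps by (rule restrict_ext) simp

lemma End_multiple_0: "End_multiple E 0 = \<zero>\<^bsub>End_ring E\<^esub>"
  unfolding End_multiple_def End_ring_simps by (rule restrict_ext) simp

locale nontrivial_End_algebra =
  nontrivial_scalar_extension "End_ring E" "End_of_int E" "of_int :: int \<Rightarrow> rat"
  for E :: "'a::{field,finite} weierstrass"
begin

lemma zero_tensor: "T \<zero>\<^bsub>End_ring E\<^esub> s = \<zero>\<^bsub>S\<^esub>"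
proof (rule self_add_imp_zero[OF T_closed[OF zero_End]])
  have "\<zero>\<^bsub>End_ring E\<^esub> = \<zero>\<^bsub>End_ring E\<^esub> \<oplus>\<^bsub>End_ring E\<^esub> \<zero>\<^bsub>End_ring E\<^esub>"
    unfolding End_ring_simps by (rule restrict_ext) (simp add: Infinity_add)
  then show "T \<zero>\<^bsub>End_ring E\<^esub> s = T \<zero>\<^bsub>End_ring E\<^esub> s \<oplus>\<^bsub>S\<^esub> T \<zero>\<^bsub>End_ring E\<^esub> s"
    using T_add_left[OF zero_End zero_End] by metis
qed

lemma End_multiple_closed: "End_multiple E m \<in> carrier (End_ring E)"
  by (induction m) (simp_all add: End_multiple_0 End_multiple_Suc zero_End add_closed one_closed)

lemma End_multiple_tensor: "T (End_multiple E m) 1 = T \<one>\<^bsub>End_ring E\<^esub> (of_nat m)"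
proof (induction m)
  case 0
  show ?case by (simp add: End_multiple_0 zero_tensor T_zero_right[OF one_closed])
next
  case (Suc m)
  have "T (End_multiple E (Suc m)) 1 = T \<one>\<^bsub>End_ring E\<^esub> (of_nat m) \<oplus>\<^bsub>S\<^esub> T \<one>\<^bsub>End_ring E\<^esub> 1"
    unfolding End_multiple_Suc T_add_left[OF End_multiple_closed one_closed] Suc ..
  also have "\<dots> = T \<one>\<^bsub>End_ring E\<^esub> (of_nat (Suc m))"
    unfolding T_add_right[OF one_closed, symmetric] by (simp add: add.commute)
  finally show ?case .
qed

lemma End_one_mult: "f \<in> carrier (End_ring E) \<Longrightarrow> \<one>\<^bsub>End_ring E\<^esub> \<otimes>\<^bsub>End_ring E\<^esub> f = f"
  "f \<in> carrier (End_ring E) \<Longrightarrow> f \<otimes>\<^bsub>End_ring E\<^esub> \<one>\<^bsub>End_ring E\<^esub> = f"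
proof -
  assume f: "f \<in> carrier (End_ring E)"
  note * = End_carrierD(1,2)[OF f]
  show "\<one>\<^bsub>End_ring E\<^esub> \<otimes>\<^bsub>End_ring E\<^esub> f = f" "f \<otimes>\<^bsub>End_ring E\<^esub> \<one>\<^bsub>End_ring E\<^esub> = f"
    unfolding End_ring_simps using *
    by (auto intro!: extensionalityI[OF compose_extensional *(1)] simp: compose_eq Pi_iff)
qed

text \<open>
  A nonzero rational is invertible in the algebra, and the algebra is not the zero ring.
\<close>

lemma rational_tensor_nonzero:
  assumes "r \<noteq> 0" shows "T \<one>\<^bsub>End_ring E\<^esub> r \<noteq> \<zero>\<^bsub>S\<^esub>"
proof
  interpret S: ring S by (rule ring_S)
  assume eq: "T \<one>\<^bsub>End_ring E\<^esub> r = \<zero>\<^bsub>S\<^esub>"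
  have "\<one>\<^bsub>S\<^esub> = T \<one>\<^bsub>End_ring E\<^esub> r \<otimes>\<^bsub>S\<^esub> T \<one>\<^bsub>End_ring E\<^esub> (inverse r)"
    unfolding T_mult[OF one_closed one_closed] End_one_mult[OF one_closed] one_S using assms by simp
  also have "\<dots> = \<zero>\<^bsub>S\<^esub>" unfolding eq by (rule S.l_null[OF T_closed[OF one_closed]])
  finally show False using one_not_zero_S by simp
qed

lemma End_multiple_nonzero:
  assumes "0 < m" shows "End_multiple E m \<noteq> \<zero>\<^bsub>End_ring E\<^esub>"
proof
  assume "End_multiple E m = \<zero>\<^bsub>End_ring E\<^esub>"
  then have "T \<one>\<^bsub>End_ring E\<^esub> (of_nat m) = \<zero>\<^bsub>S\<^esub>"
    using End_multiple_tensor[of m] zero_tensor by simp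
  then show False using rational_tensor_nonzero assms by simp
qed

lemma frobenius_tensor_nonzero:
  assumes "elliptic_curve E" shows "T (frobenius E) 1 \<noteq> \<zero>\<^bsub>S\<^esub>"
proof
  interpret S: ring S by (rule ring_S)
  assume eq: "T (frobenius E) 1 = \<zero>\<^bsub>S\<^esub>"
  obtain V n where V: "V \<in> carrier (End_ring E)"
    "frobenius E \<otimes>\<^bsub>End_ring E\<^esub> V = End_multiple E CHAR('a) [^]\<^bsub>End_ring E\<^esub> (n :: nat)"
    by (rule Verschiebung_exists[OF assms End_multiple_closed End_multiple_nonzero])
  have pow: "End_multiple E m [^]\<^bsub>End_ring E\<^esub> k \<in> carrier (End_ring E) \<and>
    T (End_multiple E m [^]\<^bsub>End_ring E\<^esub> k) 1 = T \<one>\<^bsub>End_ring E\<^esub> (of_nat (m ^ k))" for m and k :: nat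
  proof (induction k)
    case 0
    show ?case by (simp add: nat_pow_def one_closed)
  next
    case (Suc k)
    note Suc_pow = End_pow_Suc[of E "End_multiple E m" k]
    have IH: "End_multiple E m [^]\<^bsub>End_ring E\<^esub> k \<in> carrier (End_ring E)"
      "T (End_multiple E m [^]\<^bsub>End_ring E\<^esub> k) 1 = T \<one>\<^bsub>End_ring E\<^esub> (of_nat (m ^ k))" using Suc by blast+
    have "T (End_multiple E m [^]\<^bsub>End_ring E\<^esub> Suc k) 1
      = T (End_multiple E m [^]\<^bsub>End_ring E\<^esub> k) 1 \<otimes>\<^bsub>S\<^esub> T (End_multiple E m) 1"
      unfolding Suc_pow T_mult[OF IH(1) End_multiple_closed] by simp
    also have "\<dots> = T \<one>\<^bsub>End_ring E\<^esub> (of_nat (m ^ Suc k))"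
      unfolding IH(2) End_multiple_tensor T_mult[OF one_closed one_closed] End_one_mult[OF one_closed]
      by (simp add: mult.commute)
    finally show ?case unfolding Suc_pow using mult_closed[OF IH(1) End_multiple_closed] by blast
  qed
  have "T \<one>\<^bsub>End_ring E\<^esub> (of_nat (CHAR('a) ^ n)) = T (frobenius E) 1 \<otimes>\<^bsub>S\<^esub> T V 1"
    unfolding T_mult[OF frobenius_End[OF refl] V(1)] V(2) using pow by simp
  also have "\<dots> = \<zero>\<^bsub>S\<^esub>" unfolding eq by (rule S.l_null[OF T_closed[OF V(1)]])
  finally show False
    using rational_tensor_nonzero[of "of_nat (CHAR('a) ^ n)"] prime_gt_0_nat[OF prime_CHAR_finite[where 'a = 'a]] by simp
qed

end

theorem proposition4p3p1:
  fixes E :: "'a::{field,finite} weierstrass"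
    and \<sigma> :: "'a End_algebra_elem \<Rightarrow> 'a End_algebra_elem"
  assumes "elliptic_curve E"
    and "spinorial_type E"
    and "spin_structure TYPE('k::field_char_0) E \<sigma>"
  shows "similitude (End_algebra E) (End_algebra_of_rat E) \<sigma> (End_to_End_algebra E (frobenius E))"
proof -
  obtain \<sigma>' x where \<sigma>': "involution_first_kind (End_algebra E) \<sigma>'" "x \<in> carrier (End_algebra E)" "\<sigma>' x \<noteq> x"
    using assms(2) unfolding spinorial_type_def by blast
  have "\<sigma>' \<in> carrier (End_algebra E) \<rightarrow> carrier (End_algebra E)"
    using \<sigma>'(1) unfolding involution_first_kind_def by (rule conjunct1)
  then have \<sigma>'x: "\<sigma>' x \<in> carrier (End_algebra E)" using \<sigma>'(2) by (rule funcset_mem)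
  interpret B: nontrivial_End_algebra E
  proof
    fix t
    show "\<not> carrier (scalar_extension (End_ring E) (End_of_int E) (of_int :: int \<Rightarrow> rat)) \<subseteq> {t}"
      unfolding End_algebra_def[symmetric]
    proof
      assume sub: "carrier (End_algebra E) \<subseteq> {t}"
      then show False using subsetD[OF sub \<sigma>'(2)] subsetD[OF sub \<sigma>'x] \<sigma>'(3) by simp
    qed
  qed
  have S: "End_algebra E = B.S" by (simp add: End_algebra_def)
  define i where "i = End_algebra_of_rat E"
  have i: "i r = B.T \<one>\<^bsub>End_ring E\<^esub> r" for r by (simp add: i_def End_algebra_of_rat_def)
  have i_mult: "i (r * s) = i r \<otimes>\<^bsub>B.S\<^esub> i s" for r s
    unfolding i B.T_mult[OF B.one_closed B.one_closed] B.End_one_mult[OF B.one_closed] ..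
  obtain n and \<phi> :: "('a End_algebra_elem \<times> 'k \<Rightarrow>\<^sub>0 int) set \<Rightarrow> 'k mat" where split: "splitting B.S i n \<phi>"
    and \<sigma>: "involution_first_kind B.S \<sigma>"
    using assms(3) unfolding spin_structure_def orthogonal_involution_def S i_def[symmetric] by blast
  interpret Q: split_rational_algebra B.S i n \<phi>
  proof (rule split_rational_algebra.intro[OF B.ring_S], unfold_locales)
    show "i c \<in> carrier B.S" for c unfolding i by (rule B.T_closed[OF B.one_closed])
    show "i (c + d) = i c \<oplus>\<^bsub>B.S\<^esub> i d" for c d unfolding i by (rule B.T_add_right[OF B.one_closed])
    show "i (c * d) = i c \<otimes>\<^bsub>B.S\<^esub> i d" for c d by (rule i_mult)
    show "i 1 = \<one>\<^bsub>B.S\<^esub>" unfolding i B.one_S ..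
    show "i c \<otimes>\<^bsub>B.S\<^esub> y = y \<otimes>\<^bsub>B.S\<^esub> i c" if "y \<in> carrier B.S" for y c
      using B.central_T[OF B.one_closed, of c] that B.End_one_mult by (simp add: i center_def)
    show "splitting B.S i n \<phi>" by (rule split)
  qed
  let ?z = "B.T (frobenius E) 1"
  have z: "?z \<in> center B.S"
    by (rule B.central_T[OF frobenius_End[OF refl] frobenius_commutes[OF refl]])
  obtain r where r: "?z = i r" using Q.center_eq_rationals[OF z] by blast
  have "r \<noteq> 0"
  proof
    assume "r = 0"
    then have "?z = \<zero>\<^bsub>B.S\<^esub>" unfolding r i by (simp add: B.T_zero_right[OF B.one_closed])
    with B.frobenius_tensor_nonzero[OF assms(1)] show False ..
  qed
  moreover have "\<sigma> ?z = ?z" using \<sigma> z unfolding involution_first_kind_def by blast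
  then have "\<sigma> ?z \<otimes>\<^bsub>B.S\<^esub> ?z = i (r * r)" unfolding r i_mult by simp
  moreover have "End_to_End_algebra E (frobenius E) = ?z" by (simp add: End_to_End_algebra_def)
  moreover have "?z \<in> carrier B.S" using z by (simp add: center_def)
  ultimately show ?thesis
    unfolding similitude_def S i_def[symmetric] by auto
qed

end
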